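(* Let $A:\Delta\times\Omega\to\mathbb R^{n\times n}$ and $B:[0,T]\times\Omega\to\mathbb R^{n\times n}$ be uniformly bounded, with $B(\cdot)$ $\mathbb F$-progressively measurable, for each $t\in[0,T]$, $s\mapsto A(t,s)$ $\mathbb F$-progressively measurable, and for each $s\in[0,T]$, $t\mapsto A(t,s)$ continuous. Moreover, suppose $$A(t,s)\in\mathbb R^{n\times n}_{*+},\qquad(t,s)\in\Delta,\ \text{a.s.},$$ $$A(t,s)-A(\tau,s)\in\mathbb R^{n\times n}_+,\qquad0\le t\le\tau\le s\le T,\ \text{a.s.},$$ $$B(s)\in\mathbb R^{n\times n}_d,\qquad s\in[0,T],\ \text{a.s.}$$ Then for any $\psi(\cdot)\in C_{\mathcal F_T}([0,T];L^2(\Omega;\mathbb R^n))$ with $$\psi(t)\ge\psi(s)\ge0,\qquad0\le t\le s\le T,\ \text{a.s.},$$ the adapted solution $(Y(\cdot),Z(\cdot,\cdot))$ of the linear backward stochastic Volterra integral equation $$Y(t)=\psi(t)+\int_t^T\big[A(t,s)Y(s)+B(s)Z(t,s)\big]ds-\int_t^TZ(t,s)dW(s),\qquad t\in[0,T],$$ satisfies $$Y(t)\ge0,\qquad t\in[0,T],\ \text{a.s.}$$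
   Context: $T>0$ and $n\ge1$ are fixed. $(\Omega,\mathcal F,\mathbb F,\mathbb P)$ is a complete filtered probability space carrying a one-dimensional standard Brownian motion $W(\cdot)$, and $\mathbb F=\{\mathcal F_t\}_{t\ge0}$ is the natural filtration of $W$ augmented by all $\mathbb P$-null sets. $\Delta=\{(t,s)\in[0,T]^2:t\le s\}$. For $x,y\in\mathbb R^n$, $x\ge y$ means componentwise inequality. $\mathbb R^{n\times n}_+$ is the set of $n\times n$ real matrices with all entries nonnegative; $\mathbb R^{n\times n}_{*+}$ is the set of $n\times n$ real matrices whose off-diagonal entries are all nonnegative (no condition on the diagonal); $\mathbb R^{n\times n}_d$ is the set of diagonal $n\times n$ real matrices. $C_{\mathcal F_T}([0,T];L^2(\Omega;\mathbb R^n))$ is the set of maps $\psi:[0,T]\to L^2_{\mathcal F_T}(\Omega;\mathbb R^n)$ that are continuous (each $\psi(t)$ is $\mathcal F_T$-measurable, not necessarily $\mathcal F_t$-measurable). $\mathcal H^2_\Delta[0,T]=L^2_{\mathbb F}(0,T;\mathbb R^n)\times L^2_{\mathbb F}(\Delta;\mathbb R^n)$, where $L^2_{\mathbb F}(0,T;\mathbb R^n)$ is the set of $\mathbb F$-adapted $Y$ with $\mathbb E\int_0^T|Y(t)|^2dt<\infty$, and $L^2_{\mathbb F}(\Delta;\mathbb R^n)$ is the set of $Z:\Delta\times\Omega\to\mathbb R^n$ such that $s\mapsto Z(t,s)$ is $\mathbb F$-progressively measurable on $[t,T]$ for every $t\in[0,T]$ and $\int_0^T\mathbb E\int_t^T|Z(t,s)|^2ds\,dt<\infty$.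 An adapted solution is a pair in $\mathcal H^2_\Delta[0,T]$ satisfying the equation in the Itô sense; under the stated hypotheses it exists and is unique. As $Y$ is an element of $L^2_{\mathbb F}(0,T;\mathbb R^n)$, inequalities for it are understood for a.e. $t$, a.s. *)

theory Defs
  imports "HOL-Probability.Probability"
begin

definition standard_brownian_motion :: "'w measure \<Rightarrow> (real \<Rightarrow> 'w \<Rightarrow> real) \<Rightarrow> bool" where
  "standard_brownian_motion M W \<longleftrightarrow>
     (\<forall>t\<ge>0. W t \<in> borel_measurable M) \<and>
     (AE \<omega> in M. W 0 \<omega> = 0) \<and>
     (\<forall>s t. 0 \<le> s \<and> s < t \<longrightarrow>
        distributed M lborel (\<lambda>\<omega>. W t \<omega> - W s \<omega>) (normal_density 0 (sqrt (t - s)))) \<and>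
     (\<forall>(\<tau>::nat \<Rightarrow> real) k. 0 \<le> \<tau> 0 \<and> (\<forall>i<k. \<tau> i \<le> \<tau> (Suc i)) \<longrightarrow>
        prob_space.indep_vars M (\<lambda>_. borel) (\<lambda>i \<omega>. W (\<tau> (Suc i)) \<omega> - W (\<tau> i) \<omega>) {..<k}) \<and>
     (AE \<omega> in M. continuous_on {0..} (\<lambda>t. W t \<omega>))"

definition augmented_filtration :: "'w measure \<Rightarrow> (real \<Rightarrow> 'w \<Rightarrow> real) \<Rightarrow> real \<Rightarrow> 'w measure" where
  "augmented_filtration M W t =
     sigma (space M)
       ({W s -` S \<inter> space M | s S. 0 \<le> s \<and> s \<le> t \<and> S \<in> sets borel} \<union> null_sets M)"

definition prog_measurable_on ::
  "(real \<Rightarrow> 'w measure) \<Rightarrow> real \<Rightarrow> real \<Rightarrow> (real \<Rightarrow> 'w \<Rightarrow> 'b::topological_space) \<Rightarrow> bool" where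
  "prog_measurable_on F a b X \<longleftrightarrow>
     (\<forall>u\<in>{a..b}. (\<lambda>(s, \<omega>). X s \<omega>) \<in> borel_measurable (restrict_space borel {a..u} \<Otimes>\<^sub>M F u))"

text \<open>
  A simple integrand on \<open>[a, b]\<close> is given by a partition
  \<open>a = \<tau> 0 \<le> \<dots> \<le> \<tau> k = b\<close> and bounded coefficients \<open>\<xi> i\<close>, measurable with respect to \<open>F (\<tau> i)\<close>;
  its value on \<open>(\<tau> i, \<tau> (i+1)]\<close> is \<open>\<xi> i\<close>.
\<close>

definition simple_integrand ::
  "'w measure \<Rightarrow> (real \<Rightarrow> 'w measure) \<Rightarrow> real \<Rightarrow> real \<Rightarrow> nat \<Rightarrow> (nat \<Rightarrow> real)
    \<Rightarrow> (nat \<Rightarrow> 'w \<Rightarrow> 'b::euclidean_space) \<Rightarrow> bool" where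
  "simple_integrand M F a b k \<tau> \<xi> \<longleftrightarrow>
     \<tau> 0 = a \<and> \<tau> k = b \<and> (\<forall>i<k. \<tau> i \<le> \<tau> (Suc i)) \<and>
     (\<forall>i<k. \<xi> i \<in> borel_measurable (F (\<tau> i)) \<and> (\<exists>c. \<forall>\<omega>\<in>space M. norm (\<xi> i \<omega>) \<le> c))"

definition simple_value ::
  "nat \<Rightarrow> (nat \<Rightarrow> real) \<Rightarrow> (nat \<Rightarrow> 'w \<Rightarrow> 'b::euclidean_space) \<Rightarrow> real \<Rightarrow> 'w \<Rightarrow> 'b" where
  "simple_value k \<tau> \<xi> s \<omega> = (\<Sum>i<k. indicator {\<tau> i<..\<tau> (Suc i)} s *\<^sub>R \<xi> i \<omega>)"

definition simple_ito ::
  "(real \<Rightarrow> 'w \<Rightarrow> real) \<Rightarrow> nat \<Rightarrow> (nat \<Rightarrow> real) \<Rightarrow> (nat \<Rightarrow> 'w \<Rightarrow> 'b::euclidean_space) \<Rightarrow> 'w \<Rightarrow> 'b" where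
  "simple_ito W k \<tau> \<xi> \<omega> = (\<Sum>i<k. (W (\<tau> (Suc i)) \<omega> - W (\<tau> i) \<omega>) *\<^sub>R \<xi> i \<omega>)"

text \<open>
  \<open>J\<close> is (a version of) the integral of \<open>H\<close> against \<open>W\<close> over \<open>[a, b]\<close>: the \<open>L\<^sup>2\<close>-limit of the
  integrals of simple integrands converging to \<open>H\<close> in \<open>L\<^sup>2([a, b] \<times> \<Omega>)\<close>. By the isometry for
  simple integrands, \<open>J\<close> is determined up to null sets.
\<close>

definition has_ito_integral ::
  "'w measure \<Rightarrow> (real \<Rightarrow> 'w measure) \<Rightarrow> (real \<Rightarrow> 'w \<Rightarrow> real) \<Rightarrow> real \<Rightarrow> real
    \<Rightarrow> (real \<Rightarrow> 'w \<Rightarrow> 'b::euclidean_space) \<Rightarrow> ('w \<Rightarrow> 'b) \<Rightarrow> bool" where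
  "has_ito_integral M F W a b H J \<longleftrightarrow>
     J \<in> borel_measurable M \<and>
     (\<exists>k \<tau> \<xi>.
        (\<forall>m::nat. simple_integrand M F a b (k m) (\<tau> m) (\<xi> m)) \<and>
        (\<lambda>m. \<integral>\<^sup>+\<omega>. (\<integral>\<^sup>+s\<in>{a..b}.
            ennreal ((norm (simple_value (k m) (\<tau> m) (\<xi> m) s \<omega> - H s \<omega>))\<^sup>2) \<partial>lborel) \<partial>M)
          \<longlonglongrightarrow> 0 \<and>
        (\<lambda>m. \<integral>\<^sup>+\<omega>. ennreal ((norm (simple_ito W (k m) (\<tau> m) (\<xi> m) \<omega> - J \<omega>))\<^sup>2) \<partial>M)
          \<longlonglongrightarrow> 0)"

definition L2_rv :: "'w measure \<Rightarrow> 'w measure \<Rightarrow> ('w \<Rightarrow> 'b::euclidean_space) set" where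
  "L2_rv M G =
     {X. X \<in> borel_measurable G \<and> (\<integral>\<^sup>+\<omega>. ennreal ((norm (X \<omega>))\<^sup>2) \<partial>M) < \<infinity>}"

definition continuous_L2_maps ::
  "'w measure \<Rightarrow> 'w measure \<Rightarrow> real \<Rightarrow> (real \<Rightarrow> 'w \<Rightarrow> 'b::euclidean_space) set" where
  "continuous_L2_maps M G T =
     {\<psi>. (\<forall>t\<in>{0..T}. \<psi> t \<in> L2_rv M G) \<and>
         (\<forall>t\<in>{0..T}. ((\<lambda>s. \<integral>\<^sup>+\<omega>. ennreal ((norm (\<psi> s \<omega> - \<psi> t \<omega>))\<^sup>2) \<partial>M) \<longlongrightarrow> 0)
                        (at t within {0..T}))}"

text \<open>Processes are taken to be jointly measurable, so that the time integrals make sense.\<close>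

definition L2_adapted ::
  "'w measure \<Rightarrow> (real \<Rightarrow> 'w measure) \<Rightarrow> real \<Rightarrow> (real \<Rightarrow> 'w \<Rightarrow> 'b::euclidean_space) set" where
  "L2_adapted M F T =
     {Y. (\<lambda>(t, \<omega>). Y t \<omega>) \<in> borel_measurable (restrict_space borel {0..T} \<Otimes>\<^sub>M M) \<and>
         (\<forall>t\<in>{0..T}. Y t \<in> borel_measurable (F t)) \<and>
         (\<integral>\<^sup>+\<omega>. (\<integral>\<^sup>+t\<in>{0..T}. ennreal ((norm (Y t \<omega>))\<^sup>2) \<partial>lborel) \<partial>M) < \<infinity>}"

text \<open>
  Only the measurability of \<open>t \<mapsto> E \<integral>\<^sub>t\<^sup>T |Z(t,s)|\<^sup>2 ds\<close> is demanded, which is what the outer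
  integral needs; it follows if \<open>Z\<close> is jointly measurable in all its arguments.
\<close>

definition L2_adapted_triangle ::
  "'w measure \<Rightarrow> (real \<Rightarrow> 'w measure) \<Rightarrow> real
    \<Rightarrow> (real \<Rightarrow> real \<Rightarrow> 'w \<Rightarrow> 'b::euclidean_space) set" where
  "L2_adapted_triangle M F T =
     {Z. (\<forall>t\<in>{0..T}. prog_measurable_on F t T (Z t)) \<and>
         (\<lambda>t. \<integral>\<^sup>+\<omega>. (\<integral>\<^sup>+s\<in>{t..T}. ennreal ((norm (Z t s \<omega>))\<^sup>2) \<partial>lborel) \<partial>M)
           \<in> borel_measurable (restrict_space borel {0..T}) \<and>
         (\<integral>\<^sup>+t\<in>{0..T}. (\<integral>\<^sup>+\<omega>. (\<integral>\<^sup>+s\<in>{t..T}. ennreal ((norm (Z t s \<omega>))\<^sup>2) \<partial>lborel) \<partial>M)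
            \<partial>lborel) < \<infinity>}"

definition nonneg_matrices :: "(real^'n^'n) set" where
  "nonneg_matrices = {C. \<forall>i j. 0 \<le> C $ i $ j}"

definition offdiag_nonneg_matrices :: "(real^'n^'n) set" where
  "offdiag_nonneg_matrices = {C. \<forall>i j. i \<noteq> j \<longrightarrow> 0 \<le> C $ i $ j}"

definition diagonal_matrices :: "(real^'n^'n) set" where
  "diagonal_matrices = {C. \<forall>i j. i \<noteq> j \<longrightarrow> C $ i $ j = 0}"

text \<open>
  As \<open>Y\<close> is only determined for almost every \<open>t\<close>, so is the validity of the equation.
  The order on \<open>real^'n\<close> used in the theorem is the library's componentwise order.
\<close>

definition adapted_solution ::
  "'w measure \<Rightarrow> (real \<Rightarrow> 'w measure) \<Rightarrow> (real \<Rightarrow> 'w \<Rightarrow> real) \<Rightarrow> real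
    \<Rightarrow> (real \<Rightarrow> real \<Rightarrow> 'w \<Rightarrow> real^'n^'n) \<Rightarrow> (real \<Rightarrow> 'w \<Rightarrow> real^'n^'n)
    \<Rightarrow> (real \<Rightarrow> 'w \<Rightarrow> real^'n)
    \<Rightarrow> (real \<Rightarrow> 'w \<Rightarrow> real^'n) \<Rightarrow> (real \<Rightarrow> real \<Rightarrow> 'w \<Rightarrow> real^'n) \<Rightarrow> bool" where
  "adapted_solution M F W T A B \<psi> Y Z \<longleftrightarrow>
     Y \<in> L2_adapted M F T \<and> Z \<in> L2_adapted_triangle M F T \<and>
     (AE t in lborel. t \<in> {0..T} \<longrightarrow>
        (\<exists>J. has_ito_integral M F W t T (Z t) J \<and>
             (AE \<omega> in M. Y t \<omega> =
                \<psi> t \<omega> + (LINT s:{t..T}|lborel. A t s \<omega> *v Y s \<omega> + B s \<omega> *v Z t s \<omega>) - J \<omega>)))"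

end

theory Submission
  imports Defs
begin

text \<open>
  One component of the equation reads
  \<open>Y\<^sub>i(t) = \<psi>\<^sub>i(t) + \<integral>\<^sub>t\<^sup>T (A(t,s) Y(s))\<^sub>i ds + \<integral>\<^sub>t\<^sup>T \<beta>(s) Z\<^sub>i(t,s) ds - \<integral>\<^sub>t\<^sup>T Z\<^sub>i(t,s) dW(s)\<close>,
  where \<open>\<beta>\<close> is the \<open>i\<close>-th diagonal entry of \<open>B\<close>: as \<open>B\<close> is diagonal, no other component of \<open>Z\<close>
  occurs. By Girsanov's idea, the last two terms together have mean zero under the density
  \<open>D = exp (\<integral> \<beta> dW - 1/2 \<integral> \<beta>\<^sup>2 ds)\<close>. So \<open>Z\<close> disappears when the equation is tested with \<open>\<eta> = \<zeta> D\<close>, where \<open>D\<close>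
  starts at time \<open>t\<close> and \<open>\<zeta>\<close> is the negative part of \<open>Y\<^sub>i(t)\<close>: for almost every \<open>s \<ge> t\<close>,
  \<open>E[\<eta> Y\<^sub>i(s)] = E[\<eta> \<psi>\<^sub>i(s)] + E[\<eta> \<integral>\<^sub>s\<^sup>T (A(s,r) Y(r))\<^sub>i dr]\<close>.

  The off-diagonal entries of \<open>A\<close> preserve positivity, the diagonal ones need not. If \<open>K\<close> bounds \<open>A\<close>,
  then \<open>A + K I\<close> is entrywise nonnegative, and \<open>y(s) = E[\<eta> Y\<^sub>i(s)]\<close> solves \<open>y(s) + K \<integral>\<^sub>s\<^sup>T y = g(s)\<close> with
  \<open>g(s) = E[\<eta> \<psi>\<^sub>i(s)] + E[\<eta> \<integral>\<^sub>s\<^sup>T ((A(s,r) + K I) Y(r))\<^sub>i dr]\<close>, hence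
  \<open>y(t) = g(t) - K \<integral>\<^sub>t\<^sup>T exp (- K (s - t)) g(s) ds\<close>. Splitting \<open>Y\<close> into its positive and negative parts
  splits \<open>g\<close> into a difference \<open>p - n\<close> of nonnegative functions, and both are nonincreasing: this is
  where the monotonicity of \<open>\<psi>\<close> and of \<open>A\<close> in the first time variable enters. The kernel
  \<open>K exp (- K (s - t))\<close> has mass at most one, so \<open>p\<close> contributes a nonnegative amount to \<open>y(t)\<close>, and
  \<open>y(t) \<ge> - n(t)\<close>. Now \<open>y(t) = E[\<zeta> Y\<^sub>i(t)] = - E[\<zeta>\<^sup>2]\<close>, and by the Cauchy-Schwarz inequality \<open>n(t)\<close> is at most
  a constant times the product of the norm of \<open>\<zeta>\<close> in \<open>L\<^sup>2\<close> and that of the negative part of \<open>Y\<close> on \<open>[t, T]\<close>.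
  So the mean square \<open>q(t)\<close> of the negative part of \<open>Y(t)\<close> satisfies \<open>q(t) \<le> C \<integral>\<^sub>t\<^sup>T q\<close>, and it vanishes by
  Gronwall's lemma.

  Only densities of simple kernels are used. These are products of exponentials of Gaussian
  increments, and all that has to be known about them reduces to integrals over one Gaussian increment
  that is independent of the past. The kernel \<open>\<beta>\<close> is an almost everywhere limit of simple kernels
  \<open>b\<^sub>m\<close> with the same bound (\<open>bounded_progressive_approx\<close>). Testing with the density of \<open>b\<^sub>m\<close> leaves an error
  \<open>E[\<eta> \<integral>\<^sub>s\<^sup>T (\<beta> - b\<^sub>m) Z\<^sub>i(s,r) dr]\<close>; it tends to zero by dominated convergence, because the second moments
  of these densities are bounded uniformly in \<open>m\<close>.

  The steps of this argument are \<open>ito_duality\<close> (Girsanov's idea), \<open>weighted_equation\<close> (the tested equation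
  with its error), \<open>resolvent_lower_bound\<close>, \<open>perturbed_estimate\<close>, \<open>negative_part_estimate\<close> (the limit
  \<open>m \<rightarrow> \<infinity>\<close>) and \<open>backward_Gronwall\<close>.
\<close>

section \<open>Independence of Brownian increments from the past\<close>

lemma sets_vimage_Collect:
  assumes "f \<in> measurable M N" "A \<in> sets N"
  shows "{x \<in> space M. f x \<in> A} \<in> sets M"
proof -
  have "{x \<in> space M. f x \<in> A} = f -` A \<inter> space M" by auto
  then show ?thesis using assms by (simp add: measurable_sets)
qed

locale brownian_space = prob_space M for M :: "'w measure" +
  fixes W :: "real \<Rightarrow> 'w \<Rightarrow> real"
  assumes brownian: "standard_brownian_motion M W"
begin

abbreviation F :: "real \<Rightarrow> 'w measure" where
  "F \<equiv> augmented_filtration M W"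

lemma measurable_W: "0 \<le> t \<Longrightarrow> W t \<in> borel_measurable M"
  using brownian by (auto simp: standard_brownian_motion_def)

lemma space_F [simp]: "space (F t) = space M"
  unfolding augmented_filtration_def by (rule space_measure_of_conv)

lemma sets_F:
  "sets (F t) = sigma_sets (space M)
     ({W s -` S \<inter> space M | s S. 0 \<le> s \<and> s \<le> t \<and> S \<in> sets borel} \<union> null_sets M)"
  unfolding augmented_filtration_def
  by (intro sets_measure_of) (auto dest: sets.sets_into_space)

lemma sets_F_subset: "sets (F t) \<subseteq> sets M"
proof -
  have "{W s -` S \<inter> space M | s S. 0 \<le> s \<and> s \<le> t \<and> S \<in> sets borel} \<union> null_sets M \<subseteq> sets M"
    using measurable_W by (auto intro: measurable_sets)
  then show ?thesis unfolding sets_F by (rule sets.sigma_sets_subset)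
qed

lemma subalgebra_F: "subalgebra M (F t)"
  using sets_F_subset by (simp add: subalgebra_def)

lemma subalgebra_F_mono: "s \<le> t \<Longrightarrow> subalgebra (F t) (F s)"
  unfolding subalgebra_def sets_F by (auto intro!: sigma_sets_subseteq intro: order_trans)


lemma measurable_F_mono: "f \<in> measurable (F s) N \<Longrightarrow> s \<le> t \<Longrightarrow> f \<in> measurable (F t) N"
  using measurable_from_subalg[OF subalgebra_F_mono] .

lemma measurable_F_M: "f \<in> measurable (F s) N \<Longrightarrow> f \<in> measurable M N"
  using measurable_from_subalg[OF subalgebra_F] .

lemma W_adapted:
  assumes "0 \<le> s" "s \<le> t" shows "W s \<in> borel_measurable (F t)"
proof (rule measurableI)
  fix S :: "real set" assume "S \<in> sets borel"
  then show "W s -` S \<inter> space (F t) \<in> sets (F t)"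
    unfolding sets_F space_F using assms by (intro sigma_sets.Basic) auto
qed simp

text \<open>
  Together with the null sets, the cylinders form an intersection-stable generator of the augmented
  \<open>\<sigma>\<close>-algebra, so independence has to be checked on them only.
\<close>

definition cylinders :: "real \<Rightarrow> 'w set set" where
  "cylinders u = {A. \<exists>I S. finite I \<and> I \<subseteq> {0..u} \<and> (\<forall>s\<in>I. S s \<in> sets (borel :: real measure)) \<and>
     A = {\<omega> \<in> space M. \<forall>s\<in>I. W s \<omega> \<in> S s}}"

lemma cylinders_events: "cylinders u \<subseteq> events"
proof
  fix A assume "A \<in> cylinders u"
  then obtain I S where I: "finite I" "I \<subseteq> {0..u}" "\<forall>s\<in>I. S s \<in> sets (borel :: real measure)"
    and A: "A = {\<omega> \<in> space M. \<forall>s\<in>I. W s \<omega> \<in> S s}" unfolding cylinders_def by auto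
  have "\<And>s. s \<in> I \<Longrightarrow> {\<omega> \<in> space M. W s \<omega> \<in> S s} \<in> events"
    using I measurable_W by (intro sets_vimage_Collect[of _ M borel]) auto
  then show "A \<in> events" unfolding A using I(1) by (auto intro: sets.sets_Collect_finite_All)
qed

lemma Int_stable_cylinders: "Int_stable (cylinders u \<union> null_sets M)"
proof (rule Int_stableI)
  fix A B assume A: "A \<in> cylinders u \<union> null_sets M" and B: "B \<in> cylinders u \<union> null_sets M"
  show "A \<inter> B \<in> cylinders u \<union> null_sets M"
  proof (cases "A \<in> null_sets M \<or> B \<in> null_sets M")
    case True
    then have "A \<inter> B \<in> null_sets M"
      using A B cylinders_events[of u] by (auto intro: null_set_Int1 null_set_Int2)
    then show ?thesis by simp
  next
    case False
    with A B obtain I S J S' where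
      I: "finite I" "I \<subseteq> {0..u}" "\<forall>s\<in>I. S s \<in> sets (borel :: real measure)"
         "A = {\<omega> \<in> space M. \<forall>s\<in>I. W s \<omega> \<in> S s}" and
      J: "finite J" "J \<subseteq> {0..u}" "\<forall>s\<in>J. S' s \<in> sets (borel :: real measure)"
         "B = {\<omega> \<in> space M. \<forall>s\<in>J. W s \<omega> \<in> S' s}"
      unfolding cylinders_def by auto
    let ?S = "\<lambda>s. (if s \<in> I then S s else UNIV) \<inter> (if s \<in> J then S' s else UNIV)"
    have "A \<inter> B = {\<omega> \<in> space M. \<forall>s\<in>I \<union> J. W s \<omega> \<in> ?S s}"
      using I J by auto
    moreover have "\<forall>s\<in>I \<union> J. ?S s \<in> sets (borel :: real measure)"
      using I J by auto
    ultimately have "A \<inter> B \<in> cylinders u"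
      unfolding cylinders_def using I(1,2) J(1,2) by (intro CollectI exI[of _ "I \<union> J"] exI[of _ ?S]) auto
    then show ?thesis by simp
  qed
qed

text \<open>
  The time points of the cylinder together with \<open>0\<close>, \<open>u\<close> and \<open>v\<close> form a partition, whose increments are
  independent by assumption. The cylinder is an event about the increments up to \<open>u\<close>, up to the null
  set where \<open>W 0 \<noteq> 0\<close>, and the increment from \<open>u\<close> to \<open>v\<close> is the last one.
\<close>

lemma prob_cylinder_Int_increment:
  assumes u: "0 \<le> u" "u < v" and A: "A \<in> cylinders u" and C: "C \<in> sets (borel :: real measure)"
  shows "prob (A \<inter> {\<omega> \<in> space M. W v \<omega> - W u \<omega> \<in> C}) = prob A * prob {\<omega> \<in> space M. W v \<omega> - W u \<omega> \<in> C}"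
proof -
  obtain I S where I: "finite I" "I \<subseteq> {0..u}" "\<And>s. s\<in>I \<Longrightarrow> S s \<in> sets (borel :: real measure)"
    and A_eq: "A = {\<omega> \<in> space M. \<forall>s\<in>I. W s \<omega> \<in> S s}" using A unfolding cylinders_def by auto
  define L where "L = sorted_list_of_set (I \<union> {0, u})"
  define k where "k = length L"
  define \<tau> where "\<tau> i = (if i < k then L ! i else v)" for i
  have set_L: "set L = I \<union> {0, u}" and L: "sorted L" "distinct L"
    unfolding L_def using I(1) by (auto simp del: sorted_list_of_set_insert_remove sorted_list_of_set.fold_insort_key.insert_remove)
  have "k > 0" unfolding k_def using set_L by (cases L) auto
  have in_range: "x \<in> {0..u}" if "x \<in> set L" for x using that set_L I(2) u by auto
  have L0: "L ! 0 = 0"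
  proof -
    obtain j where "j < k" "L ! j = 0" using set_L k_def by (metis Un_iff in_set_conv_nth insertI1)
    then have "L ! 0 \<le> 0" using L(1) k_def by (metis sorted_nth_mono zero_le)
    moreover have "L ! 0 \<in> set L" using \<open>k > 0\<close> k_def by auto
    ultimately show ?thesis using in_range by fastforce
  qed
  have L_last: "L ! (k - 1) = u"
  proof -
    obtain j where "j < k" "L ! j = u" using set_L k_def
      by (metis Un_iff in_set_conv_nth insertI1 insertI2)
    then have "u \<le> L ! (k - 1)" using L(1) k_def
      by (metis One_nat_def Suc_pred \<open>0 < k\<close> diff_less less_Suc_eq_le less_one sorted_nth_mono)
    moreover have "L ! (k - 1) \<in> set L" using \<open>k > 0\<close> k_def by auto
    ultimately show ?thesis using in_range by fastforce
  qed
  have tau_mono: "\<tau> i \<le> \<tau> (Suc i)" if "i < k" for i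
  proof (cases "Suc i < k")
    case True then show ?thesis unfolding \<tau>_def using L(1) k_def by (auto intro: sorted_nth_mono)
  next
    case False
    then show ?thesis unfolding \<tau>_def using that in_range[of "L ! i"] u k_def by auto
  qed
  define X where "X i \<omega> = W (\<tau> (Suc i)) \<omega> - W (\<tau> i) \<omega>" for i \<omega>
  have "0 \<le> \<tau> 0" using L0 \<open>k > 0\<close> by (simp add: \<tau>_def)
  then have indep: "indep_vars (\<lambda>_. borel) X {..<k}"
    using brownian tau_mono unfolding standard_brownian_motion_def X_def[abs_def] by blast
  have "indep_var (PiM {..<k-1} (\<lambda>_. borel)) (\<lambda>\<omega>. restrict (\<lambda>i. X i \<omega>) {..<k-1})
          (PiM {k-1} (\<lambda>_. borel)) (\<lambda>\<omega>. restrict (\<lambda>i. X i \<omega>) {k-1})"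
    using \<open>k > 0\<close> by (intro indep_var_restrict[OF indep]) auto
  then have ind: "indep_var (PiM {..<k-1} (\<lambda>_. borel)) (\<lambda>\<omega>. restrict (\<lambda>i. X i \<omega>) {..<k-1})
          (PiM {k-1} (\<lambda>_. borel)) (\<lambda>\<omega>. restrict (\<lambda>i. X i \<omega>) {k-1})" .
  have X_last: "X (k - 1) = (\<lambda>\<omega>. W v \<omega> - W u \<omega>)"
    using L_last \<open>k > 0\<close> by (auto simp: X_def \<tau>_def fun_eq_iff)
  have "\<forall>s\<in>I. \<exists>j<k. L ! j = s" using set_L k_def by (metis UnI1 in_set_conv_nth)
  then obtain idx where idx: "\<And>s. s \<in> I \<Longrightarrow> idx s < k" "\<And>s. s \<in> I \<Longrightarrow> L ! idx s = s" by metis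
  \<comment> \<open>the values at the points of \<open>I\<close> are partial sums of the increments, since \<open>W 0 = 0\<close>\<close>
  have part: "W s \<omega> = W 0 \<omega> + (\<Sum>i<idx s. X i \<omega>)" if "s \<in> I" for s \<omega>
  proof -
    have "(\<Sum>i<idx s. X i \<omega>) = W (\<tau> (idx s)) \<omega> - W (\<tau> 0) \<omega>"
      unfolding X_def by (rule sum_lessThan_telescope)
    then show ?thesis using idx[OF that] L0 \<open>k > 0\<close> by (simp add: \<tau>_def)
  qed
  define D where "D = {x \<in> space (PiM {..<k-1} (\<lambda>_. borel)). \<forall>s\<in>I. (\<Sum>i<idx s. x i) \<in> S s}"
  have D: "D \<in> sets (PiM {..<k-1} (\<lambda>_. borel :: real measure))"
    unfolding D_def
  proof (rule sets.sets_Collect_finite_All)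
    fix s assume s: "s \<in> I"
    have "(\<lambda>x. \<Sum>i<idx s. x i) \<in> borel_measurable (PiM {..<k-1} (\<lambda>_. borel :: real measure))"
      using idx(1)[OF s] by (intro borel_measurable_sum measurable_component_singleton) auto
    then show "{x \<in> space (PiM {..<k-1} (\<lambda>_. borel)). (\<Sum>i<idx s. x i) \<in> S s} \<in> sets (PiM {..<k-1} (\<lambda>_. borel))"
      using I(3)[OF s] by (rule sets_vimage_Collect)
  qed (rule I(1))
  let ?V = "\<lambda>\<omega>. restrict (\<lambda>i. X i \<omega>) {..<k-1}"
  have V: "?V \<in> measurable M (PiM {..<k-1} (\<lambda>_. borel))" using ind by (rule indep_var_rv1)
  have inc: "(\<lambda>\<omega>. W v \<omega> - W u \<omega>) \<in> borel_measurable M"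
    using u by (intro borel_measurable_diff measurable_W) auto
  define E where "E = {x \<in> space (PiM {k-1} (\<lambda>_. borel :: real measure)). x (k-1) \<in> C}"
  have E: "E \<in> sets (PiM {k-1} (\<lambda>_. borel :: real measure))"
    unfolding E_def using C by (intro sets_vimage_Collect[of _ _ borel] measurable_component_singleton) auto
  let ?U = "\<lambda>\<omega>. restrict (\<lambda>i. X i \<omega>) {k-1}"
  have UE: "?U -` E \<inter> space M = {\<omega> \<in> space M. W v \<omega> - W u \<omega> \<in> C}"
    unfolding E_def using X_last by (auto simp: space_PiM)
  have VD: "?V -` D \<inter> space M = {\<omega> \<in> space M. \<forall>s\<in>I. (\<Sum>i<idx s. X i \<omega>) \<in> S s}"
  proof -
    have "(\<Sum>i<idx s. ?V \<omega> i) = (\<Sum>i<idx s. X i \<omega>)" if "s \<in> I" for s \<omega>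
      using idx(1)[OF that] by (intro sum.cong) auto
    then show ?thesis unfolding D_def using measurable_space[OF V] by auto
  qed
  have W0: "AE \<omega> in M. W 0 \<omega> = 0" using brownian by (simp add: standard_brownian_motion_def)
  have AE_eq: "AE \<omega> in M. \<omega> \<in> A \<longleftrightarrow> \<omega> \<in> ?V -` D \<inter> space M"
    unfolding VD A_eq using W0 by eventually_elim (auto simp: part)
  have ev: "?V -` D \<inter> space M \<in> events" "A \<in> events"
    using V D cylinders_events A by (auto intro: measurable_sets)
  have C_ev: "{\<omega> \<in> space M. W v \<omega> - W u \<omega> \<in> C} \<in> events"
    using inc C by (rule sets_vimage_Collect)
  have "prob (A \<inter> {\<omega> \<in> space M. W v \<omega> - W u \<omega> \<in> C})
      = prob ((?V -` D \<inter> space M) \<inter> {\<omega> \<in> space M. W v \<omega> - W u \<omega> \<in> C})"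
    using AE_eq ev C_ev by (intro finite_measure_eq_AE) auto
  also have "(?V -` D \<inter> space M) \<inter> {\<omega> \<in> space M. W v \<omega> - W u \<omega> \<in> C}
      = (\<lambda>\<omega>. (?V \<omega>, ?U \<omega>)) -` (D \<times> E) \<inter> space M" unfolding UE[symmetric] by auto
  also have "prob \<dots> = prob (?V -` D \<inter> space M) * prob (?U -` E \<inter> space M)"
    using indep_varD[OF ind D E] by simp
  also have "prob (?V -` D \<inter> space M) = prob A"
    using AE_eq ev by (intro finite_measure_eq_AE) auto
  finally show ?thesis unfolding UE .
qed

lemma increment_indep_F:
  assumes u: "0 \<le> u" "u < v"
  shows "indep_set (sets (F u)) {(\<lambda>\<omega>. W v \<omega> - W u \<omega>) -` A \<inter> space M |A. A \<in> sets borel}"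
proof -
  let ?X = "\<lambda>\<omega>. W v \<omega> - W u \<omega>"
  let ?G = "{?X -` A \<inter> space M |A. A \<in> sets borel}"
  have X: "?X \<in> borel_measurable M" using u by (intro borel_measurable_diff measurable_W) auto
  have *: "indep_set (cylinders u \<union> null_sets M) ?G"
  proof (rule indep_setI)
    show "cylinders u \<union> null_sets M \<subseteq> events" using cylinders_events by auto
    show "?G \<subseteq> events" using X by (auto intro: measurable_sets)
    fix a b assume a: "a \<in> cylinders u \<union> null_sets M" and "b \<in> ?G"
    then obtain C where C: "C \<in> sets borel" and b: "b = ?X -` C \<inter> space M" by auto
    have b': "b = {\<omega> \<in> space M. ?X \<omega> \<in> C}" unfolding b by auto
    have bev: "b \<in> events" using C X b by (auto intro: measurable_sets)
    show "prob (a \<inter> b) = prob a * prob b"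
    proof (cases "a \<in> null_sets M")
      case True
      then have "a \<inter> b \<in> null_sets M" using bev by (rule null_set_Int2)
      with True show ?thesis by (simp add: measure_eq_0_null_sets)
    next
      case False
      with a show ?thesis unfolding b' by (intro prob_cylinder_Int_increment[OF u _ C]) auto
    qed
  qed
  have "Int_stable ?G"
  proof (rule Int_stableI)
    fix a b assume "a \<in> ?G" "b \<in> ?G"
    then obtain A B where "A \<in> sets borel" "B \<in> sets borel" "a = ?X -` A \<inter> space M" "b = ?X -` B \<inter> space M" by auto
    then show "a \<inter> b \<in> ?G" by (intro CollectI exI[of _ "A \<inter> B"]) auto
  qed
  with * have ind: "indep_set (sigma_sets (space M) (cylinders u \<union> null_sets M)) (sigma_sets (space M) ?G)"
    by (intro indep_set_sigma_sets Int_stable_cylinders)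
  have "sets (F u) \<subseteq> sigma_sets (space M) (cylinders u \<union> null_sets M)"
    unfolding sets_F
  proof (rule sigma_sets_subseteq, safe)
    fix s S assume "0 \<le> s" "s \<le> u" "S \<in> sets (borel :: real measure)" "W s -` S \<inter> space M \<notin> null_sets M"
    then show "W s -` S \<inter> space M \<in> cylinders u"
      unfolding cylinders_def by (intro CollectI exI[of _ "{s}"] exI[of _ "\<lambda>_. S"]) auto
  qed
  moreover have "?G \<subseteq> sigma_sets (space M) ?G" by auto
  ultimately show ?thesis
    using ind unfolding indep_set_def
    by (elim indep_sets_mono_sets) (auto split: bool.split)
qed

text \<open>
  The point of keeping the identity as first component is that a function of the whole past can be
  substituted for it: the next two lemmas integrate out the increment while everything known at
  time \<open>u\<close> is frozen.
\<close>

lemma joint_distr_increment: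
  assumes u: "0 \<le> u" "u < v"
  shows "distr M (F u \<Otimes>\<^sub>M borel) (\<lambda>\<omega>. (\<omega>, W v \<omega> - W u \<omega>))
    = distr M (F u) (\<lambda>\<omega>. \<omega>) \<Otimes>\<^sub>M density lborel (normal_density 0 (sqrt (v - u)))"
proof (rule pair_measure_eqI[symmetric])
  let ?X = "\<lambda>\<omega>. W v \<omega> - W u \<omega>"
  let ?N = "density lborel (normal_density 0 (sqrt (v - u)))"
  let ?P = "distr M (F u) (\<lambda>\<omega>. \<omega>)"
  have id: "(\<lambda>\<omega>. \<omega>) \<in> measurable M (F u)" by (rule measurable_F_M[of _ u]) simp
  have X: "?X \<in> borel_measurable M" using u by (intro borel_measurable_diff measurable_W) auto
  interpret N: prob_space ?N using u by (intro prob_space_normal_density) simp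
  interpret P: prob_space ?P using id by (rule prob_space_distr)
  show "sigma_finite_measure ?N" "sigma_finite_measure ?P" by unfold_locales
  show "sets (?P \<Otimes>\<^sub>M ?N) = sets (distr M (F u \<Otimes>\<^sub>M borel) (\<lambda>\<omega>. (\<omega>, ?X \<omega>)))"
    by (simp cong: sets_pair_measure_cong)
  fix A B assume A: "A \<in> sets ?P" and B: "B \<in> sets ?N"
  have "distributed M lborel ?X (normal_density 0 (sqrt (v - u)))"
    using brownian u by (auto simp: standard_brownian_motion_def)
  then have "distr M lborel ?X = ?N" by (simp add: distributed_def)
  then have NB: "emeasure ?N B = prob (?X -` B \<inter> space M)"
    using X B by (metis (no_types, lifting) distributed_measurable[OF \<open>distributed M lborel ?X _\<close>] emeasure_distr
        emeasure_eq_measure sets_density)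
  have PA: "emeasure ?P A = prob A" 
    using A id sets.sets_into_space[of A "F u"] by (simp add: emeasure_distr emeasure_eq_measure Int_absorb2)
  have "A \<subseteq> space M" using A sets.sets_into_space[of A "F u"] by simp
  then have "(\<lambda>\<omega>. (\<omega>, ?X \<omega>)) -` (A \<times> B) \<inter> space M = A \<inter> (?X -` B \<inter> space M)" by auto
  then have "emeasure (distr M (F u \<Otimes>\<^sub>M borel) (\<lambda>\<omega>. (\<omega>, ?X \<omega>))) (A \<times> B)
      = prob (A \<inter> (?X -` B \<inter> space M))"
    using A B id X by (subst emeasure_distr) (auto simp: emeasure_eq_measure)
  also have "prob (A \<inter> (?X -` B \<inter> space M)) = prob A * prob (?X -` B \<inter> space M)"
    using A B by (intro indep_setD[OF increment_indep_F[OF u]]) auto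
  finally show "emeasure ?P A * emeasure ?N B = emeasure (distr M (F u \<Otimes>\<^sub>M borel) (\<lambda>\<omega>. (\<omega>, ?X \<omega>))) (A \<times> B)"
    unfolding NB PA by (simp add: ennreal_mult)
qed

lemma nn_integral_increment:
  assumes u: "0 \<le> u" "u < v" and H: "case_prod H \<in> borel_measurable (F u \<Otimes>\<^sub>M borel)"
  shows "(\<integral>\<^sup>+\<omega>. H \<omega> (W v \<omega> - W u \<omega>) \<partial>M)
    = (\<integral>\<^sup>+\<omega>. (\<integral>\<^sup>+x. ennreal (normal_density 0 (sqrt (v - u)) x) * H \<omega> x \<partial>lborel) \<partial>M)"
proof -
  let ?N = "density lborel (normal_density 0 (sqrt (v - u)))"
  let ?P = "distr M (F u) (\<lambda>\<omega>. \<omega>)"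
  interpret N: prob_space ?N using u by (intro prob_space_normal_density) simp
  have id: "(\<lambda>\<omega>. \<omega>) \<in> measurable M (F u)" by (rule measurable_F_M[of _ u]) simp
  have inc: "(\<lambda>\<omega>. W v \<omega> - W u \<omega>) \<in> borel_measurable M"
    using u by (intro borel_measurable_diff measurable_W) auto
  have H': "case_prod H \<in> borel_measurable (?P \<Otimes>\<^sub>M ?N)"
    using H by (simp cong: measurable_cong_sets)
  have "(\<integral>\<^sup>+\<omega>. H \<omega> (W v \<omega> - W u \<omega>) \<partial>M) = (\<integral>\<^sup>+z. case_prod H z \<partial>distr M (F u \<Otimes>\<^sub>M borel) (\<lambda>\<omega>. (\<omega>, W v \<omega> - W u \<omega>)))"
    using H id inc by (subst nn_integral_distr) auto
  also have "\<dots> = (\<integral>\<^sup>+z. case_prod H z \<partial>(?P \<Otimes>\<^sub>M ?N))"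
    unfolding joint_distr_increment[OF u] ..
  also have "\<dots> = (\<integral>\<^sup>+\<omega>. (\<integral>\<^sup>+x. H \<omega> x \<partial>?N) \<partial>?P)"
    using N.nn_integral_fst[OF H'] by simp
  also have "\<dots> = (\<integral>\<^sup>+\<omega>. (\<integral>\<^sup>+x. H \<omega> x \<partial>?N) \<partial>M)"
    using id N.borel_measurable_nn_integral_fst[OF H'] by (subst nn_integral_distr) auto
  also have "\<dots> = (\<integral>\<^sup>+\<omega>. (\<integral>\<^sup>+x. ennreal (normal_density 0 (sqrt (v - u)) x) * H \<omega> x \<partial>lborel) \<partial>M)"
  proof (rule nn_integral_cong)
    fix \<omega> assume "\<omega> \<in> space M"
    then have "H \<omega> \<in> borel_measurable borel" using measurable_Pair2[OF H] by simp
    then show "(\<integral>\<^sup>+x. H \<omega> x \<partial>?N) = (\<integral>\<^sup>+x. ennreal (normal_density 0 (sqrt (v - u)) x) * H \<omega> x \<partial>lborel)"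
      by (subst nn_integral_density) auto
  qed
  finally show ?thesis .
qed

lemma integral_increment:
  fixes H :: "'w \<Rightarrow> real \<Rightarrow> real"
  assumes u: "0 \<le> u" "u < v" and H: "case_prod H \<in> borel_measurable (F u \<Otimes>\<^sub>M borel)"
    and int: "integrable M (\<lambda>\<omega>. H \<omega> (W v \<omega> - W u \<omega>))"
  shows "(\<integral>\<omega>. H \<omega> (W v \<omega> - W u \<omega>) \<partial>M)
    = (\<integral>\<omega>. (\<integral>x. normal_density 0 (sqrt (v - u)) x * H \<omega> x \<partial>lborel) \<partial>M)"
proof -
  let ?N = "density lborel (normal_density 0 (sqrt (v - u)))"
  let ?P = "distr M (F u) (\<lambda>\<omega>. \<omega>)"
  interpret N: prob_space ?N using u by (intro prob_space_normal_density) simp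
  have id: "(\<lambda>\<omega>. \<omega>) \<in> measurable M (F u)" by (rule measurable_F_M[of _ u]) simp
  interpret P: prob_space ?P using id by (rule prob_space_distr)
  interpret PN: pair_sigma_finite ?P ?N ..
  have inc: "(\<lambda>\<omega>. W v \<omega> - W u \<omega>) \<in> borel_measurable M"
    using u by (intro borel_measurable_diff measurable_W) auto
  have H': "case_prod H \<in> borel_measurable (?P \<Otimes>\<^sub>M ?N)"
    using H by (simp cong: measurable_cong_sets)
  have pair: "(\<lambda>\<omega>. (\<omega>, W v \<omega> - W u \<omega>)) \<in> measurable M (F u \<Otimes>\<^sub>M borel)"
    using id inc by auto
  have "integrable (distr M (F u \<Otimes>\<^sub>M borel) (\<lambda>\<omega>. (\<omega>, W v \<omega> - W u \<omega>))) (case_prod H)"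
    using int H pair by (subst integrable_distr_eq) auto
  then have intPN: "integrable (?P \<Otimes>\<^sub>M ?N) (case_prod H)"
    unfolding joint_distr_increment[OF u] .
  have "(\<integral>\<omega>. H \<omega> (W v \<omega> - W u \<omega>) \<partial>M) = (\<integral>z. case_prod H z \<partial>distr M (F u \<Otimes>\<^sub>M borel) (\<lambda>\<omega>. (\<omega>, W v \<omega> - W u \<omega>)))"
    using H pair by (subst integral_distr) auto
  also have "\<dots> = (\<integral>z. case_prod H z \<partial>(?P \<Otimes>\<^sub>M ?N))"
    unfolding joint_distr_increment[OF u] ..
  also have "\<dots> = (\<integral>\<omega>. (\<integral>x. H \<omega> x \<partial>?N) \<partial>?P)"
    using PN.integral_fst'[OF intPN] by simp
  also have "\<dots> = (\<integral>\<omega>. (\<integral>x. H \<omega> x \<partial>?N) \<partial>M)"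
    using id N.borel_measurable_lebesgue_integral[OF H'] by (subst integral_distr) auto
  also have "\<dots> = (\<integral>\<omega>. (\<integral>x. normal_density 0 (sqrt (v - u)) x * H \<omega> x \<partial>lborel) \<partial>M)"
  proof (rule Bochner_Integration.integral_cong[OF refl])
    fix \<omega> assume "\<omega> \<in> space M"
    then have "H \<omega> \<in> borel_measurable borel" using measurable_Pair2[OF H] by simp
    then show "(\<integral>x. H \<omega> x \<partial>?N) = (\<integral>x. normal_density 0 (sqrt (v - u)) x * H \<omega> x \<partial>lborel)"
      by (subst integral_density) auto
  qed
  finally show ?thesis .
qed

end

section \<open>Square-integrable functions\<close>

definition square_integrable :: "'a measure \<Rightarrow> ('a \<Rightarrow> real) \<Rightarrow> bool" where
  "square_integrable M f \<longleftrightarrow> f \<in> borel_measurable M \<and> integrable M (\<lambda>x. (f x)\<^sup>2)"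

lemma square_integrable_mult:
  assumes "square_integrable M f" "square_integrable M g"
  shows "integrable M (\<lambda>x. f x * g x)"
proof (rule Bochner_Integration.integrable_bound)
  show "integrable M (\<lambda>x. (f x)\<^sup>2 + (g x)\<^sup>2)" using assms by (simp add: square_integrable_def)
  show "(\<lambda>x. f x * g x) \<in> borel_measurable M" using assms by (auto simp: square_integrable_def intro!: borel_measurable_times)
  have "\<bar>a * b\<bar> \<le> a\<^sup>2 + b\<^sup>2" for a b :: real
  proof -
    have "\<bar>a * b\<bar> * 2 \<le> a\<^sup>2 + b\<^sup>2"
      using sum_squares_bound[of "\<bar>a\<bar>" "\<bar>b\<bar>"] by (simp add: abs_mult ac_simps)
    then show ?thesis by linarith
  qed
  then show "AE x in M. norm (f x * g x) \<le> norm ((f x)\<^sup>2 + (g x)\<^sup>2)" by simp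
qed

lemma square_integrable_add:
  assumes "square_integrable M f" "square_integrable M g"
  shows "square_integrable M (\<lambda>x. f x + g x)"
proof -
  have "integrable M (\<lambda>x. (f x)\<^sup>2 + (g x)\<^sup>2 + 2 * (f x * g x))"
    using assms square_integrable_mult[OF assms] by (simp add: square_integrable_def)
  then show ?thesis using assms
    by (auto simp: square_integrable_def power2_sum mult.assoc intro!: borel_measurable_add)
qed

lemma square_integrable_cmult: "square_integrable M f \<Longrightarrow> square_integrable M (\<lambda>x. c * f x)"
  unfolding square_integrable_def power_mult_distrib
  by (intro conjI borel_measurable_times borel_measurable_const integrable_mult_right) auto

lemma square_integrable_diff:
  assumes "square_integrable M f" "square_integrable M g"
  shows "square_integrable M (\<lambda>x. f x - g x)"
  using square_integrable_add[OF assms(1) square_integrable_cmult[OF assms(2), of "-1"]] by simp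

lemma square_integrable_sum:
  assumes "\<And>i. i \<in> I \<Longrightarrow> square_integrable M (f i)"
  shows "square_integrable M (\<lambda>x. \<Sum>i\<in>I. f i x)"
  using assms
proof (induction I rule: infinite_finite_induct)
  case (insert i I)
  then show ?case by (simp add: square_integrable_add)
qed (simp_all add: square_integrable_def)

lemma square_integrable_dominated:
  assumes f: "square_integrable M f" and g: "g \<in> borel_measurable M"
    and le: "AE x in M. \<bar>g x\<bar> \<le> \<bar>f x\<bar>"
  shows "square_integrable M g"
  unfolding square_integrable_def
proof (rule conjI[OF g Bochner_Integration.integrable_bound[of M "\<lambda>x. (f x)\<^sup>2"]])
  show "AE x in M. norm ((g x)\<^sup>2) \<le> norm ((f x)\<^sup>2)"
    using le by eventually_elim (metis abs_le_square_iff abs_power2 real_norm_def)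
  show "integrable M (\<lambda>x. (f x)\<^sup>2)" using f by (simp add: square_integrable_def)
  show "(\<lambda>x. (g x)\<^sup>2) \<in> borel_measurable M" using g by simp
qed

lemma square_integrable_bounded_mult:
  assumes f: "square_integrable M f" and g: "g \<in> borel_measurable M"
    and b: "\<And>x. x \<in> space M \<Longrightarrow> \<bar>g x\<bar> \<le> c"
  shows "square_integrable M (\<lambda>x. g x * f x)"
proof (rule square_integrable_dominated[OF square_integrable_cmult[OF f, of c]])
  show "(\<lambda>x. g x * f x) \<in> borel_measurable M" using f g by (auto simp: square_integrable_def intro!: borel_measurable_times)
  show "AE x in M. \<bar>g x * f x\<bar> \<le> \<bar>c * f x\<bar>"
  proof (rule AE_I2)
    fix x assume "x \<in> space M"
    then have "\<bar>g x\<bar> \<le> \<bar>c\<bar>" using b[of x] by linarith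
    then show "\<bar>g x * f x\<bar> \<le> \<bar>c * f x\<bar>" by (simp add: abs_mult mult_right_mono)
  qed
qed

lemma square_integrable_nn_iff:
  assumes "f \<in> borel_measurable M"
  shows "square_integrable M f \<longleftrightarrow> (\<integral>\<^sup>+x. ennreal ((f x)\<^sup>2) \<partial>M) < \<infinity>"
  unfolding square_integrable_def integrable_iff_bounded using assms by simp

lemma Cauchy_Schwarz_integral:
  assumes f: "square_integrable M f" and g: "square_integrable M g"
  shows "\<bar>\<integral>x. f x * g x \<partial>M\<bar> \<le> sqrt (\<integral>x. (f x)\<^sup>2 \<partial>M) * sqrt (\<integral>x. (g x)\<^sup>2 \<partial>M)"
proof -
  let ?A = "\<integral>x. (f x)\<^sup>2 \<partial>M" and ?B = "\<integral>x. f x * g x \<partial>M" and ?C = "\<integral>x. (g x)\<^sup>2 \<partial>M"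
  note int = square_integrable_mult[OF f g]
  have sq: "integrable M (\<lambda>x. (f x)\<^sup>2)" "integrable M (\<lambda>x. (g x)\<^sup>2)"
    using f g by (auto simp: square_integrable_def)
  \<comment> \<open>the quadratic polynomial \<open>l \<mapsto> \<integral> (f - l g)\<^sup>2\<close> is nonnegative; its minimum, at \<open>l = ?B / ?C\<close>, gives the claim\<close>
  have quad: "0 \<le> ?A - 2 * l * ?B + l\<^sup>2 * ?C" for l :: real
  proof -
    have "0 \<le> (\<integral>x. (f x - l * g x)\<^sup>2 \<partial>M)" by simp
    also have "(\<lambda>x. (f x - l * g x)\<^sup>2) = (\<lambda>x. (f x)\<^sup>2 - 2 * l * (f x * g x) + l\<^sup>2 * (g x)\<^sup>2)"
      by (auto simp: fun_eq_iff power2_eq_square algebra_simps)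
    also have "integral\<^sup>L M \<dots> = ?A - 2 * l * ?B + l\<^sup>2 * ?C"
      using int sq by simp
    finally show ?thesis .
  qed
  have C0: "0 \<le> ?C" by simp
  have "?B\<^sup>2 \<le> ?A * ?C"
  proof (cases "?C = 0")
    case True
    have "?B = 0"
    proof (rule ccontr)
      assume B: "?B \<noteq> 0"
      \<comment> \<open>if \<open>?C = 0\<close>, the polynomial is affine, and negative at this point\<close>
      show False using quad[of "(?A + 1) / (2 * ?B)"] True B by (simp add: field_simps)
    qed
    then show ?thesis using True by simp
  next
    case False
    with C0 have C: "?C > 0" by linarith
    have "0 \<le> ?A - 2 * (?B / ?C) * ?B + (?B / ?C)\<^sup>2 * ?C" by (rule quad)
    also have "\<dots> = ?A - ?B\<^sup>2 / ?C" using C by (simp add: power2_eq_square field_simps)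
    finally show ?thesis using C by (simp add: field_simps)
  qed
  then have "sqrt (?B\<^sup>2) \<le> sqrt (?A * ?C)" by (rule real_sqrt_le_mono)
  then show ?thesis by (simp add: real_sqrt_mult)
qed

section \<open>Exponential densities of simple kernels\<close>

text \<open>
  The density of the normal distribution with mean \<open>\<beta> d\<close> and variance \<open>d\<close> with respect to the one with
  mean \<open>0\<close> and variance \<open>d\<close>.
\<close>

definition gauss_exp :: "real \<Rightarrow> real \<Rightarrow> real \<Rightarrow> real" where
  "gauss_exp d \<beta> x = exp (\<beta> * x - \<beta>\<^sup>2 * d / 2)"

lemma normal_density_gauss_exp:
  assumes "0 < d"
  shows "normal_density 0 (sqrt d) x * gauss_exp d \<beta> x = normal_density (\<beta> * d) (sqrt d) x"
proof -
  have "- x\<^sup>2 / (2 * d) + (\<beta> * x - \<beta>\<^sup>2 * d / 2) = - (x - \<beta> * d)\<^sup>2 / (2 * d)"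
    using assms by (simp add: field_simps power2_eq_square)
  then show ?thesis
    using assms by (simp add: normal_density_def gauss_exp_def flip: exp_add)
qed

lemma gauss_exp_power:
  "(gauss_exp d \<beta> x) ^ p = exp (real p * (real p - 1) / 2 * (\<beta>\<^sup>2 * d)) * gauss_exp d (real p * \<beta>) x"
proof -
  have "real p * (\<beta> * x - \<beta>\<^sup>2 * d / 2)
    = real p * (real p - 1) / 2 * (\<beta>\<^sup>2 * d) + (real p * \<beta> * x - (real p * \<beta>)\<^sup>2 * d / 2)"
    by (simp add: power2_eq_square field_simps)
  then show ?thesis unfolding gauss_exp_def exp_of_nat_mult[symmetric] exp_add[symmetric] by simp
qed

lemma nn_integral_normal_density: "0 < s \<Longrightarrow> (\<integral>\<^sup>+x. ennreal (normal_density m s x) \<partial>lborel) = 1"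
  by (subst nn_integral_eq_integral) auto

lemma nn_integral_gauss_exp:
  assumes "0 < d"
  shows "(\<integral>\<^sup>+x. ennreal (normal_density 0 (sqrt d) x) * ennreal (gauss_exp d \<beta> x) \<partial>lborel) = 1"
  using nn_integral_normal_density[of "sqrt d" "\<beta> * d"] assms
  by (simp add: normal_density_gauss_exp flip: ennreal_mult')

lemma nn_integral_gauss_exp_power:
  assumes "0 < d"
  shows "(\<integral>\<^sup>+x. ennreal (normal_density 0 (sqrt d) x) * ennreal ((gauss_exp d \<beta> x) ^ p) \<partial>lborel)
    = ennreal (exp (real p * (real p - 1) / 2 * (\<beta>\<^sup>2 * d)))"
proof -
  let ?c = "ennreal (exp (real p * (real p - 1) / 2 * (\<beta>\<^sup>2 * d)))"
  have "(\<integral>\<^sup>+x. ennreal (normal_density 0 (sqrt d) x) * ennreal ((gauss_exp d \<beta> x) ^ p) \<partial>lborel)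
     = (\<integral>\<^sup>+x. ?c * (ennreal (normal_density 0 (sqrt d) x) * ennreal (gauss_exp d (real p * \<beta>) x)) \<partial>lborel)"
    by (intro nn_integral_cong) (simp add: gauss_exp_power ennreal_mult' mult.left_commute)
  also have "\<dots> = ?c * (\<integral>\<^sup>+x. ennreal (normal_density 0 (sqrt d) x) * ennreal (gauss_exp d (real p * \<beta>) x) \<partial>lborel)"
    by (rule nn_integral_cmult) (simp add: gauss_exp_def[abs_def])
  finally show ?thesis using assms by (simp add: nn_integral_gauss_exp)
qed

lemma integral_gauss_exp_centered:
  assumes "0 < d"
  shows "(\<integral>x. normal_density 0 (sqrt d) x * (gauss_exp d \<beta> x * (w + x - \<beta> * d)) \<partial>lborel) = w"
proof -
  have s: "0 < sqrt d" using assms by simp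
  have "(\<integral>x. normal_density 0 (sqrt d) x * (gauss_exp d \<beta> x * (w + x - \<beta> * d)) \<partial>lborel)
    = (\<integral>x. (w - \<beta> * d) * normal_density (\<beta> * d) (sqrt d) x + normal_density (\<beta> * d) (sqrt d) x * x \<partial>lborel)"
    by (intro Bochner_Integration.integral_cong refl)
       (simp add: normal_density_gauss_exp[OF assms, symmetric] algebra_simps)
  also have "\<dots> = (w - \<beta> * d) + \<beta> * d"
    using s integral_normal_moment_nz_1[OF s] integrable_normal_moment_nz_1[OF s] by simp
  finally show ?thesis by simp
qed

lemma partition_mono:
  fixes \<tau> :: "nat \<Rightarrow> real"
  assumes "\<forall>i<k. \<tau> i \<le> \<tau> (Suc i)" "i \<le> j" "j \<le> k"
  shows "\<tau> i \<le> \<tau> j"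
  using assms(2,3)
proof (induction rule: dec_induct)
  case (step n)
  then have "\<tau> n \<le> \<tau> (Suc n)" using assms(1) by simp
  with step show ?case by simp
qed simp

text \<open>
  Martingale-type statements relate two times and are transitive. By this rule it is enough to prove
  them within a single cell of the partition, where the kernel is constant in time.
\<close>

lemma partition_chain:
  fixes \<tau> :: "nat \<Rightarrow> real"
  assumes \<tau>: "\<tau> 0 = a" "\<tau> k = b" "\<forall>i<k. \<tau> i \<le> \<tau> (Suc i)"
    and refl: "\<And>u. a \<le> u \<Longrightarrow> u \<le> b \<Longrightarrow> P u u"
    and trans: "\<And>u v w. a \<le> u \<Longrightarrow> u \<le> v \<Longrightarrow> v \<le> w \<Longrightarrow> w \<le> b \<Longrightarrow> P u v \<Longrightarrow> P v w \<Longrightarrow> P u w"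
    and cell: "\<And>j u v. j < k \<Longrightarrow> \<tau> j \<le> u \<Longrightarrow> u < v \<Longrightarrow> v \<le> \<tau> (Suc j) \<Longrightarrow> P u v"
    and uv: "a \<le> u" "u \<le> v" "v \<le> b"
  shows "P u v"
proof -
  have le_b: "\<tau> j \<le> b" if "j \<le> k" for j
    using partition_mono[OF \<tau>(3) that] \<tau>(2) by simp
  have ge_a: "a \<le> \<tau> j" if "j \<le> k" for j
    using partition_mono[OF \<tau>(3), of 0 j] that \<tau>(1) by simp
  have "\<forall>u v. a \<le> u \<longrightarrow> u \<le> v \<longrightarrow> v \<le> \<tau> j \<longrightarrow> P u v" if "j \<le> k" for j
    using that
  proof (induction j)
    case 0
    show ?case
    proof (intro allI impI)
      fix u v assume uv: "a \<le> u" "u \<le> v" "v \<le> \<tau> 0"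
      then have "u = v" "v \<le> b" using \<tau>(1) le_b[of 0] by auto
      then show "P u v" using refl uv by simp
    qed
  next
    case (Suc j)
    then have j: "j < k" by simp
    show ?case
    proof (intro allI impI)
      fix u v assume uv: "a \<le> u" "u \<le> v" "v \<le> \<tau> (Suc j)"
      have vb: "v \<le> b" using uv le_b[of "Suc j"] Suc.prems by linarith
      consider "v \<le> \<tau> j" | "u = v" | "\<tau> j \<le> u" "u < v" | "u < \<tau> j" "\<tau> j < v" using uv by linarith
      then show "P u v"
      proof cases
        case 1 then show ?thesis using Suc uv by simp
      next
        case 2 then show ?thesis using refl uv vb by simp
      next
        case 3 then show ?thesis using cell[OF j] uv by simp
      next
        case 4
        then have "P u (\<tau> j)" "P (\<tau> j) v" using Suc uv cell[OF j] by auto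
        then show ?thesis using trans[of u "\<tau> j" v] uv 4 vb by simp
      qed
    qed
  qed
  from this[of k] show ?thesis using \<tau>(2) uv by simp
qed

text \<open>
  The integral up to time \<open>v\<close> of the step function with value \<open>c i\<close> on the \<open>i\<close>-th cell, with respect to
  the increments of \<open>f\<close>. Capping the grid points at \<open>v\<close> makes the cells after \<open>v\<close> contribute nothing.
\<close>

definition step_sum :: "nat \<Rightarrow> (nat \<Rightarrow> real) \<Rightarrow> (nat \<Rightarrow> real) \<Rightarrow> (real \<Rightarrow> real) \<Rightarrow> real \<Rightarrow> real" where
  "step_sum k \<tau> c f v = (\<Sum>i<k. c i * (f (min (\<tau> (Suc i)) v) - f (min (\<tau> i) v)))"

lemma step_sum_cell:
  assumes \<tau>: "\<forall>i<k. \<tau> i \<le> \<tau> (Suc i)"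
    and j: "j < k" "\<tau> j \<le> u" "u \<le> v" "v \<le> \<tau> (Suc j)"
  shows "step_sum k \<tau> c f v = step_sum k \<tau> c f u + c j * (f v - f u)"
proof -
  have "c i * (f (min (\<tau> (Suc i)) v) - f (min (\<tau> i) v)) - c i * (f (min (\<tau> (Suc i)) u) - f (min (\<tau> i) u))
      = (if i = j then c j * (f v - f u) else 0)" if "i < k" for i
  proof -
    consider "i < j" | "i = j" | "j < i" by linarith
    then show ?thesis
    proof cases
      case 1
      then have "\<tau> (Suc i) \<le> \<tau> j" "\<tau> i \<le> \<tau> j" using partition_mono[OF \<tau>, of _ j] j by auto
      then show ?thesis using 1 j by (simp add: min_absorb1)
    next
      case 2
      then show ?thesis using j by (simp add: min_absorb1 min_absorb2 algebra_simps)
    next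
      case 3
      then have "\<tau> (Suc j) \<le> \<tau> i" "\<tau> (Suc j) \<le> \<tau> (Suc i)" using partition_mono[OF \<tau>, of "Suc j"] that by auto
      then show ?thesis using 3 j by (simp add: min_absorb2)
    qed
  qed
  then have "step_sum k \<tau> c f v - step_sum k \<tau> c f u = (\<Sum>i<k. if i = j then c j * (f v - f u) else 0)"
    unfolding step_sum_def sum_subtractf[symmetric] by (intro sum.cong) auto
  also have "\<dots> = c j * (f v - f u)" using j by simp
  finally show ?thesis by simp
qed

lemma step_sum_start:
  assumes "\<forall>i<k. \<tau> i \<le> \<tau> (Suc i)"
  shows "step_sum k \<tau> c f (\<tau> 0) = 0"
proof -
  have "min (\<tau> i) (\<tau> 0) = \<tau> 0" if "i \<le> k" for i
    using partition_mono[OF assms, of 0 i] that by simp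
  then show ?thesis unfolding step_sum_def by (intro sum.neutral) (simp add: Suc_le_eq)
qed

text \<open>
  The simple process with partition \<open>\<tau>\<close> and values \<open>\<xi>\<close>, bounded by \<open>\<kappa>\<close>, plays the role of the kernel
  in Girsanov's theorem.
\<close>

locale exponential_density = brownian_space M W for M :: "'w measure" and W +
  fixes a b :: real and k :: nat and \<tau> :: "nat \<Rightarrow> real" and \<xi> :: "nat \<Rightarrow> 'w \<Rightarrow> real" and \<kappa> :: real
  assumes a_nonneg: "0 \<le> a"
    and simple: "simple_integrand M F a b k \<tau> \<xi>"
    and bounded: "\<And>i \<omega>. i < k \<Longrightarrow> \<omega> \<in> space M \<Longrightarrow> \<bar>\<xi> i \<omega>\<bar> \<le> \<kappa>"
begin

lemma tau: "\<tau> 0 = a" "\<tau> k = b" "\<forall>i<k. \<tau> i \<le> \<tau> (Suc i)"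
  using simple by (auto simp: simple_integrand_def)

lemma tau_range: "i \<le> k \<Longrightarrow> a \<le> \<tau> i" "i \<le> k \<Longrightarrow> \<tau> i \<le> b"
  using partition_mono[OF tau(3), of 0 i] partition_mono[OF tau(3), of i k] by (simp_all add: tau(1,2))

lemma a_le_b: "a \<le> b" using tau_range(1)[of k] by (simp add: tau(2))

lemma xi_measurable: "i < k \<Longrightarrow> \<tau> i \<le> v \<Longrightarrow> \<xi> i \<in> borel_measurable (F v)"
proof -
  assume "i < k" "\<tau> i \<le> v"
  moreover from this have "\<xi> i \<in> borel_measurable (F (\<tau> i))"
    using simple by (simp add: simple_integrand_def)
  ultimately show ?thesis by (intro measurable_F_mono[of "\<xi> i" "\<tau> i" borel v])
qed

lemmas chain = partition_chain[OF tau]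

definition ito_upto :: "real \<Rightarrow> 'w \<Rightarrow> real" where
  "ito_upto v \<omega> = step_sum k \<tau> (\<lambda>i. \<xi> i \<omega>) (\<lambda>s. W s \<omega>) v"

definition drift_upto :: "real \<Rightarrow> 'w \<Rightarrow> real" where
  "drift_upto v \<omega> = step_sum k \<tau> (\<lambda>i. \<xi> i \<omega>) (\<lambda>s. s) v"

text \<open>
  The stochastic exponential of the integral of the simple kernel against \<open>W\<close>.
\<close>

definition density_upto :: "real \<Rightarrow> 'w \<Rightarrow> real" where
  "density_upto v \<omega> = exp (ito_upto v \<omega> - step_sum k \<tau> (\<lambda>i. (\<xi> i \<omega>)\<^sup>2) (\<lambda>s. s) v / 2)"

text \<open>
  This is a Brownian motion under the measure with density \<open>density_upto\<close>; below, only its martingale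
  property is derived, in \<open>integral_density_shifted_W\<close>.
\<close>

definition shifted_W :: "real \<Rightarrow> 'w \<Rightarrow> real" where
  "shifted_W v \<omega> = W v \<omega> - W a \<omega> - drift_upto v \<omega>"

text \<open>
  Only coefficients of cells that start before \<open>v\<close> have to be known at time \<open>v\<close>: on the other cells
  both capped grid points equal \<open>v\<close>.
\<close>

lemma step_sum_measurable:
  assumes v: "a \<le> v" and c: "\<And>i. i < k \<Longrightarrow> \<tau> i \<le> v \<Longrightarrow> c i \<in> borel_measurable (F v)"
    and f: "\<And>s. 0 \<le> s \<Longrightarrow> s \<le> v \<Longrightarrow> f s \<in> borel_measurable (F v)"
  shows "(\<lambda>\<omega>. step_sum k \<tau> (\<lambda>i. c i \<omega>) (\<lambda>s. f s \<omega>) v) \<in> borel_measurable (F v)"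
  unfolding step_sum_def
proof (rule borel_measurable_sum)
  fix i assume "i \<in> {..<k}"
  then have i: "i < k" by simp
  show "(\<lambda>\<omega>. c i \<omega> * (f (min (\<tau> (Suc i)) v) \<omega> - f (min (\<tau> i) v) \<omega>)) \<in> borel_measurable (F v)"
  proof (cases "\<tau> i \<le> v")
    case True
    have "0 \<le> \<tau> i" "0 \<le> \<tau> (Suc i)" using tau_range(1)[of i] tau_range(1)[of "Suc i"] a_nonneg i by auto
    then show ?thesis using v a_nonneg True i
      by (intro borel_measurable_times borel_measurable_diff c f) auto
  next
    case False
    then have "min (\<tau> (Suc i)) v = v" "min (\<tau> i) v = v" using tau(3) i by fastforce+
    then show ?thesis by simp
  qed
qed

lemma density_measurable: "a \<le> v \<Longrightarrow> density_upto v \<in> borel_measurable (F v)"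
  unfolding density_upto_def[abs_def] ito_upto_def
  by (intro measurable_compose[OF _ borel_measurable_exp] borel_measurable_diff
      borel_measurable_divide step_sum_measurable borel_measurable_power xi_measurable W_adapted) auto

lemma drift_measurable: "a \<le> v \<Longrightarrow> drift_upto v \<in> borel_measurable (F v)"
  unfolding drift_upto_def[abs_def] by (intro step_sum_measurable xi_measurable) auto

lemma shifted_W_measurable: "a \<le> v \<Longrightarrow> shifted_W v \<in> borel_measurable (F v)"
  unfolding shifted_W_def[abs_def] using a_nonneg
  by (intro borel_measurable_diff W_adapted drift_measurable) auto

lemma density_start: "density_upto a \<omega> = 1"
  using step_sum_start[OF tau(3)] by (simp add: density_upto_def ito_upto_def tau(1))

lemma density_pos: "0 < density_upto v \<omega>"
  by (simp add: density_upto_def)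

lemma density_cell:
  assumes "j < k" "\<tau> j \<le> u" "u \<le> v" "v \<le> \<tau> (Suc j)"
  shows "density_upto v \<omega> = density_upto u \<omega> * gauss_exp (v - u) (\<xi> j \<omega>) (W v \<omega> - W u \<omega>)"
proof -
  note cell = step_sum_cell[OF tau(3) assms]
  show ?thesis
    unfolding density_upto_def ito_upto_def gauss_exp_def exp_add[symmetric]
      cell[of "\<lambda>i. \<xi> i \<omega>" "\<lambda>s. W s \<omega>"] cell[of "\<lambda>i. (\<xi> i \<omega>)\<^sup>2" "\<lambda>s. s"]
    by (simp add: algebra_simps diff_divide_distrib add_divide_distrib)
qed

lemma shifted_W_cell:
  assumes "j < k" "\<tau> j \<le> u" "u \<le> v" "v \<le> \<tau> (Suc j)"
  shows "shifted_W v \<omega> = shifted_W u \<omega> + (W v \<omega> - W u \<omega>) - \<xi> j \<omega> * (v - u)"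
  using step_sum_cell[OF tau(3) assms, of "\<lambda>i. \<xi> i \<omega>" "\<lambda>s. s"] by (simp add: shifted_W_def drift_upto_def)

text \<open>
  Within a cell, \<open>density_cell\<close> splits off a factor \<open>gauss_exp\<close> of the increment, which is independent of
  the rest. The two uses are \<open>p = 1\<close>, where the last factor is one and the density is a martingale, and
  \<open>p = 2\<close>, where that factor bounds the growth of the second moment.
\<close>

lemma nn_integral_density_power_cell:
  assumes j: "j < k" "\<tau> j \<le> u" "u < v" "v \<le> \<tau> (Suc j)" and X[measurable]: "X \<in> borel_measurable (F u)"
  shows "(\<integral>\<^sup>+\<omega>. X \<omega> * ennreal (density_upto v \<omega> ^ p) \<partial>M)
    = (\<integral>\<^sup>+\<omega>. X \<omega> * ennreal (density_upto u \<omega> ^ p)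
        * ennreal (exp (real p * (real p - 1) / 2 * ((\<xi> j \<omega>)\<^sup>2 * (v - u)))) \<partial>M)"
proof -
  have au: "a \<le> u" "0 \<le> u" using j tau_range(1)[of j] a_nonneg by auto
  note [measurable] = density_measurable[OF au(1)] xi_measurable[OF j(1,2)]
  let ?Y = "\<lambda>\<omega>. X \<omega> * ennreal (density_upto u \<omega> ^ p)"
  let ?H = "\<lambda>\<omega> x. ?Y \<omega> * ennreal (gauss_exp (v - u) (\<xi> j \<omega>) x ^ p)"
  have H: "case_prod ?H \<in> borel_measurable (F u \<Otimes>\<^sub>M borel)"
    unfolding gauss_exp_def by measurable
  have "(\<integral>\<^sup>+\<omega>. X \<omega> * ennreal (density_upto v \<omega> ^ p) \<partial>M) = (\<integral>\<^sup>+\<omega>. ?H \<omega> (W v \<omega> - W u \<omega>) \<partial>M)"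
    using j by (intro nn_integral_cong)
      (simp add: density_cell[of j u v] power_mult_distrib ennreal_mult'' gauss_exp_def mult.assoc)
  also have "\<dots> = (\<integral>\<^sup>+\<omega>. (\<integral>\<^sup>+x. ennreal (normal_density 0 (sqrt (v - u)) x) * ?H \<omega> x \<partial>lborel) \<partial>M)"
    using nn_integral_increment[OF au(2) j(3) H] .
  also have "\<dots> = (\<integral>\<^sup>+\<omega>. ?Y \<omega> * ennreal (exp (real p * (real p - 1) / 2 * ((\<xi> j \<omega>)\<^sup>2 * (v - u)))) \<partial>M)"
  proof (rule nn_integral_cong)
    fix \<omega>
    have "(\<integral>\<^sup>+x. ennreal (normal_density 0 (sqrt (v - u)) x) * ?H \<omega> x \<partial>lborel)
      = (\<integral>\<^sup>+x. ?Y \<omega> * (ennreal (normal_density 0 (sqrt (v - u)) x) * ennreal (gauss_exp (v - u) (\<xi> j \<omega>) x ^ p)) \<partial>lborel)"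
      by (simp add: ac_simps)
    also have "\<dots> = ?Y \<omega> * (\<integral>\<^sup>+x. ennreal (normal_density 0 (sqrt (v - u)) x) * ennreal (gauss_exp (v - u) (\<xi> j \<omega>) x ^ p) \<partial>lborel)"
      by (rule nn_integral_cmult) (simp add: gauss_exp_def)
    finally show "(\<integral>\<^sup>+x. ennreal (normal_density 0 (sqrt (v - u)) x) * ?H \<omega> x \<partial>lborel)
        = ?Y \<omega> * ennreal (exp (real p * (real p - 1) / 2 * ((\<xi> j \<omega>)\<^sup>2 * (v - u))))"
      using nn_integral_gauss_exp_power[of "v - u" "\<xi> j \<omega>" p] j(3) by simp
  qed
  finally show ?thesis .
qed

lemma nn_integral_density:
  assumes uv: "a \<le> u" "u \<le> v" "v \<le> b" and X: "X \<in> borel_measurable (F u)"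
  shows "(\<integral>\<^sup>+\<omega>. X \<omega> * ennreal (density_upto v \<omega>) \<partial>M) = (\<integral>\<^sup>+\<omega>. X \<omega> * ennreal (density_upto u \<omega>) \<partial>M)"
proof -
  let ?P = "\<lambda>u v. \<forall>X\<in>borel_measurable (F u). (\<integral>\<^sup>+\<omega>. X \<omega> * ennreal (density_upto v \<omega>) \<partial>M)
      = (\<integral>\<^sup>+\<omega>. X \<omega> * ennreal (density_upto u \<omega>) \<partial>M)"
  have "?P u v"
  proof (rule chain[where P = ?P])
    fix u v w assume "u \<le> v" "?P u v" "?P v w"
    then show "?P u w"
      using measurable_F_mono[OF _ \<open>u \<le> v\<close>, of _ "borel :: ennreal measure"] by metis
  next
    fix j u v assume "j < k" "\<tau> j \<le> u" "u < v" "v \<le> \<tau> (Suc j)"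
    from nn_integral_density_power_cell[OF this, of _ 1] show "?P u v" by simp
  qed (use uv in simp_all)
  then show ?thesis using X by auto
qed

text \<open>
  The bound depends on the kernel through \<open>\<kappa>\<close> only, which makes it uniform along a sequence of
  approximating kernels.
\<close>

lemma nn_integral_density_square:
  assumes uv: "a \<le> u" "u \<le> v" "v \<le> b" and X: "X \<in> borel_measurable (F u)"
  shows "(\<integral>\<^sup>+\<omega>. X \<omega> * ennreal ((density_upto v \<omega>)\<^sup>2) \<partial>M)
    \<le> ennreal (exp (\<kappa>\<^sup>2 * (v - u))) * (\<integral>\<^sup>+\<omega>. X \<omega> * ennreal ((density_upto u \<omega>)\<^sup>2) \<partial>M)"
proof -
  let ?I = "\<lambda>X v. \<integral>\<^sup>+\<omega>. X \<omega> * ennreal ((density_upto v \<omega>)\<^sup>2) \<partial>M"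
  let ?c = "\<lambda>u v. ennreal (exp (\<kappa>\<^sup>2 * (v - u)))"
  let ?P = "\<lambda>u v. \<forall>X\<in>borel_measurable (F u). ?I X v \<le> ?c u v * ?I X u"
  have "?P u v"
  proof (rule chain[where P = ?P])
    fix u v w assume uv: "u \<le> v" and 1: "?P u v" and 2: "?P v w"
    show "?P u w"
    proof
      fix X :: "'w \<Rightarrow> ennreal" assume X: "X \<in> borel_measurable (F u)"
      have e: "exp (\<kappa>\<^sup>2 * (w - v)) * exp (\<kappa>\<^sup>2 * (v - u)) = exp (\<kappa>\<^sup>2 * (w - u))"
        by (simp add: algebra_simps flip: exp_add)
      have "?I X w \<le> ?c v w * ?I X v" using 2 measurable_F_mono[OF X uv] by blast
      also have "\<dots> \<le> ?c v w * (?c u v * ?I X u)" using 1 X by (intro mult_left_mono) auto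
      also have "\<dots> = ?c u w * ?I X u"
        by (simp add: e mult.assoc[symmetric] flip: ennreal_mult')
      finally show "?I X w \<le> ?c u w * ?I X u" .
    qed
  next
    fix j u v assume j: "j < k" "\<tau> j \<le> u" "u < v" "v \<le> \<tau> (Suc j)"
    have au: "a \<le> u" using j tau_range(1)[of j] by auto
    show "?P u v"
    proof
      fix X :: "'w \<Rightarrow> ennreal" assume X[measurable]: "X \<in> borel_measurable (F u)"
      note [measurable] = density_measurable[OF au]
      have "?I X v = (\<integral>\<^sup>+\<omega>. X \<omega> * ennreal ((density_upto u \<omega>)\<^sup>2) * ennreal (exp ((\<xi> j \<omega>)\<^sup>2 * (v - u))) \<partial>M)"
        using nn_integral_density_power_cell[OF j X, of 2] by simp
      also have "\<dots> \<le> (\<integral>\<^sup>+\<omega>. ?c u v * (X \<omega> * ennreal ((density_upto u \<omega>)\<^sup>2)) \<partial>M)"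
      proof (rule nn_integral_mono)
        fix \<omega> assume \<omega>: "\<omega> \<in> space M"
        have "(\<xi> j \<omega>)\<^sup>2 \<le> \<kappa>\<^sup>2" using bounded[OF j(1) \<omega>] by (metis abs_ge_zero power2_abs power_mono)
        then have "ennreal (exp ((\<xi> j \<omega>)\<^sup>2 * (v - u))) \<le> ?c u v"
          using j by (intro ennreal_leI) (auto intro: mult_right_mono)
        then show "X \<omega> * ennreal ((density_upto u \<omega>)\<^sup>2) * ennreal (exp ((\<xi> j \<omega>)\<^sup>2 * (v - u)))
          \<le> ?c u v * (X \<omega> * ennreal ((density_upto u \<omega>)\<^sup>2))"
          by (subst mult.commute[of "?c u v"]) (rule mult_left_mono, auto)
      qed
      also have "\<dots> = ?c u v * ?I X u"
        by (intro nn_integral_cmult measurable_F_M[of _ u]) measurable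
      finally show "?I X v \<le> ?c u v * ?I X u" .
    qed
  qed (use uv in simp_all)
  then show ?thesis using X by auto
qed

end

section \<open>Product of Lebesgue measure on an interval and the probability space\<close>

abbreviation Leb :: "real \<Rightarrow> real \<Rightarrow> real measure" where
  "Leb s t \<equiv> restrict_space lborel {s..t}"

lemma finite_measure_Leb: "finite_measure (Leb s t)"
  by (intro finite_measureI) (simp add: emeasure_restrict_space space_restrict_space emeasure_lborel_Icc_eq)

lemma measure_Leb: "s \<le> t \<Longrightarrow> measure (Leb s t) (space (Leb s t)) = t - s"
  by (simp add: measure_restrict_space space_restrict_space)

lemma sets_Leb: "sets (Leb s t) = sets (restrict_space borel {s..t})"
  by (rule sets_restrict_space_cong) simp

lemma borel_measurable_Leb: "f \<in> borel_measurable borel \<Longrightarrow> f \<in> borel_measurable (Leb s t)"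
  by (rule measurable_restrict_space1) simp

lemma square_integrable_const: "finite_measure M \<Longrightarrow> square_integrable M (\<lambda>_. c)"
  by (simp add: square_integrable_def finite_measure.integrable_const)

context prob_space
begin

abbreviation LebM :: "real \<Rightarrow> real \<Rightarrow> (real \<times> 'a) measure" where
  "LebM s t \<equiv> Leb s t \<Otimes>\<^sub>M M"

lemma pair_Leb: "pair_sigma_finite (Leb s t) M"
proof -
  interpret L: finite_measure "Leb s t" by (rule finite_measure_Leb)
  show ?thesis ..
qed

lemma finite_measure_pair_Leb: "finite_measure (LebM s t)"
proof -
  interpret L: finite_measure "Leb s t" by (rule finite_measure_Leb)
  interpret P: pair_sigma_finite "Leb s t" M by (rule pair_Leb)
  show ?thesis
  proof (rule finite_measureI)
    have "emeasure (LebM s t) (space (Leb s t) \<times> space M) = emeasure (Leb s t) (space (Leb s t)) * emeasure M (space M)"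
      by (rule emeasure_pair_measure_Times[OF sets.top sets.top])
    then show "emeasure (LebM s t) (space (LebM s t)) \<noteq> \<infinity>"
      using L.emeasure_finite emeasure_space_1 by (simp add: space_pair_measure)
  qed
qed

lemma square_integrable_lift:
  assumes "square_integrable M \<eta>"
  shows "square_integrable (LebM s t) (\<lambda>(r, \<omega>). \<eta> \<omega>)"
    and "s \<le> t \<Longrightarrow> (\<integral>z. (case z of (r, \<omega>) \<Rightarrow> \<eta> \<omega>)\<^sup>2 \<partial>(LebM s t)) = (t - s) * (\<integral>\<omega>. (\<eta> \<omega>)\<^sup>2 \<partial>M)"
proof -
  interpret L: finite_measure "Leb s t" by (rule finite_measure_Leb)
  interpret P: pair_sigma_finite "Leb s t" M by (rule pair_Leb)
  have [measurable]: "\<eta> \<in> borel_measurable M" and int: "integrable M (\<lambda>\<omega>. (\<eta> \<omega>)\<^sup>2)"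
    using assms by (auto simp: square_integrable_def)
  have "integrable (LebM s t) (\<lambda>(r, \<omega>). (\<eta> \<omega>)\<^sup>2)"
    using int by (intro P.Fubini_integrable) auto
  then have i: "integrable (LebM s t) (\<lambda>z. (case z of (r, \<omega>) \<Rightarrow> \<eta> \<omega>)\<^sup>2)"
    by (simp add: case_prod_unfold)
  then show "square_integrable (LebM s t) (\<lambda>(r, \<omega>). \<eta> \<omega>)"
    unfolding square_integrable_def by simp
  show "(\<integral>z. (case z of (r, \<omega>) \<Rightarrow> \<eta> \<omega>)\<^sup>2 \<partial>(LebM s t)) = (t - s) * (\<integral>\<omega>. (\<eta> \<omega>)\<^sup>2 \<partial>M)" if "s \<le> t"
    using P.integral_fst'[OF i] measure_Leb[OF that] by simp
qed

lemma square_integrable_Leb_iff: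
  assumes [measurable]: "(\<lambda>(r, \<omega>). f r \<omega>) \<in> borel_measurable (LebM s t)"
  shows "square_integrable (LebM s t) (\<lambda>(r, \<omega>). f r \<omega>) \<longleftrightarrow>
    (\<integral>\<^sup>+\<omega>. (\<integral>\<^sup>+r\<in>{s..t}. ennreal ((f r \<omega>)\<^sup>2) \<partial>lborel) \<partial>M) < \<infinity>"
    and "square_integrable (LebM s t) (\<lambda>(r, \<omega>). f r \<omega>) \<Longrightarrow>
      (\<integral>z. (case z of (r, \<omega>) \<Rightarrow> f r \<omega>)\<^sup>2 \<partial>(LebM s t))
      = enn2real (\<integral>\<^sup>+\<omega>. (\<integral>\<^sup>+r\<in>{s..t}. ennreal ((f r \<omega>)\<^sup>2) \<partial>lborel) \<partial>M)"
proof -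
  interpret P: pair_sigma_finite "Leb s t" M by (rule pair_Leb)
  have eq: "(\<integral>\<^sup>+z. ennreal ((case z of (r, \<omega>) \<Rightarrow> f r \<omega>)\<^sup>2) \<partial>(LebM s t))
     = (\<integral>\<^sup>+\<omega>. (\<integral>\<^sup>+r\<in>{s..t}. ennreal ((f r \<omega>)\<^sup>2) \<partial>lborel) \<partial>M)"
  proof -
    have "(\<integral>\<^sup>+z. ennreal ((case z of (r, \<omega>) \<Rightarrow> f r \<omega>)\<^sup>2) \<partial>(LebM s t))
      = (\<integral>\<^sup>+\<omega>. (\<integral>\<^sup>+r. ennreal ((case (r, \<omega>) of (r, \<omega>) \<Rightarrow> f r \<omega>)\<^sup>2) \<partial>Leb s t) \<partial>M)"
      by (rule P.nn_integral_snd[symmetric]) measurable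
    then show ?thesis by (simp add: nn_integral_restrict_space)
  qed
  show "square_integrable (LebM s t) (\<lambda>(r, \<omega>). f r \<omega>) \<longleftrightarrow>
    (\<integral>\<^sup>+\<omega>. (\<integral>\<^sup>+r\<in>{s..t}. ennreal ((f r \<omega>)\<^sup>2) \<partial>lborel) \<partial>M) < \<infinity>"
    using square_integrable_nn_iff[OF assms] unfolding eq .
  show "(\<integral>z. (case z of (r, \<omega>) \<Rightarrow> f r \<omega>)\<^sup>2 \<partial>(LebM s t))
      = enn2real (\<integral>\<^sup>+\<omega>. (\<integral>\<^sup>+r\<in>{s..t}. ennreal ((f r \<omega>)\<^sup>2) \<partial>lborel) \<partial>M)"
    unfolding eq[symmetric] by (rule integral_eq_nn_integral) (use assms in auto)
qed

text \<open>
  All time integrals of processes are only ever tested against a random variable \<open>\<eta>\<close>. By Fubini's theorem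
  this is an integral over the product space, where the Cauchy-Schwarz inequality applies at once.
\<close>

lemma integral_mult_Leb:
  fixes f :: "real \<Rightarrow> 'a \<Rightarrow> real"
  assumes \<eta>: "square_integrable M \<eta>" and f: "square_integrable (LebM s t) (\<lambda>(r, \<omega>). f r \<omega>)"
  shows "integrable (LebM s t) (\<lambda>(r, \<omega>). \<eta> \<omega> * f r \<omega>)"
    and "integrable M (\<lambda>\<omega>. \<eta> \<omega> * (\<integral>r. f r \<omega> \<partial>Leb s t))"
    and "(\<integral>\<omega>. \<eta> \<omega> * (\<integral>r. f r \<omega> \<partial>Leb s t) \<partial>M) = (\<integral>(r, \<omega>). \<eta> \<omega> * f r \<omega> \<partial>(LebM s t))"
    and "s \<le> t \<Longrightarrow> \<bar>\<integral>(r, \<omega>). \<eta> \<omega> * f r \<omega> \<partial>(LebM s t)\<bar>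
      \<le> sqrt ((t - s) * (\<integral>\<omega>. (\<eta> \<omega>)\<^sup>2 \<partial>M)) * sqrt (\<integral>z. (case z of (r, \<omega>) \<Rightarrow> f r \<omega>)\<^sup>2 \<partial>(LebM s t))"
proof -
  interpret P: pair_sigma_finite "Leb s t" M by (rule pair_Leb)
  show int: "integrable (LebM s t) (\<lambda>(r, \<omega>). \<eta> \<omega> * f r \<omega>)"
    using square_integrable_mult[OF square_integrable_lift(1)[OF \<eta>] f] by (simp add: case_prod_unfold)
  show "integrable M (\<lambda>\<omega>. \<eta> \<omega> * (\<integral>r. f r \<omega> \<partial>Leb s t))"
    using P.integrable_snd[OF int] by simp
  show "(\<integral>\<omega>. \<eta> \<omega> * (\<integral>r. f r \<omega> \<partial>Leb s t) \<partial>M) = (\<integral>(r, \<omega>). \<eta> \<omega> * f r \<omega> \<partial>(LebM s t))"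
    using P.integral_snd[OF int] by simp
  show "\<bar>\<integral>(r, \<omega>). \<eta> \<omega> * f r \<omega> \<partial>(LebM s t)\<bar>
      \<le> sqrt ((t - s) * (\<integral>\<omega>. (\<eta> \<omega>)\<^sup>2 \<partial>M)) * sqrt (\<integral>z. (case z of (r, \<omega>) \<Rightarrow> f r \<omega>)\<^sup>2 \<partial>(LebM s t))"
    if "s \<le> t"
    using Cauchy_Schwarz_integral[OF square_integrable_lift(1)[OF \<eta>] f] square_integrable_lift(2)[OF \<eta> that]
    by (simp add: case_prod_unfold)
qed

end

section \<open>Girsanov duality for the stochastic integral\<close>

context brownian_space
begin

lemma square_integrable_increment:
  assumes "0 \<le> u" "u \<le> v"
  shows "square_integrable M (\<lambda>\<omega>. W v \<omega> - W u \<omega>)"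
proof (cases "u = v")
  case True
  then show ?thesis by (simp add: square_integrable_def)
next
  case False
  with assms have uv: "u < v" "0 < sqrt (v - u)" by auto
  have meas: "(\<lambda>\<omega>. W v \<omega> - W u \<omega>) \<in> borel_measurable M"
    using assms by (intro borel_measurable_diff measurable_W) auto
  have "(\<integral>\<^sup>+\<omega>. ennreal ((W v \<omega> - W u \<omega>)\<^sup>2) \<partial>M)
    = (\<integral>\<^sup>+\<omega>. (\<integral>\<^sup>+x. ennreal (normal_density 0 (sqrt (v - u)) x) * ennreal (x\<^sup>2) \<partial>lborel) \<partial>M)"
    by (rule nn_integral_increment[OF assms(1) uv(1)]) measurable
  also have "\<dots> = (\<integral>\<^sup>+x. ennreal (normal_density 0 (sqrt (v - u)) x * (x - 0)\<^sup>2) \<partial>lborel)"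
    by (simp add: emeasure_space_1 ennreal_mult')
  also have "\<dots> < \<infinity>"
    using integrable_normal_moment[OF uv(2), of 0 2] by (simp add: integrable_iff_bounded)
  finally show ?thesis using square_integrable_nn_iff[OF meas] by simp
qed

end

context exponential_density
begin

lemma measurable_density_M: "a \<le> v \<Longrightarrow> density_upto v \<in> borel_measurable M"
  using measurable_F_M[OF density_measurable] .

lemma square_integrable_density_step:
  assumes uv: "a \<le> u" "u \<le> v" "v \<le> b" and X: "X \<in> borel_measurable (F u)"
    and sq: "square_integrable M (\<lambda>\<omega>. X \<omega> * density_upto u \<omega>)"
  shows "square_integrable M (\<lambda>\<omega>. X \<omega> * density_upto v \<omega>)"
    and "(\<integral>\<omega>. (X \<omega> * density_upto v \<omega>)\<^sup>2 \<partial>M) \<le> exp (\<kappa>\<^sup>2 * (v - u)) * (\<integral>\<omega>. (X \<omega> * density_upto u \<omega>)\<^sup>2 \<partial>M)"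
proof -
  have [measurable]: "density_upto v \<in> borel_measurable M" "density_upto u \<in> borel_measurable M"
    using uv by (auto intro!: measurable_density_M)
  have split: "ennreal ((X \<omega> * density_upto r \<omega>)\<^sup>2) = ennreal ((X \<omega>)\<^sup>2) * ennreal ((density_upto r \<omega>)\<^sup>2)" for r \<omega>
    by (simp add: power_mult_distrib ennreal_mult)
  have le: "(\<integral>\<^sup>+\<omega>. ennreal ((X \<omega> * density_upto v \<omega>)\<^sup>2) \<partial>M)
    \<le> ennreal (exp (\<kappa>\<^sup>2 * (v - u))) * (\<integral>\<^sup>+\<omega>. ennreal ((X \<omega> * density_upto u \<omega>)\<^sup>2) \<partial>M)"
    unfolding split using X by (intro nn_integral_density_square[OF uv]) measurable
  have [measurable]: "X \<in> borel_measurable M" using measurable_F_M[OF X] .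
  have fin: "(\<integral>\<^sup>+\<omega>. ennreal ((X \<omega> * density_upto u \<omega>)\<^sup>2) \<partial>M) < \<infinity>"
    using square_integrable_nn_iff[of "\<lambda>\<omega>. X \<omega> * density_upto u \<omega>" M] sq by simp
  have "(\<integral>\<^sup>+\<omega>. ennreal ((X \<omega> * density_upto v \<omega>)\<^sup>2) \<partial>M) < \<infinity>"
    using le fin by (auto simp: ennreal_mult_less_top intro: le_less_trans)
  then show sqv: "square_integrable M (\<lambda>\<omega>. X \<omega> * density_upto v \<omega>)"
    using square_integrable_nn_iff[of "\<lambda>\<omega>. X \<omega> * density_upto v \<omega>" M] by simp
  have "ennreal (\<integral>\<omega>. (X \<omega> * density_upto v \<omega>)\<^sup>2 \<partial>M) = (\<integral>\<^sup>+\<omega>. ennreal ((X \<omega> * density_upto v \<omega>)\<^sup>2) \<partial>M)"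
    using sqv by (intro nn_integral_eq_integral[symmetric]) (auto simp: square_integrable_def)
  also note le
  also have "(\<integral>\<^sup>+\<omega>. ennreal ((X \<omega> * density_upto u \<omega>)\<^sup>2) \<partial>M) = ennreal (\<integral>\<omega>. (X \<omega> * density_upto u \<omega>)\<^sup>2 \<partial>M)"
    using sq by (intro nn_integral_eq_integral) (auto simp: square_integrable_def)
  finally show "(\<integral>\<omega>. (X \<omega> * density_upto v \<omega>)\<^sup>2 \<partial>M) \<le> exp (\<kappa>\<^sup>2 * (v - u)) * (\<integral>\<omega>. (X \<omega> * density_upto u \<omega>)\<^sup>2 \<partial>M)"
    by (simp flip: ennreal_mult)
qed

lemma square_integrable_density:
  assumes v: "a \<le> v" "v \<le> b" and \<zeta>: "\<zeta> \<in> borel_measurable (F a)" "square_integrable M \<zeta>"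
  shows "square_integrable M (\<lambda>\<omega>. \<zeta> \<omega> * density_upto v \<omega>)"
    and "(\<integral>\<omega>. (\<zeta> \<omega> * density_upto v \<omega>)\<^sup>2 \<partial>M) \<le> exp (\<kappa>\<^sup>2 * (v - a)) * (\<integral>\<omega>. (\<zeta> \<omega>)\<^sup>2 \<partial>M)"
  using square_integrable_density_step[OF order_refl v \<zeta>(1)] \<zeta>(2) by (simp_all add: density_start)

text \<open>
  Equality for nonnegative test functions carries over to the positive and the negative part of \<open>X\<close>,
  because the density is positive.
\<close>

lemma integral_density:
  assumes uv: "a \<le> u" "u \<le> v" "v \<le> b" and X: "X \<in> borel_measurable (F u)"
    and int: "integrable M (\<lambda>\<omega>. X \<omega> * density_upto u \<omega>)"
  shows "integrable M (\<lambda>\<omega>. X \<omega> * density_upto v \<omega>)"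
    and "(\<integral>\<omega>. X \<omega> * density_upto v \<omega> \<partial>M) = (\<integral>\<omega>. X \<omega> * density_upto u \<omega> \<partial>M)"
proof -
  have [measurable]: "density_upto v \<in> borel_measurable M" "density_upto u \<in> borel_measurable M"
    using uv by (auto intro!: measurable_density_M)
  have D0: "0 \<le> density_upto r \<omega>" for r \<omega> using density_pos[of r \<omega>] by simp
  have eq: "(\<integral>\<^sup>+\<omega>. ennreal (g (X \<omega>) * density_upto v \<omega>) \<partial>M) = (\<integral>\<^sup>+\<omega>. ennreal (g (X \<omega>) * density_upto u \<omega>) \<partial>M)"
    if g[measurable]: "g \<in> borel_measurable borel" for g :: "real \<Rightarrow> real"
    unfolding ennreal_mult''[OF D0] using X by (intro nn_integral_density[OF uv]) measurable
  have [measurable]: "X \<in> borel_measurable M" using measurable_F_M[OF X] .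
  have "(\<integral>\<^sup>+\<omega>. ennreal (norm (X \<omega> * density_upto v \<omega>)) \<partial>M) = (\<integral>\<^sup>+\<omega>. ennreal (norm (X \<omega> * density_upto u \<omega>)) \<partial>M)"
    using eq[of abs] D0 by (simp add: abs_mult abs_of_nonneg)
  with int show "integrable M (\<lambda>\<omega>. X \<omega> * density_upto v \<omega>)"
    unfolding integrable_iff_bounded by simp
  then show "(\<integral>\<omega>. X \<omega> * density_upto v \<omega> \<partial>M) = (\<integral>\<omega>. X \<omega> * density_upto u \<omega> \<partial>M)"
    using int eq[of "\<lambda>x. x"] eq[of uminus] by (simp add: real_lebesgue_integral_def)
qed

lemma drift_bounded:
  assumes \<omega>: "\<omega> \<in> space M"
  shows "\<bar>drift_upto v \<omega>\<bar> \<le> \<kappa> * (min b v - min a v)"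
proof -
  have "\<bar>drift_upto v \<omega>\<bar> \<le> (\<Sum>i<k. \<kappa> * (min (\<tau> (Suc i)) v - min (\<tau> i) v))"
    unfolding drift_upto_def step_sum_def
  proof (rule order_trans[OF sum_abs], rule sum_mono)
    fix i assume "i \<in> {..<k}"
    then have i: "i < k" "\<tau> i \<le> \<tau> (Suc i)" using tau(3) by auto
    then have "0 \<le> min (\<tau> (Suc i)) v - min (\<tau> i) v" by auto
    then show "\<bar>\<xi> i \<omega> * (min (\<tau> (Suc i)) v - min (\<tau> i) v)\<bar> \<le> \<kappa> * (min (\<tau> (Suc i)) v - min (\<tau> i) v)"
      using bounded[OF i(1) \<omega>] by (simp only: abs_mult abs_of_nonneg) (intro mult_right_mono)
  qed
  also have "\<dots> = \<kappa> * (min b v - min a v)"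
    unfolding sum_distrib_left[symmetric] by (simp add: sum_lessThan_telescope[of "\<lambda>i. min (\<tau> i) v"] tau(1,2))
  finally show ?thesis .
qed

lemma square_integrable_shifted_W:
  assumes v: "a \<le> v"
  shows "square_integrable M (shifted_W v)"
proof -
  have "square_integrable M (drift_upto v)"
  proof (rule square_integrable_dominated[OF square_integrable_const[OF finite_measure_axioms, of "\<kappa> * (min b v - min a v)"]])
    show "drift_upto v \<in> borel_measurable M" using measurable_F_M[OF drift_measurable[OF v]] .
    show "AE \<omega> in M. \<bar>drift_upto v \<omega>\<bar> \<le> \<bar>\<kappa> * (min b v - min a v)\<bar>"
      by (rule AE_I2, rule order_trans[OF drift_bounded abs_ge_self])
  qed
  then show ?thesis
    unfolding shifted_W_def[abs_def]
    using square_integrable_increment[OF a_nonneg v] by (intro square_integrable_diff[of M "\<lambda>\<omega>. W v \<omega> - W a \<omega>"]) auto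
qed

text \<open>
  Within a cell, the factor \<open>gauss_exp\<close> moves the mean of the increment of \<open>W\<close> from \<open>0\<close> to
  \<open>\<xi> (v - u)\<close>, and this is exactly what \<open>shifted_W\<close> subtracts.
\<close>

lemma integral_density_shifted_W:
  assumes uv: "a \<le> u" "u \<le> v" "v \<le> b" and X: "X \<in> borel_measurable (F u)"
    and sq: "square_integrable M (\<lambda>\<omega>. X \<omega> * density_upto u \<omega>)"
  shows "(\<integral>\<omega>. X \<omega> * density_upto v \<omega> * shifted_W v \<omega> \<partial>M) = (\<integral>\<omega>. X \<omega> * density_upto u \<omega> * shifted_W u \<omega> \<partial>M)"
proof -
  let ?P = "\<lambda>u v. \<forall>X\<in>borel_measurable (F u). square_integrable M (\<lambda>\<omega>. X \<omega> * density_upto u \<omega>) \<longrightarrow>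
    (\<integral>\<omega>. X \<omega> * density_upto v \<omega> * shifted_W v \<omega> \<partial>M) = (\<integral>\<omega>. X \<omega> * density_upto u \<omega> * shifted_W u \<omega> \<partial>M)"
  have "?P u v"
  proof (rule chain[where P = ?P])
    fix u v w
    assume uv: "a \<le> u" "u \<le> v" "v \<le> w" "w \<le> b" and 1: "?P u v" and 2: "?P v w"
    show "?P u w"
    proof (intro ballI impI)
      fix X assume X: "X \<in> borel_measurable (F u)" "square_integrable M (\<lambda>\<omega>. X \<omega> * density_upto u \<omega>)"
      have "square_integrable M (\<lambda>\<omega>. X \<omega> * density_upto v \<omega>)"
        using uv X by (intro square_integrable_density_step(1)[of u v]) auto
      with 2 measurable_F_mono[OF X(1) uv(2)]
      have "(\<integral>\<omega>. X \<omega> * density_upto w \<omega> * shifted_W w \<omega> \<partial>M) = (\<integral>\<omega>. X \<omega> * density_upto v \<omega> * shifted_W v \<omega> \<partial>M)" by blast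
      also have "\<dots> = (\<integral>\<omega>. X \<omega> * density_upto u \<omega> * shifted_W u \<omega> \<partial>M)" using 1 X by blast
      finally show "(\<integral>\<omega>. X \<omega> * density_upto w \<omega> * shifted_W w \<omega> \<partial>M) = (\<integral>\<omega>. X \<omega> * density_upto u \<omega> * shifted_W u \<omega> \<partial>M)" .
    qed
  next
    fix j u v assume j: "j < k" "\<tau> j \<le> u" "u < v" "v \<le> \<tau> (Suc j)"
    have au: "a \<le> u" "0 \<le> u" "v \<le> b" using j tau_range(1)[of j] tau_range(2)[of "Suc j"] a_nonneg by auto
    show "?P u v"
    proof (intro ballI impI)
      fix X assume X[measurable]: "X \<in> borel_measurable (F u)" and sq: "square_integrable M (\<lambda>\<omega>. X \<omega> * density_upto u \<omega>)"
      note [measurable] = density_measurable[OF au(1)] xi_measurable[OF j(1,2)] shifted_W_measurable[OF au(1)]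
      let ?H = "\<lambda>\<omega> x. X \<omega> * density_upto u \<omega> * (gauss_exp (v - u) (\<xi> j \<omega>) x * (shifted_W u \<omega> + x - \<xi> j \<omega> * (v - u)))"
      have H: "case_prod ?H \<in> borel_measurable (F u \<Otimes>\<^sub>M borel)"
        unfolding gauss_exp_def by measurable
      have eq: "X \<omega> * density_upto v \<omega> * shifted_W v \<omega> = ?H \<omega> (W v \<omega> - W u \<omega>)" for \<omega>
        using j by (simp add: density_cell[of j u v] shifted_W_cell[of j u v])
      have "square_integrable M (\<lambda>\<omega>. X \<omega> * density_upto v \<omega>)"
        using au j sq by (intro square_integrable_density_step(1)[of u v]) auto
      then have "integrable M (\<lambda>\<omega>. X \<omega> * density_upto v \<omega> * shifted_W v \<omega>)"
        using au j by (intro square_integrable_mult square_integrable_shifted_W) auto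
      then have "(\<integral>\<omega>. X \<omega> * density_upto v \<omega> * shifted_W v \<omega> \<partial>M)
        = (\<integral>\<omega>. (\<integral>x. normal_density 0 (sqrt (v - u)) x * ?H \<omega> x \<partial>lborel) \<partial>M)"
        unfolding eq by (rule integral_increment[OF au(2) j(3) H])
      also have "\<dots> = (\<integral>\<omega>. X \<omega> * density_upto u \<omega> * shifted_W u \<omega> \<partial>M)"
      proof (rule Bochner_Integration.integral_cong[OF refl])
        fix \<omega>
        have "(\<integral>x. normal_density 0 (sqrt (v - u)) x * ?H \<omega> x \<partial>lborel)
          = (\<integral>x. X \<omega> * density_upto u \<omega> * (normal_density 0 (sqrt (v - u)) x * (gauss_exp (v - u) (\<xi> j \<omega>) x * (shifted_W u \<omega> + x - \<xi> j \<omega> * (v - u)))) \<partial>lborel)"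
          by (intro Bochner_Integration.integral_cong) (simp_all only: mult_ac)
        also have "\<dots> = X \<omega> * density_upto u \<omega> * shifted_W u \<omega>"
          using integral_gauss_exp_centered[of "v - u"] j by simp
        finally show "(\<integral>x. normal_density 0 (sqrt (v - u)) x * ?H \<omega> x \<partial>lborel) = X \<omega> * density_upto u \<omega> * shifted_W u \<omega>" .
      qed
      finally show "(\<integral>\<omega>. X \<omega> * density_upto v \<omega> * shifted_W v \<omega> \<partial>M) = (\<integral>\<omega>. X \<omega> * density_upto u \<omega> * shifted_W u \<omega> \<partial>M)" .
    qed
  qed (use uv in simp_all)
  then show ?thesis using X sq by blast
qed

text \<open>
  The density at the final time \<open>b\<close> may be replaced by the one at time \<open>v\<close> or \<open>u\<close>, when the remaining factors are
  known by then.
\<close>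

lemma integral_density_increment:
  assumes uv: "a \<le> u" "u \<le> v" "v \<le> b" and X: "X \<in> borel_measurable (F u)"
    and sq: "square_integrable M (\<lambda>\<omega>. X \<omega> * density_upto u \<omega>)"
  shows "integrable M (\<lambda>\<omega>. X \<omega> * density_upto b \<omega> * (shifted_W v \<omega> - shifted_W u \<omega>))"
    and "(\<integral>\<omega>. X \<omega> * density_upto b \<omega> * (shifted_W v \<omega> - shifted_W u \<omega>) \<partial>M) = 0"
proof -
  have sqr: "square_integrable M (\<lambda>\<omega>. X \<omega> * density_upto r \<omega>)" if "u \<le> r" "r \<le> b" for r
    using that uv X sq by (intro square_integrable_density_step(1)[of u r]) auto
  have int: "integrable M (\<lambda>\<omega>. X \<omega> * density_upto r \<omega> * shifted_W s \<omega>)" if "u \<le> r" "r \<le> b" "a \<le> s" for r s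
    using that by (intro square_integrable_mult sqr square_integrable_shifted_W)
  have late: "(\<integral>\<omega>. X \<omega> * density_upto b \<omega> * shifted_W r \<omega> \<partial>M) = (\<integral>\<omega>. X \<omega> * density_upto r \<omega> * shifted_W r \<omega> \<partial>M)"
    if r: "u \<le> r" "r \<le> b" for r
  proof -
    have "(\<lambda>\<omega>. X \<omega> * shifted_W r \<omega>) \<in> borel_measurable (F r)"
      using r uv by (intro borel_measurable_times shifted_W_measurable measurable_F_mono[OF X]) auto
    moreover have "integrable M (\<lambda>\<omega>. X \<omega> * shifted_W r \<omega> * density_upto r \<omega>)"
      using int[of r r] r uv by (simp add: mult_ac)
    ultimately have "(\<integral>\<omega>. X \<omega> * shifted_W r \<omega> * density_upto b \<omega> \<partial>M) = (\<integral>\<omega>. X \<omega> * shifted_W r \<omega> * density_upto r \<omega> \<partial>M)"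
      using r uv by (intro integral_density(2)[of r b]) auto
    then show ?thesis by (simp add: mult_ac)
  qed
  have i: "integrable M (\<lambda>\<omega>. X \<omega> * density_upto b \<omega> * shifted_W v \<omega>)" "integrable M (\<lambda>\<omega>. X \<omega> * density_upto b \<omega> * shifted_W u \<omega>)"
    using int uv by auto
  then show "integrable M (\<lambda>\<omega>. X \<omega> * density_upto b \<omega> * (shifted_W v \<omega> - shifted_W u \<omega>))"
    by (simp add: right_diff_distrib)
  show "(\<integral>\<omega>. X \<omega> * density_upto b \<omega> * (shifted_W v \<omega> - shifted_W u \<omega>) \<partial>M) = 0"
    using i late[of u] late[of v] integral_density_shifted_W[OF uv X sq] uv
    by (simp add: right_diff_distrib)
qed

lemma drift_eq_integral:
  assumes "a \<le> u" "u \<le> v" "v \<le> b"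
  shows "(LINT r|lborel. indicator {u<..v} r * simple_value k \<tau> \<xi> r \<omega>) = drift_upto v \<omega> - drift_upto u \<omega>"
proof -
  have Int: "{u<..v} \<inter> {\<tau> i<..\<tau> (Suc i)} = {max u (\<tau> i)<..min v (\<tau> (Suc i))}" for i by auto
  have measure_Ioc: "measure lborel {p<..q} = (if p \<le> q then q - p else 0)" for p q :: real by simp
  have ind: "indicator {u<..v} r * simple_value k \<tau> \<xi> r \<omega>
     = (\<Sum>i<k. \<xi> i \<omega> * indicator {max u (\<tau> i)<..min v (\<tau> (Suc i))} r)" for r
    unfolding simple_value_def sum_distrib_left Int[symmetric]
    by (intro sum.cong) (auto simp: indicator_def)
  have "(LINT r|lborel. indicator {u<..v} r * simple_value k \<tau> \<xi> r \<omega>)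
     = (\<Sum>i<k. \<xi> i \<omega> * measure lborel {max u (\<tau> i)<..min v (\<tau> (Suc i))})"
    unfolding ind by (subst Bochner_Integration.integral_sum)
      (auto intro!: integrable_real_indicator emeasure_bounded_finite bounded_subset[OF bounded_cbox[of u v]])
  also have "\<dots> = (\<Sum>i<k. \<xi> i \<omega> * (min (\<tau> (Suc i)) v - min (\<tau> i) v) - \<xi> i \<omega> * (min (\<tau> (Suc i)) u - min (\<tau> i) u))"
  proof (intro sum.cong refl)
    fix i assume "i \<in> {..<k}"
    then have "\<tau> i \<le> \<tau> (Suc i)" using tau(3) by auto
    then have "measure lborel {max u (\<tau> i)<..min v (\<tau> (Suc i))}
      = (min (\<tau> (Suc i)) v - min (\<tau> i) v) - (min (\<tau> (Suc i)) u - min (\<tau> i) u)"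
      using assms(2) unfolding measure_Ioc by (smt (verit))
    then show "\<xi> i \<omega> * measure lborel {max u (\<tau> i)<..min v (\<tau> (Suc i))}
      = \<xi> i \<omega> * (min (\<tau> (Suc i)) v - min (\<tau> i) v) - \<xi> i \<omega> * (min (\<tau> (Suc i)) u - min (\<tau> i) u)"
      by (simp add: right_diff_distrib)
  qed
  also have "\<dots> = drift_upto v \<omega> - drift_upto u \<omega>"
    unfolding drift_upto_def step_sum_def by (rule sum_subtractf)
  finally show ?thesis .
qed

end

text \<open>
  The cells of a partition are disjoint, so at most one summand is not zero.
\<close>

lemma simple_value_cases:
  fixes \<xi> :: "nat \<Rightarrow> 'w \<Rightarrow> 'b::euclidean_space"
  assumes \<tau>: "\<forall>i<k. \<tau> i \<le> \<tau> (Suc i)"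
  shows "simple_value k \<tau> \<xi> r \<omega> = 0 \<or> (\<exists>j<k. simple_value k \<tau> \<xi> r \<omega> = \<xi> j \<omega>)"
proof (cases "\<exists>j<k. r \<in> {\<tau> j<..\<tau> (Suc j)}")
  case True
  then obtain j where j: "j < k" "r \<in> {\<tau> j<..\<tau> (Suc j)}" by blast
  have "r \<notin> {\<tau> i<..\<tau> (Suc i)}" if i: "i < k" "i \<noteq> j" for i
  proof (cases "i < j")
    case True
    then show ?thesis using partition_mono[OF \<tau>, of "Suc i" j] j by auto
  next
    case False
    then show ?thesis using partition_mono[OF \<tau>, of "Suc j" i] i j by auto
  qed
  then have "simple_value k \<tau> \<xi> r \<omega> = (\<Sum>i<k. if i = j then \<xi> j \<omega> else 0)"
    unfolding simple_value_def using j by (intro sum.cong) auto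
  then show ?thesis using j by auto
next
  case False
  then have "simple_value k \<tau> \<xi> r \<omega> = 0" unfolding simple_value_def by (intro sum.neutral) auto
  then show ?thesis ..
qed

context brownian_space
begin

lemma simple_integrand_measurable:
  assumes "simple_integrand M F s t k \<tau> \<xi>" "i < k"
  shows "\<xi> i \<in> borel_measurable M"
  using assms measurable_F_M unfolding simple_integrand_def by blast

lemma simple_integrand_bounded:
  assumes "simple_integrand M F s t k \<tau> \<xi>" "i < k"
  shows "\<exists>c. \<forall>\<omega>\<in>space M. norm (\<xi> i \<omega>) \<le> c"
  using assms unfolding simple_integrand_def by blast

lemma simple_value_measurable:
  fixes \<xi> :: "nat \<Rightarrow> 'w \<Rightarrow> real"
  assumes "simple_integrand M F s t k \<tau> \<xi>"
  shows "(\<lambda>(r, \<omega>). simple_value k \<tau> \<xi> r \<omega>) \<in> borel_measurable (LebM s' t')"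
  unfolding simple_value_def case_prod_unfold
proof (rule borel_measurable_sum)
  fix i assume "i \<in> {..<k}"
  then have [measurable]: "\<xi> i \<in> borel_measurable M" using simple_integrand_measurable[OF assms] by simp
  have [measurable]: "indicat_real {\<tau> i<..\<tau> (Suc i)} \<in> borel_measurable (Leb s' t')"
    by (rule borel_measurable_Leb) simp
  show "(\<lambda>z. indicat_real {\<tau> i<..\<tau> (Suc i)} (fst z) *\<^sub>R \<xi> i (snd z)) \<in> borel_measurable (LebM s' t')"
    by measurable
qed

lemma simple_value_bounded:
  fixes \<xi> :: "nat \<Rightarrow> 'w \<Rightarrow> real"
  assumes "simple_integrand M F s t k \<tau> \<xi>"
  shows "\<exists>c. \<forall>r. \<forall>\<omega>\<in>space M. \<bar>simple_value k \<tau> \<xi> r \<omega>\<bar> \<le> c"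
proof -
  have \<tau>: "\<forall>i<k. \<tau> i \<le> \<tau> (Suc i)" and "\<forall>i<k. \<exists>c. \<forall>\<omega>\<in>space M. norm (\<xi> i \<omega>) \<le> c"
    using assms by (auto simp: simple_integrand_def)
  then obtain c where c: "\<And>i \<omega>. i < k \<Longrightarrow> \<omega> \<in> space M \<Longrightarrow> \<bar>\<xi> i \<omega>\<bar> \<le> c i" by (metis real_norm_def)
  have "\<bar>simple_value k \<tau> \<xi> r \<omega>\<bar> \<le> (\<Sum>i<k. \<bar>c i\<bar>)" if \<omega>: "\<omega> \<in> space M" for r \<omega>
  proof -
    consider "simple_value k \<tau> \<xi> r \<omega> = 0" | j where "j < k" "simple_value k \<tau> \<xi> r \<omega> = \<xi> j \<omega>"
      using simple_value_cases[OF \<tau>, of \<xi> r \<omega>] by blast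
    then show ?thesis
    proof cases
      case 1 then show ?thesis by (simp add: sum_nonneg)
    next
      case 2
      have "\<bar>\<xi> j \<omega>\<bar> \<le> \<bar>c j\<bar>" using c[OF 2(1) \<omega>] by linarith
      also have "\<dots> \<le> (\<Sum>i<k. \<bar>c i\<bar>)" using 2(1) by (intro member_le_sum) auto
      finally show ?thesis using 2(2) by simp
    qed
  qed
  then show ?thesis by blast
qed

lemma square_integrable_simple_value:
  fixes \<xi> :: "nat \<Rightarrow> 'w \<Rightarrow> real"
  assumes "simple_integrand M F s t k \<tau> \<xi>"
  shows "square_integrable (LebM s' t') (\<lambda>(r, \<omega>). simple_value k \<tau> \<xi> r \<omega>)"
proof -
  obtain c where c: "\<And>r \<omega>. \<omega> \<in> space M \<Longrightarrow> \<bar>simple_value k \<tau> \<xi> r \<omega>\<bar> \<le> c"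
    using simple_value_bounded[OF assms] by blast
  have "AE z in LebM s' t'. \<bar>case z of (r, \<omega>) \<Rightarrow> simple_value k \<tau> \<xi> r \<omega>\<bar> \<le> \<bar>c\<bar>"
    by (rule AE_I2) (auto simp: space_pair_measure intro: order_trans[OF c abs_ge_self])
  then show ?thesis
    by (rule square_integrable_dominated[OF square_integrable_const[OF finite_measure_pair_Leb] simple_value_measurable[OF assms]])
qed

lemma square_integrable_simple_ito:
  fixes \<xi> :: "nat \<Rightarrow> 'w \<Rightarrow> real"
  assumes simple: "simple_integrand M F s t k \<tau> \<xi>" and s: "0 \<le> s"
  shows "square_integrable M (simple_ito W k \<tau> \<xi>)"
  unfolding simple_ito_def[abs_def]
proof (rule square_integrable_sum)
  fix i assume "i \<in> {..<k}"
  then have i: "i < k" by simp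
  have \<tau>: "\<forall>i<k. \<tau> i \<le> \<tau> (Suc i)" "\<tau> 0 = s" using simple by (auto simp: simple_integrand_def)
  obtain c where c: "\<And>\<omega>. \<omega> \<in> space M \<Longrightarrow> norm (\<xi> i \<omega>) \<le> c"
    using simple_integrand_bounded[OF simple i] by blast
  have "0 \<le> \<tau> i" using partition_mono[OF \<tau>(1), of 0 i] \<tau>(2) s i by simp
  then have "square_integrable M (\<lambda>\<omega>. \<xi> i \<omega> * (W (\<tau> (Suc i)) \<omega> - W (\<tau> i) \<omega>))"
    using c \<tau> i by (intro square_integrable_bounded_mult[OF square_integrable_increment simple_integrand_measurable[OF simple i]]) auto
  then show "square_integrable M (\<lambda>\<omega>. (W (\<tau> (Suc i)) \<omega> - W (\<tau> i) \<omega>) *\<^sub>R \<xi> i \<omega>)" by (simp add: mult.commute)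
qed

end

context exponential_density
begin

abbreviation kern :: "real \<Rightarrow> 'w \<Rightarrow> real" where
  "kern \<equiv> simple_value k \<tau> \<xi>"

lemma kern_bounded: "\<omega> \<in> space M \<Longrightarrow> \<bar>kern r \<omega>\<bar> \<le> \<bar>\<kappa>\<bar>"
  using simple_value_cases[OF tau(3), of \<xi> r \<omega>] bounded[of _ \<omega>] by fastforce

lemma kern_measurable: "(\<lambda>(r, \<omega>). kern r \<omega>) \<in> borel_measurable (LebM s t)"
  using simple_value_measurable[OF simple] .

lemma square_integrable_kern_mult:
  assumes "square_integrable (LebM s t) (\<lambda>(r, \<omega>). H r \<omega>)"
  shows "square_integrable (LebM s t) (\<lambda>(r, \<omega>). kern r \<omega> * H r \<omega>)"
proof -
  have "square_integrable (LebM s t) (\<lambda>z. (case z of (r, \<omega>) \<Rightarrow> kern r \<omega>) * (case z of (r, \<omega>) \<Rightarrow> H r \<omega>))"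
    using kern_bounded by (intro square_integrable_bounded_mult[where c = "\<bar>\<kappa>\<bar>", OF assms kern_measurable]) (auto simp: space_pair_measure)
  then show ?thesis by (simp add: case_prod_unfold)
qed

text \<open>
  The difference of the two sides is a sum over the cells of the integrand, and each summand is an
  increment of \<open>shifted_W\<close> tested against a variable known at the start of the cell. The partition of
  the integrand need not be related to that of the kernel.
\<close>

lemma integral_density_simple_ito:
  fixes \<xi>' :: "nat \<Rightarrow> 'w \<Rightarrow> real"
  assumes s: "a \<le> s" "s \<le> b" and simple': "simple_integrand M F s b k' \<tau>' \<xi>'"
    and \<zeta>: "\<zeta> \<in> borel_measurable (F a)" "square_integrable M \<zeta>"
  shows "(\<integral>\<omega>. \<zeta> \<omega> * density_upto b \<omega> * simple_ito W k' \<tau>' \<xi>' \<omega> \<partial>M)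
    = (\<integral>(r, \<omega>). \<zeta> \<omega> * density_upto b \<omega> * (kern r \<omega> * simple_value k' \<tau>' \<xi>' r \<omega>) \<partial>(LebM s b))"
proof -
  let ?\<eta> = "\<lambda>\<omega>. \<zeta> \<omega> * density_upto b \<omega>"
  have \<tau>': "\<forall>i<k'. \<tau>' i \<le> \<tau>' (Suc i)" "\<tau>' 0 = s" "\<tau>' k' = b" using simple' by (auto simp: simple_integrand_def)
  have range: "s \<le> \<tau>' i" "\<tau>' i \<le> b" if "i \<le> k'" for i
    using partition_mono[OF \<tau>'(1), of 0 i] partition_mono[OF \<tau>'(1), of i k'] \<tau>'(2,3) that by auto
  have sq: "square_integrable M ?\<eta>" using a_le_b \<zeta> by (intro square_integrable_density) auto
  have inner: "(\<integral>r. kern r \<omega> * simple_value k' \<tau>' \<xi>' r \<omega> \<partial>Leb s b)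
    = (\<Sum>i<k'. \<xi>' i \<omega> * (drift_upto (\<tau>' (Suc i)) \<omega> - drift_upto (\<tau>' i) \<omega>))" if \<omega>: "\<omega> \<in> space M" for \<omega>
  proof -
    have "(\<integral>r. kern r \<omega> * simple_value k' \<tau>' \<xi>' r \<omega> \<partial>Leb s b)
      = (\<integral>r. (\<Sum>i<k'. \<xi>' i \<omega> * (indicator {\<tau>' i<..\<tau>' (Suc i)} r * kern r \<omega>)) \<partial>Leb s b)"
      unfolding simple_value_def[of k'] sum_distrib_left by (intro Bochner_Integration.integral_cong refl sum.cong) (simp add: mult_ac)
    also have "\<dots> = (\<Sum>i<k'. \<xi>' i \<omega> * (\<integral>r. indicator {\<tau>' i<..\<tau>' (Suc i)} r * kern r \<omega> \<partial>Leb s b))"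
    proof (subst Bochner_Integration.integral_sum)
      fix i assume "i \<in> {..<k'}"
      interpret L: finite_measure "Leb s b" by (rule finite_measure_Leb)
      have "(\<lambda>r. (\<lambda>(r, \<omega>). kern r \<omega>) (r, \<omega>)) \<in> borel_measurable (Leb s b)"
        by (rule measurable_Pair1[OF kern_measurable \<omega>])
      then have [measurable]: "(\<lambda>r. kern r \<omega>) \<in> borel_measurable (Leb s b)" by simp
      have [measurable]: "indicat_real {\<tau>' i<..\<tau>' (Suc i)} \<in> borel_measurable (Leb s b)"
        by (rule borel_measurable_Leb) simp
      show "integrable (Leb s b) (\<lambda>r. \<xi>' i \<omega> * (indicator {\<tau>' i<..\<tau>' (Suc i)} r * kern r \<omega>))"
      proof (intro integrable_mult_right L.integrable_const_bound[of _ "\<bar>\<kappa>\<bar>"] AE_I2)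
        show "norm (indicat_real {\<tau>' i<..\<tau>' (Suc i)} r * kern r \<omega>) \<le> \<bar>\<kappa>\<bar>" for r
          using kern_bounded[OF \<omega>, of r] by (simp add: indicator_def)
      qed measurable
    qed simp
    also have "\<dots> = (\<Sum>i<k'. \<xi>' i \<omega> * (drift_upto (\<tau>' (Suc i)) \<omega> - drift_upto (\<tau>' i) \<omega>))"
    proof (intro sum.cong refl arg_cong2[where f="(*)"])
      fix i assume "i \<in> {..<k'}"
      then have i: "i < k'" by simp
      have "(\<integral>r. indicator {\<tau>' i<..\<tau>' (Suc i)} r * kern r \<omega> \<partial>Leb s b)
        = (LINT r|lborel. indicator {\<tau>' i<..\<tau>' (Suc i)} r * kern r \<omega>)"
        using range[of i] range[of "Suc i"] i
        by (subst integral_restrict_space) (auto intro!: Bochner_Integration.integral_cong simp: indicator_def set_lebesgue_integral_def)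
      also have "\<dots> = drift_upto (\<tau>' (Suc i)) \<omega> - drift_upto (\<tau>' i) \<omega>"
        using range[of i] range[of "Suc i"] i s \<tau>'(1) by (intro drift_eq_integral) auto
      finally show "(\<integral>r. indicator {\<tau>' i<..\<tau>' (Suc i)} r * kern r \<omega> \<partial>Leb s b)
         = drift_upto (\<tau>' (Suc i)) \<omega> - drift_upto (\<tau>' i) \<omega>" .
    qed
    finally show ?thesis .
  qed
  have sqkv: "square_integrable (LebM s b) (\<lambda>(r, \<omega>). kern r \<omega> * simple_value k' \<tau>' \<xi>' r \<omega>)"
    by (rule square_integrable_kern_mult[OF square_integrable_simple_value[OF simple']])
  have *: "integrable M (\<lambda>\<omega>. (\<zeta> \<omega> * \<xi>' i \<omega>) * density_upto b \<omega> * (shifted_W (\<tau>' (Suc i)) \<omega> - shifted_W (\<tau>' i) \<omega>))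
    \<and> (\<integral>\<omega>. (\<zeta> \<omega> * \<xi>' i \<omega>) * density_upto b \<omega> * (shifted_W (\<tau>' (Suc i)) \<omega> - shifted_W (\<tau>' i) \<omega>) \<partial>M) = 0"
    if i: "i < k'" for i
  proof -
    have r: "a \<le> \<tau>' i" "\<tau>' i \<le> \<tau>' (Suc i)" "\<tau>' (Suc i) \<le> b" "\<tau>' i \<le> b"
      using range[of i] range[of "Suc i"] i s \<tau>'(1) by auto
    have \<xi>': "\<xi>' i \<in> borel_measurable (F (\<tau>' i))" using simple' i by (simp add: simple_integrand_def)
    obtain c where c: "\<And>\<omega>. \<omega> \<in> space M \<Longrightarrow> norm (\<xi>' i \<omega>) \<le> c"
      using simple_integrand_bounded[OF simple' i] by blast
    have "(\<lambda>\<omega>. \<zeta> \<omega> * \<xi>' i \<omega>) \<in> borel_measurable (F (\<tau>' i))"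
      using \<xi>' r by (intro borel_measurable_times measurable_F_mono[OF \<zeta>(1)]) auto
    moreover have "square_integrable M (\<lambda>\<omega>. \<xi>' i \<omega> * (\<zeta> \<omega> * density_upto (\<tau>' i) \<omega>))"
      using c r \<zeta> measurable_F_M[OF \<xi>'] by (intro square_integrable_bounded_mult[OF square_integrable_density(1)]) auto
    then have "square_integrable M (\<lambda>\<omega>. (\<zeta> \<omega> * \<xi>' i \<omega>) * density_upto (\<tau>' i) \<omega>)" by (simp add: mult_ac)
    ultimately show ?thesis using integral_density_increment[OF r(1-3)] by blast
  qed
  have "(\<integral>\<omega>. ?\<eta> \<omega> * simple_ito W k' \<tau>' \<xi>' \<omega> \<partial>M)
      - (\<integral>(r, \<omega>). ?\<eta> \<omega> * (kern r \<omega> * simple_value k' \<tau>' \<xi>' r \<omega>) \<partial>(LebM s b))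
    = (\<integral>\<omega>. ?\<eta> \<omega> * simple_ito W k' \<tau>' \<xi>' \<omega> - ?\<eta> \<omega> * (\<integral>r. kern r \<omega> * simple_value k' \<tau>' \<xi>' r \<omega> \<partial>Leb s b) \<partial>M)"
    unfolding integral_mult_Leb(3)[OF sq sqkv, symmetric]
    using a_nonneg s integral_mult_Leb(2)[OF sq sqkv]
      square_integrable_mult[OF sq square_integrable_simple_ito[OF simple']]
    by (intro Bochner_Integration.integral_diff[symmetric]) auto
  also have "\<dots> = (\<integral>\<omega>. (\<Sum>i<k'. (\<zeta> \<omega> * \<xi>' i \<omega>) * density_upto b \<omega> * (shifted_W (\<tau>' (Suc i)) \<omega> - shifted_W (\<tau>' i) \<omega>)) \<partial>M)"
    by (intro Bochner_Integration.integral_cong refl)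
       (simp add: inner simple_ito_def shifted_W_def sum_distrib_left sum_subtractf[symmetric] algebra_simps)
  also have "\<dots> = (\<Sum>i<k'. \<integral>\<omega>. (\<zeta> \<omega> * \<xi>' i \<omega>) * density_upto b \<omega> * (shifted_W (\<tau>' (Suc i)) \<omega> - shifted_W (\<tau>' i) \<omega>) \<partial>M)"
    using * by (intro Bochner_Integration.integral_sum) auto
  also have "\<dots> = 0" using * by (intro sum.neutral) auto
  finally show ?thesis by simp
qed

text \<open>
  Girsanov's theorem in weak form: under the density, \<open>J\<close> has the same mean as the time integral of
  \<open>kern\<close> times \<open>H\<close>. For simple integrands this is \<open>integral_density_simple_ito\<close>, and both sides are continuous
  for the two \<open>L\<^sup>2\<close> limits that define the stochastic integral.
\<close>

lemma ito_duality:
  fixes H :: "real \<Rightarrow> 'w \<Rightarrow> real"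
  assumes s: "a \<le> s" "s \<le> b" and J: "has_ito_integral M F W s b H J"
    and H: "square_integrable (LebM s b) (\<lambda>(r, \<omega>). H r \<omega>)"
    and \<zeta>: "\<zeta> \<in> borel_measurable (F a)" "square_integrable M \<zeta>"
  shows "square_integrable M J"
    and "(\<integral>\<omega>. \<zeta> \<omega> * density_upto b \<omega> * J \<omega> \<partial>M)
      = (\<integral>(r, \<omega>). \<zeta> \<omega> * density_upto b \<omega> * (kern r \<omega> * H r \<omega>) \<partial>(LebM s b))"
proof -
  let ?\<eta> = "\<lambda>\<omega>. \<zeta> \<omega> * density_upto b \<omega>"
  obtain k' \<tau>' \<xi>' where simple': "\<And>m::nat. simple_integrand M F s b (k' m) (\<tau>' m) (\<xi>' m)"
    and lim_V: "(\<lambda>m. \<integral>\<^sup>+\<omega>. (\<integral>\<^sup>+r\<in>{s..b}.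
        ennreal ((norm (simple_value (k' m) (\<tau>' m) (\<xi>' m) r \<omega> - H r \<omega>))\<^sup>2) \<partial>lborel) \<partial>M) \<longlonglongrightarrow> 0"
    and lim_I: "(\<lambda>m. \<integral>\<^sup>+\<omega>. ennreal ((norm (simple_ito W (k' m) (\<tau>' m) (\<xi>' m) \<omega> - J \<omega>))\<^sup>2) \<partial>M) \<longlonglongrightarrow> 0"
    and J_meas[measurable]: "J \<in> borel_measurable M"
    using J unfolding has_ito_integral_def by blast
  define V where "V m = simple_value (k' m) (\<tau>' m) (\<xi>' m)" for m
  define I where "I m = simple_ito W (k' m) (\<tau>' m) (\<xi>' m)" for m
  have sq_I: "square_integrable M (I m)" for m
    unfolding I_def using square_integrable_simple_ito[OF simple'] a_nonneg s by simp
  have sq_V: "square_integrable (LebM s b) (\<lambda>(r, \<omega>). V m r \<omega>)" for m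
    unfolding V_def by (rule square_integrable_simple_value[OF simple'])
  have sq_\<eta>: "square_integrable M ?\<eta>" using a_le_b \<zeta> by (intro square_integrable_density) auto
  let ?\<eta>I = "\<lambda>m. \<integral>\<omega>. ?\<eta> \<omega> * I m \<omega> \<partial>M" and ?\<eta>J = "\<integral>\<omega>. ?\<eta> \<omega> * J \<omega> \<partial>M"
  let ?\<eta>V = "\<lambda>m. \<integral>(r, \<omega>). ?\<eta> \<omega> * (kern r \<omega> * V m r \<omega>) \<partial>(LebM s b)"
    and ?\<eta>H = "\<integral>(r, \<omega>). ?\<eta> \<omega> * (kern r \<omega> * H r \<omega>) \<partial>(LebM s b)"
  let ?err = "\<lambda>m. \<integral>z. (case z of (r, \<omega>) \<Rightarrow> kern r \<omega> * (V m r \<omega> - H r \<omega>))\<^sup>2 \<partial>(LebM s b)"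
  define dI where "dI m = (\<integral>\<^sup>+\<omega>. ennreal ((I m \<omega> - J \<omega>)\<^sup>2) \<partial>M)" for m
  define dV where "dV m = (\<integral>\<^sup>+\<omega>. (\<integral>\<^sup>+r\<in>{s..b}. ennreal ((V m r \<omega> - H r \<omega>)\<^sup>2) \<partial>lborel) \<partial>M)" for m
  have dI: "dI \<longlonglongrightarrow> 0" using lim_I unfolding dI_def I_def by simp
  have dV: "dV \<longlonglongrightarrow> 0" using lim_V unfolding dV_def V_def by simp
  have I_meas[measurable]: "I m \<in> borel_measurable M" for m using sq_I by (simp add: square_integrable_def)
  have sq_IJ: "square_integrable M (\<lambda>\<omega>. I m \<omega> - J \<omega>)" if "dI m < \<infinity>" for m
    using that square_integrable_nn_iff[of "\<lambda>\<omega>. I m \<omega> - J \<omega>" M] by (simp add: dI_def)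
  have ev: "\<forall>\<^sub>F m in sequentially. dI m < \<infinity>"
    using order_tendstoD(2)[OF dI, of \<infinity>] by simp
  then obtain m0 where "dI m0 < \<infinity>" by (auto simp: eventually_sequentially)
  from square_integrable_diff[OF sq_I[of m0] sq_IJ[OF this]] show sq_J: "square_integrable M J" by simp
  have A_eq: "?\<eta>I m = ?\<eta>V m" for m
    unfolding I_def V_def by (rule integral_density_simple_ito[OF s simple' \<zeta>])
  have lim1: "(\<lambda>m. ?\<eta>I m - ?\<eta>J) \<longlonglongrightarrow> 0"
  proof (rule Lim_null_comparison)
    show "\<forall>\<^sub>F m in sequentially. norm (?\<eta>I m - ?\<eta>J)
      \<le> sqrt (\<integral>\<omega>. (?\<eta> \<omega>)\<^sup>2 \<partial>M) * sqrt (enn2real (dI m))"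
      using ev
    proof eventually_elim
      case (elim m)
      have "?\<eta>I m - ?\<eta>J = (\<integral>\<omega>. ?\<eta> \<omega> * (I m \<omega> - J \<omega>) \<partial>M)"
        using square_integrable_mult[OF sq_\<eta> sq_I] square_integrable_mult[OF sq_\<eta> sq_J]
        by (simp add: right_diff_distrib)
      moreover have "(\<integral>\<omega>. (I m \<omega> - J \<omega>)\<^sup>2 \<partial>M) = enn2real (dI m)"
        unfolding dI_def by (rule integral_eq_nn_integral) auto
      ultimately show ?case using Cauchy_Schwarz_integral[OF sq_\<eta> sq_IJ[OF elim]] by simp
    qed
    have "(\<lambda>m. enn2real (dI m)) \<longlonglongrightarrow> 0" using tendsto_enn2real[of dI 0] dI by simp
    then have "(\<lambda>m. sqrt (\<integral>\<omega>. (?\<eta> \<omega>)\<^sup>2 \<partial>M) * sqrt (enn2real (dI m))) \<longlonglongrightarrow> sqrt (\<integral>\<omega>. (?\<eta> \<omega>)\<^sup>2 \<partial>M) * sqrt 0"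
      by (intro tendsto_mult tendsto_const tendsto_real_sqrt)
    then show "(\<lambda>m. sqrt (\<integral>\<omega>. (?\<eta> \<omega>)\<^sup>2 \<partial>M) * sqrt (enn2real (dI m))) \<longlonglongrightarrow> 0" by simp
  qed
  have sq_VH: "square_integrable (LebM s b) (\<lambda>(r, \<omega>). V m r \<omega> - H r \<omega>)" for m
    using square_integrable_diff[OF sq_V[of m] H] by (simp add: case_prod_unfold)
  have lim2: "(\<lambda>m. ?\<eta>V m
       - ?\<eta>H) \<longlonglongrightarrow> 0"
  proof (rule Lim_null_comparison)
    let ?C = "sqrt ((b - s) * (\<integral>\<omega>. (?\<eta> \<omega>)\<^sup>2 \<partial>M))"
    show "\<forall>\<^sub>F m in sequentially. norm (?\<eta>V m
       - ?\<eta>H)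
      \<le> ?C * (\<bar>\<kappa>\<bar> * sqrt (enn2real (dV m)))"
    proof (rule always_eventually, rule allI)
      fix m
      note sqk = square_integrable_kern_mult[OF sq_VH[of m]]
      have "?\<eta>V m - ?\<eta>H
        = (\<integral>(r, \<omega>). ?\<eta> \<omega> * (kern r \<omega> * (V m r \<omega> - H r \<omega>)) \<partial>(LebM s b))"
        using integral_mult_Leb(1)[OF sq_\<eta> square_integrable_kern_mult[OF sq_V[of m]]]
          integral_mult_Leb(1)[OF sq_\<eta> square_integrable_kern_mult[OF H]]
        by (subst Bochner_Integration.integral_diff[symmetric]) (auto simp: case_prod_unfold right_diff_distrib)
      then have "norm (?\<eta>V m - ?\<eta>H)
        \<le> ?C * sqrt (?err m)"
        using integral_mult_Leb(4)[OF sq_\<eta> sqk s(2)] by simp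
      also have "\<dots> \<le> ?C * (\<bar>\<kappa>\<bar> * sqrt (enn2real (dV m)))"
      proof (rule mult_left_mono)
        have "(?err m)
          \<le> (\<integral>z. \<kappa>\<^sup>2 * (case z of (r, \<omega>) \<Rightarrow> V m r \<omega> - H r \<omega>)\<^sup>2 \<partial>(LebM s b))"
        proof (rule integral_mono)
          show "integrable (LebM s b) (\<lambda>z. (case z of (r, \<omega>) \<Rightarrow> kern r \<omega> * (V m r \<omega> - H r \<omega>))\<^sup>2)"
            using sqk by (simp add: square_integrable_def)
          show "integrable (LebM s b) (\<lambda>z. \<kappa>\<^sup>2 * (case z of (r, \<omega>) \<Rightarrow> V m r \<omega> - H r \<omega>)\<^sup>2)"
            using sq_VH[of m] by (simp add: square_integrable_def)
          fix z assume "z \<in> space (LebM s b)"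
          then obtain r \<omega> where z: "z = (r, \<omega>)" "\<omega> \<in> space M" by (auto simp: space_pair_measure)
          have "(kern r \<omega>)\<^sup>2 \<le> \<kappa>\<^sup>2" using kern_bounded[OF z(2), of r] by (simp add: abs_le_square_iff)
          then show "(case z of (r, \<omega>) \<Rightarrow> kern r \<omega> * (V m r \<omega> - H r \<omega>))\<^sup>2 \<le> \<kappa>\<^sup>2 * (case z of (r, \<omega>) \<Rightarrow> V m r \<omega> - H r \<omega>)\<^sup>2"
            by (simp add: z power_mult_distrib mult_right_mono)
        qed
        also have "\<dots> = \<kappa>\<^sup>2 * enn2real (dV m)"
          using square_integrable_Leb_iff(2)[OF _ sq_VH[of m]] sq_VH[of m] by (simp add: dV_def square_integrable_def)
        finally have "sqrt (?err m) \<le> sqrt (\<kappa>\<^sup>2 * enn2real (dV m))"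
          by (rule real_sqrt_le_mono)
        then show "sqrt (?err m) \<le> \<bar>\<kappa>\<bar> * sqrt (enn2real (dV m))"
          by (simp add: real_sqrt_mult)
      qed (use s in simp)
      finally show "norm (?\<eta>V m - ?\<eta>H)
        \<le> ?C * (\<bar>\<kappa>\<bar> * sqrt (enn2real (dV m)))" .
    qed
    have "(\<lambda>m. enn2real (dV m)) \<longlonglongrightarrow> 0" using tendsto_enn2real[of dV 0] dV by simp
    then have "(\<lambda>m. ?C * (\<bar>\<kappa>\<bar> * sqrt (enn2real (dV m)))) \<longlonglongrightarrow> ?C * (\<bar>\<kappa>\<bar> * sqrt 0)"
      by (intro tendsto_mult tendsto_const tendsto_real_sqrt)
    then show "(\<lambda>m. ?C * (\<bar>\<kappa>\<bar> * sqrt (enn2real (dV m)))) \<longlonglongrightarrow> 0" by simp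
  qed
  have "(\<lambda>m. ?\<eta>V m) \<longlonglongrightarrow> ?\<eta>J"
    using lim1 unfolding A_eq by (simp add: LIM_zero_iff)
  moreover have "(\<lambda>m. ?\<eta>V m)
     \<longlonglongrightarrow> ?\<eta>H"
    using lim2 by (simp add: LIM_zero_iff)
  ultimately show "?\<eta>J = ?\<eta>H"
    by (rule LIMSEQ_unique)
qed

end

section \<open>Bounded progressive processes as limits of simple ones\<close>

definition grid :: "real \<Rightarrow> real \<Rightarrow> nat \<Rightarrow> nat \<Rightarrow> real" where
  "grid a b n i = a + real i * ((b - a) / real n)"

text \<open>
  The average is taken over the cell that precedes the \<open>i\<close>-th grid point, so that it is known at that
  point. For \<open>i = 0\<close> the truncated subtraction makes the domain empty and the average zero.
\<close>

definition cell_average :: "real \<Rightarrow> real \<Rightarrow> nat \<Rightarrow> (real \<Rightarrow> real) \<Rightarrow> nat \<Rightarrow> real" where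
  "cell_average a b n f i = (LINT r:{grid a b n (i - 1)<..grid a b n i}|lborel. f r) / ((b - a) / real n)"

text \<open>
  The step function that carries the average over each cell to the next cell. As \<open>n\<close> grows it converges
  to \<open>f\<close> in \<open>L\<^sup>1\<close>: it does so pointwise for continuous \<open>f\<close>, and the operator is a contraction of
  \<open>L\<^sup>1\<close>, in which the continuous functions are dense.
\<close>

definition cell_step :: "real \<Rightarrow> real \<Rightarrow> nat \<Rightarrow> (real \<Rightarrow> real) \<Rightarrow> real \<Rightarrow> real" where
  "cell_step a b n f r = (\<Sum>i<n. indicator {grid a b n i<..grid a b n (Suc i)} r * cell_average a b n f i)"

lemma integrable_indicator_Ioc:
  fixes p q :: real
  shows "integrable lborel (indicat_real {p<..q})"
proof (cases "p \<le> q")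
  case True
  then show ?thesis by (intro integrable_real_indicator) auto
next
  case False
  then have "{p<..q} = {}" by simp
  then show ?thesis by simp
qed

lemma set_integrable_bounded_Ioc:
  fixes f :: "real \<Rightarrow> real"
  assumes "f \<in> borel_measurable borel" "\<And>r. \<bar>f r\<bar> \<le> \<kappa>"
  shows "set_integrable lborel {p<..q} f"
  unfolding set_integrable_def
proof (rule Bochner_Integration.integrable_bound)
  show "integrable lborel (\<lambda>r. indicat_real {p<..q} r * \<kappa>)"
    by (intro integrable_mult_left integrable_indicator_Ioc)
  show "(\<lambda>r. indicat_real {p<..q} r *\<^sub>R f r) \<in> borel_measurable lborel" using assms(1) by measurable
  show "AE r in lborel. norm (indicat_real {p<..q} r *\<^sub>R f r) \<le> norm (indicat_real {p<..q} r * \<kappa>)"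
    by (rule AE_I2) (auto simp: indicator_def intro: order_trans[OF assms(2) abs_ge_self])
qed

lemma set_integral_norm_bound_Ioc:
  fixes f :: "real \<Rightarrow> real"
  assumes f: "f \<in> borel_measurable borel" "\<And>r. \<bar>f r\<bar> \<le> \<kappa>"
    and c: "\<And>r. p < r \<Longrightarrow> r \<le> q \<Longrightarrow> \<bar>f r\<bar> \<le> c" and pq: "p \<le> q"
  shows "\<bar>LINT r:{p<..q}|lborel. f r\<bar> \<le> c * (q - p)"
proof -
  have "\<bar>LINT r:{p<..q}|lborel. f r\<bar> \<le> (LINT r:{p<..q}|lborel. \<bar>f r\<bar>)"
    using set_integral_norm_bound[OF set_integrable_bounded_Ioc[OF f, of p q]] by simp
  also have "\<dots> \<le> (LINT r:{p<..q}|lborel. c)"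
    using f c by (intro set_integral_mono set_integrable_bounded_Ioc[of _ \<kappa>] set_integrable_bounded_Ioc[of _ "\<bar>c\<bar>"]) auto
  also have "\<dots> = c * (q - p)" using pq by (simp add: set_lebesgue_integral_def)
  finally show ?thesis .
qed

lemma set_integral_Ioc_diff:
  fixes f :: "real \<Rightarrow> real"
  assumes f: "f \<in> borel_measurable borel" "\<And>r. \<bar>f r\<bar> \<le> \<kappa>" and "a \<le> p" "p \<le> q"
  shows "(LINT r:{p<..q}|lborel. f r) = (LINT r:{a<..q}|lborel. f r) - (LINT r:{a<..p}|lborel. f r)"
proof -
  have "{a<..q} = {a<..p} \<union> {p<..q}" using assms(3,4) by auto
  moreover have "(LINT r:{a<..p} \<union> {p<..q}|lborel. f r) = (LINT r:{a<..p}|lborel. f r) + (LINT r:{p<..q}|lborel. f r)"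
    by (intro set_integral_Un set_integrable_bounded_Ioc[OF f]) auto
  ultimately show ?thesis by simp
qed

context
  fixes a b :: real and n :: nat
  assumes ab: "a < b" and n: "0 < n"
begin

lemma grid_simps: "grid a b n 0 = a" "grid a b n n = b" "grid a b n (Suc i) = grid a b n i + (b - a) / real n"
  using n by (auto simp: grid_def field_simps)

lemma grid_mono: "i \<le> j \<Longrightarrow> grid a b n i \<le> grid a b n j"
  unfolding grid_def using ab by (intro add_left_mono mult_right_mono) auto

lemma grid_ge: "a \<le> grid a b n i"
  using grid_mono[of 0 i] by (simp add: grid_simps)

lemma grid_le: "i \<le> n \<Longrightarrow> grid a b n i \<le> b"
  using grid_mono[of i n] by (simp add: grid_simps)

lemma cell_width: "0 < (b - a) / real n" using ab n by simp

lemma cell_average_bounded: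
  assumes f: "f \<in> borel_measurable borel" "\<And>r. \<bar>f r\<bar> \<le> \<kappa>"
  shows "\<bar>cell_average a b n f i\<bar> \<le> \<kappa>"
proof -
  have \<kappa>: "0 \<le> \<kappa>" using f(2)[of 0] by linarith
  have "\<bar>LINT r:{grid a b n (i - 1)<..grid a b n i}|lborel. f r\<bar> \<le> \<kappa> * (grid a b n i - grid a b n (i - 1))"
    by (intro set_integral_norm_bound_Ioc[OF f]) (auto intro!: f grid_mono)
  also have "\<dots> \<le> \<kappa> * ((b - a) / real n)"
    using \<kappa> cell_width by (intro mult_left_mono) (cases i; simp add: grid_simps)+
  finally have "\<bar>LINT r:{grid a b n (i - 1)<..grid a b n i}|lborel. f r\<bar> / \<bar>(b - a) / real n\<bar> \<le> \<kappa>"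
    unfolding abs_of_pos[OF cell_width] pos_divide_le_eq[OF cell_width] .
  then show ?thesis by (simp only: cell_average_def abs_divide[symmetric])
qed

lemma cell_step_measurable [measurable]: "cell_step a b n f \<in> borel_measurable borel"
  unfolding cell_step_def[abs_def]
  by (intro borel_measurable_sum borel_measurable_times borel_measurable_indicator borel_measurable_const) auto

lemma cell_step_eq:
  assumes "i < n" "r \<in> {grid a b n i<..grid a b n (Suc i)}"
  shows "cell_step a b n f r = cell_average a b n f i"
proof -
  have "r \<notin> {grid a b n j<..grid a b n (Suc j)}" if "j \<noteq> i" for j
    using that assms grid_mono[of "Suc j" i] grid_mono[of "Suc i" j] by (cases "j < i") auto
  then have "cell_step a b n f r = (\<Sum>j<n. if j = i then cell_average a b n f i else 0)"
    unfolding cell_step_def using assms by (intro sum.cong) auto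
  then show ?thesis using assms by simp
qed

lemma cell_exists:
  assumes "a < r" "r \<le> b"
  shows "\<exists>i<n. r \<in> {grid a b n i<..grid a b n (Suc i)}"
proof -
  have "\<forall>r. a < r \<longrightarrow> r \<le> grid a b n m \<longrightarrow> (\<exists>i<m. r \<in> {grid a b n i<..grid a b n (Suc i)})" for m
  proof (induction m)
    case 0 then show ?case by (simp add: grid_simps(1))
  next
    case (Suc m)
    show ?case
    proof (intro allI impI)
      fix r assume r: "a < r" "r \<le> grid a b n (Suc m)"
      show "\<exists>i<Suc m. r \<in> {grid a b n i<..grid a b n (Suc i)}"
      proof (cases "r \<le> grid a b n m")
        case True
        then show ?thesis using Suc r less_SucI by blast
      next
        case False
        then show ?thesis using r by (intro exI[of _ m]) auto
      qed
    qed
  qed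
  then show ?thesis using assms by (metis grid_simps(2))
qed

lemma cell_step_bounded:
  assumes f: "f \<in> borel_measurable borel" "\<And>r. \<bar>f r\<bar> \<le> \<kappa>"
  shows "\<bar>cell_step a b n f r\<bar> \<le> \<kappa>"
proof (cases "\<exists>i<n. r \<in> {grid a b n i<..grid a b n (Suc i)}")
  case True
  then obtain i where "i < n" "r \<in> {grid a b n i<..grid a b n (Suc i)}" by blast
  then show ?thesis using cell_average_bounded[OF f] by (simp add: cell_step_eq)
next
  case False
  then have "cell_step a b n f r = 0" unfolding cell_step_def by (intro sum.neutral) auto
  moreover have "0 \<le> \<kappa>" using f(2)[of 0] by linarith
  ultimately show ?thesis by simp
qed

text \<open>
  The integral of the step function over a cell is at most that of \<open>\<bar>f\<bar>\<close> over the preceding cell.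
\<close>

lemma cell_step_contraction:
  assumes f: "f \<in> borel_measurable borel" "\<And>r. \<bar>f r\<bar> \<le> \<kappa>"
  shows "(LINT r:{a<..b}|lborel. \<bar>cell_step a b n f r\<bar>) \<le> (LINT r:{a<..b}|lborel. \<bar>f r\<bar>)"
proof -
  let ?g = "grid a b n" and ?h = "(b - a) / real n"
  let ?G = "\<lambda>t. LINT r:{a<..t}|lborel. \<bar>f r\<bar>"
  have f': "(\<lambda>r. \<bar>f r\<bar>) \<in> borel_measurable borel" "\<And>r. \<bar>\<bar>f r\<bar>\<bar> \<le> \<kappa>" using f by auto
  have diff: "(LINT r:{?g i<..?g j}|lborel. \<bar>f r\<bar>) = ?G (?g j) - ?G (?g i)" if "i \<le> j" for i j
    using that by (intro set_integral_Ioc_diff[OF f'] grid_ge grid_mono)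
  have avg: "\<bar>cell_average a b n f i\<bar> * ?h \<le> ?G (?g i) - ?G (?g (i - 1))" for i
  proof -
    have "\<bar>cell_average a b n f i\<bar> * ?h = \<bar>LINT r:{?g (i - 1)<..?g i}|lborel. f r\<bar>"
      using ab n by (simp add: cell_average_def abs_mult)
    also have "\<dots> \<le> (LINT r:{?g (i - 1)<..?g i}|lborel. \<bar>f r\<bar>)"
      using set_integral_norm_bound[OF set_integrable_bounded_Ioc[OF f]] by simp
    finally show ?thesis using diff[of "i - 1" i] by simp
  qed
  have "(LINT r:{a<..b}|lborel. \<bar>cell_step a b n f r\<bar>)
    \<le> (LINT r|lborel. (\<Sum>i<n. indicator {?g i<..?g (Suc i)} r * \<bar>cell_average a b n f i\<bar>))"
    unfolding set_lebesgue_integral_def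
  proof (rule integral_mono)
    show "integrable lborel (\<lambda>r. indicator {a<..b} r *\<^sub>R \<bar>cell_step a b n f r\<bar>)"
      using set_integrable_bounded_Ioc[of "\<lambda>r. \<bar>cell_step a b n f r\<bar>" \<kappa> a b] cell_step_bounded[OF f]
      by (simp add: set_integrable_def)
    show "integrable lborel (\<lambda>r. \<Sum>i<n. indicator {?g i<..?g (Suc i)} r * \<bar>cell_average a b n f i\<bar>)"
      by (intro Bochner_Integration.integrable_sum integrable_mult_left integrable_indicator_Ioc)
    fix r
    show "indicator {a<..b} r *\<^sub>R \<bar>cell_step a b n f r\<bar> \<le> (\<Sum>i<n. indicator {?g i<..?g (Suc i)} r * \<bar>cell_average a b n f i\<bar>)"
    proof -
      have "indicator {a<..b} r *\<^sub>R \<bar>cell_step a b n f r\<bar> \<le> \<bar>cell_step a b n f r\<bar>" by (simp add: indicator_def)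
      also have "\<dots> \<le> (\<Sum>i<n. indicator {?g i<..?g (Suc i)} r * \<bar>cell_average a b n f i\<bar>)"
        unfolding cell_step_def by (rule order_trans[OF sum_abs]) (simp add: abs_mult)
      finally show ?thesis .
    qed
  qed
  also have "\<dots> = (\<Sum>i<n. \<bar>cell_average a b n f i\<bar> * ?h)"
  proof (subst Bochner_Integration.integral_sum)
    show "integrable lborel (\<lambda>r. indicator {?g i<..?g (Suc i)} r * \<bar>cell_average a b n f i\<bar>)" for i
      by (intro integrable_mult_left integrable_indicator_Ioc)
    show "(\<Sum>i<n. LINT r|lborel. indicator {?g i<..?g (Suc i)} r * \<bar>cell_average a b n f i\<bar>) = (\<Sum>i<n. \<bar>cell_average a b n f i\<bar> * ?h)"
      using cell_width by (intro sum.cong) (auto simp: grid_simps)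
  qed
  also have "\<dots> \<le> (\<Sum>i<n. ?G (?g i) - ?G (?g (i - 1)))" by (intro sum_mono avg)
  also have "\<dots> = ?G (?g (n - 1)) - ?G (?g 0)"
  proof -
    obtain m where m: "n = Suc m" using n by (cases n) auto
    have "(\<Sum>i<Suc m. ?G (?g i) - ?G (?g (i - 1))) = (\<Sum>i<m. ?G (?g (Suc i)) - ?G (?g i))"
      by (subst sum.lessThan_Suc_shift) simp
    also have "\<dots> = ?G (?g m) - ?G (?g 0)" by (rule sum_lessThan_telescope)
    finally show ?thesis using m by simp
  qed
  also have "\<dots> \<le> ?G b"
  proof -
    have "?G b - ?G (?g (n - 1)) = (LINT r:{?g (n - 1)<..?g n}|lborel. \<bar>f r\<bar>)"
      using diff[of "n - 1" n] by (simp add: grid_simps(2))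
    also have "\<dots> \<ge> 0" by (simp add: set_lebesgue_integral_def integral_nonneg_AE)
    finally have "?G (?g (n - 1)) \<le> ?G b" by simp
    moreover have "?G (?g 0) = 0" by (simp add: grid_simps(1) set_lebesgue_integral_def)
    ultimately show ?thesis by simp
  qed
  finally show ?thesis .
qed

lemma cell_step_diff:
  assumes f: "f \<in> borel_measurable borel" "\<And>r. \<bar>f r\<bar> \<le> \<kappa>"
    and g: "g \<in> borel_measurable borel" "\<And>r. \<bar>g r\<bar> \<le> \<kappa>"
  shows "cell_step a b n (\<lambda>r. f r - g r) r = cell_step a b n f r - cell_step a b n g r"
proof -
  have "cell_average a b n (\<lambda>r. f r - g r) i = cell_average a b n f i - cell_average a b n g i" for i
    unfolding cell_average_def
    by (subst set_integral_diff(2)[OF set_integrable_bounded_Ioc[OF f] set_integrable_bounded_Ioc[OF g]]) (simp add: diff_divide_distrib)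
  then show ?thesis unfolding cell_step_def by (simp add: right_diff_distrib sum_subtractf)
qed

end

lemma cell_step_continuous:
  assumes ab: "a < b" and g: "continuous_on UNIV g" "\<And>r. \<bar>g r\<bar> \<le> \<kappa>" and r: "a < r" "r \<le> b"
  shows "(\<lambda>m. cell_step a b (Suc m) g r) \<longlonglongrightarrow> g r"
proof (rule LIMSEQ_I)
  fix e :: real assume e: "0 < e"
  have gm: "g \<in> borel_measurable borel" using g(1) by (rule borel_measurable_continuous_onI)
  obtain d where d: "0 < d" "\<And>x. \<bar>x - r\<bar> < d \<Longrightarrow> \<bar>g x - g r\<bar> < e / 2"
    using g(1) e unfolding continuous_on_iff dist_real_def by (metis UNIV_I half_gt_zero)
  define D where "D = min (d / 2) (r - a)"
  have D: "0 < D" using d r by (simp add: D_def)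
  have "(\<lambda>m. (b - a) / real (Suc m)) \<longlonglongrightarrow> 0"
    by (rule LIMSEQ_Suc[OF lim_const_over_n])
  then have "\<forall>\<^sub>F m in sequentially. (b - a) / real (Suc m) < D" using D by (rule order_tendstoD)
  then obtain m0 where m0: "\<And>m. m \<ge> m0 \<Longrightarrow> (b - a) / real (Suc m) < D" by (auto simp: eventually_sequentially)
  show "\<exists>no. \<forall>m\<ge>no. norm (cell_step a b (Suc m) g r - g r) < e"
  proof (intro exI allI impI)
    fix m assume "m0 \<le> m"
    then have h: "(b - a) / real (Suc m) < D" by (rule m0)
    let ?n = "Suc m" and ?h = "(b - a) / real (Suc m)"
    have n: "0 < ?n" by simp
    obtain i where i: "i < ?n" "r \<in> {grid a b ?n i<..grid a b ?n (Suc i)}"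
      using cell_exists[OF ab n r] by blast
    \<comment> \<open>the first cell is too short to reach \<open>r\<close>, so the average over a full preceding cell is used\<close>
    have "i \<noteq> 0"
    proof
      assume "i = 0"
      then have "r \<le> a + ?h" using i(2) grid_simps[OF ab n] by simp
      then show False using h by (simp add: D_def)
    qed
    then obtain j where j: "i = Suc j" by (cases i) auto
    let ?p = "grid a b ?n j"
    have cell: "grid a b ?n i = ?p + ?h" "grid a b ?n (Suc i) = ?p + ?h + ?h"
      using grid_simps(3)[OF ab n] by (simp_all add: j)
    have h0: "0 < ?h" using ab by simp
    have average_eq: "cell_average a b ?n g i - g r = (LINT x:{?p<..?p + ?h}|lborel. g x - g r) / ?h"
    proof -
      have "(LINT x:{?p<..?p + ?h}|lborel. g x - g r) = (LINT x:{?p<..?p + ?h}|lborel. g x) - (LINT x:{?p<..?p + ?h}|lborel. g r)"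
        using g(2) by (intro set_integral_diff set_integrable_bounded_Ioc[OF gm] set_integrable_bounded_Ioc[of "\<lambda>_. g r" \<kappa>]) auto
      also have "(LINT x:{?p<..?p + ?h}|lborel. g r) = g r * ?h"
        using h0 by (simp add: set_lebesgue_integral_def)
      finally have "(LINT x:{?p<..?p + ?h}|lborel. g x - g r) / ?h = (LINT x:{?p<..?p + ?h}|lborel. g x) / ?h - g r"
        using diff_divide_distrib[of _ _ ?h] nonzero_mult_div_cancel_right[OF less_imp_neq[OF h0, symmetric]] by metis
      then show ?thesis unfolding cell_average_def cell by (simp only: j diff_Suc_1)
    qed
    have quot: "\<bar>I / x\<bar> \<le> e / 2" if "\<bar>I\<bar> \<le> (e / 2) * ((p + x) - p)" "0 < x" for I p x :: real
      using that by (simp add: abs_divide pos_divide_le_eq)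
    have "\<bar>LINT x:{?p<..?p + ?h}|lborel. g x - g r\<bar> \<le> (e / 2) * ((?p + ?h) - ?p)"
    proof (rule set_integral_norm_bound_Ioc)
      show "(\<lambda>x. g x - g r) \<in> borel_measurable borel" using gm by measurable
      show "\<bar>g x - g r\<bar> \<le> 2 * \<kappa>" for x using g(2)[of x] g(2)[of r] by linarith
      fix x assume "?p < x" "x \<le> ?p + ?h"
      moreover have "?p + ?h < r" "r \<le> ?p + ?h + ?h" using i(2) cell by auto
      ultimately have "\<bar>x - r\<bar> < 2 * ?h" by linarith
      also have "\<dots> < d" using h unfolding D_def min_less_iff_conj by linarith
      finally show "\<bar>g x - g r\<bar> \<le> e / 2" using d(2)[of x] by simp
    qed (use h0 in simp)
    from quot[OF this h0] have "\<bar>cell_average a b ?n g i - g r\<bar> \<le> e / 2"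
      unfolding average_eq .
    then show "norm (cell_step a b (Suc m) g r - g r) < e"
      using e cell_step_eq[OF ab n i] by simp
  qed
qed

text \<open>
  A measurable function is an almost everywhere limit of continuous functions; truncating these at the
  bound of \<open>f\<close> makes the convergence dominated.
\<close>

lemma continuous_L1_approximation:
  fixes f :: "real \<Rightarrow> real"
  assumes f: "f \<in> borel_measurable borel" "\<And>r. \<bar>f r\<bar> \<le> \<kappa>" and e: "0 < e"
  obtains g where "continuous_on UNIV g" "\<And>r. \<bar>g r\<bar> \<le> \<kappa>" "(LINT r:{a<..b}|lborel. \<bar>f r - g r\<bar>) < e"
proof -
  have [measurable]: "f \<in> borel_measurable borel" by fact
  have "f measurable_on UNIV"
    using f(1) by (intro lebesgue_measurable_imp_measurable_on measurable_completion) auto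
  then obtain N g where N: "negligible N" and g: "\<And>n. continuous_on UNIV (g n)"
    and lim: "\<And>x. x \<notin> N \<Longrightarrow> (\<lambda>n. g n x) \<longlonglongrightarrow> f x"
    unfolding measurable_on_def by auto
  have \<kappa>: "0 \<le> \<kappa>" using f(2)[of 0] by linarith
  define G where "G n x = max (- \<kappa>) (min \<kappa> (g n x))" for n x
  have G_cont: "continuous_on UNIV (G n)" for n unfolding G_def[abs_def] by (intro continuous_intros g)
  have [measurable]: "G n \<in> borel_measurable borel" for n using G_cont by (rule borel_measurable_continuous_onI)
  have G_le: "\<bar>G n x\<bar> \<le> \<kappa>" for n x using \<kappa> by (auto simp: G_def)
  have G_lim: "(\<lambda>n. G n x) \<longlonglongrightarrow> f x" if "x \<notin> N" for x
  proof -
    have "(\<lambda>n. G n x) \<longlonglongrightarrow> max (- \<kappa>) (min \<kappa> (f x))" unfolding G_def by (intro tendsto_intros lim that)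
    moreover have "max (- \<kappa>) (min \<kappa> (f x)) = f x" using f(2)[of x] by auto
    ultimately show ?thesis by simp
  qed
  have "AE x in lebesgue. x \<notin> N" using N by (simp add: negligible_iff_null_sets AE_not_in)
  then have AE: "AE x in lborel. (\<lambda>n. G n x) \<longlonglongrightarrow> f x"
    by (subst AE_completion_iff[symmetric]) (use G_lim in \<open>auto elim: eventually_mono\<close>)
  have "(\<lambda>n. LINT r|lborel. indicator {a<..b} r *\<^sub>R \<bar>f r - G n r\<bar>) \<longlonglongrightarrow> integral\<^sup>L (lborel :: real measure) (\<lambda>_. 0::real)"
  proof (rule integral_dominated_convergence[where w = "\<lambda>r. indicator {a<..b} r * (2 * \<kappa>)"])
    show "integrable lborel (\<lambda>r. indicator {a<..b} r * (2 * \<kappa>))"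
      by (intro integrable_mult_left integrable_indicator_Ioc)
    show "AE x in lborel. (\<lambda>n. indicator {a<..b} x *\<^sub>R \<bar>f x - G n x\<bar>) \<longlonglongrightarrow> 0"
      using AE
    proof eventually_elim
      case (elim x)
      have "(\<lambda>n. indicator {a<..b} x *\<^sub>R \<bar>f x - G n x\<bar>) \<longlonglongrightarrow> indicator {a<..b} x *\<^sub>R \<bar>f x - f x\<bar>"
        by (intro tendsto_intros elim)
      then show ?case by simp
    qed
    show "AE x in lborel. norm (indicator {a<..b} x *\<^sub>R \<bar>f x - G n x\<bar>) \<le> indicator {a<..b} x * (2 * \<kappa>)" for n
    proof (rule AE_I2)
      fix x
      have "\<bar>f x - G n x\<bar> \<le> 2 * \<kappa>" using f(2)[of x] G_le[of n x] by linarith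
      then show "norm (indicator {a<..b} x *\<^sub>R \<bar>f x - G n x\<bar>) \<le> indicator {a<..b} x * (2 * \<kappa>)"
        by (simp add: indicator_def)
    qed
  qed auto
  then have "\<forall>\<^sub>F n in sequentially. (LINT r|lborel. indicator {a<..b} r *\<^sub>R \<bar>f r - G n r\<bar>) < e"
    using e by (intro order_tendstoD(2)) auto
  then obtain n where "(LINT r|lborel. indicator {a<..b} r *\<^sub>R \<bar>f r - G n r\<bar>) < e"
    by (auto simp: eventually_sequentially)
  then show ?thesis
    using that[of "G n"] G_cont G_le by (simp add: set_lebesgue_integral_def)
qed

text \<open>
  With a continuous \<open>g\<close> that is close to \<open>f\<close> in \<open>L\<^sup>1\<close>, the error is at most that for \<open>g\<close> plus twice the
  distance of \<open>f\<close> and \<open>g\<close>, by \<open>cell_step_contraction\<close>.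
\<close>

lemma cell_step_L1_tendsto:
  assumes ab: "a < b" and f: "f \<in> borel_measurable borel" "\<And>r. \<bar>f r\<bar> \<le> \<kappa>"
  shows "(\<lambda>m. LINT r:{a<..b}|lborel. \<bar>cell_step a b (Suc m) f r - f r\<bar>) \<longlonglongrightarrow> 0"
proof (rule LIMSEQ_I)
  fix e :: real assume e: "0 < e"
  have f'[measurable]: "f \<in> borel_measurable borel" by fact
  obtain g where g: "continuous_on UNIV g" "\<And>r. \<bar>g r\<bar> \<le> \<kappa>" and fg: "(LINT r:{a<..b}|lborel. \<bar>f r - g r\<bar>) < e / 3"
    using continuous_L1_approximation[OF f, of "e / 3" a b] e by auto
  have gm[measurable]: "g \<in> borel_measurable borel" using g(1) by (rule borel_measurable_continuous_onI)
  note [measurable] = cell_step_measurable[OF ab zero_less_Suc]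
  have "(\<lambda>m. LINT r|lborel. indicator {a<..b} r *\<^sub>R \<bar>cell_step a b (Suc m) g r - g r\<bar>) \<longlonglongrightarrow> integral\<^sup>L (lborel :: real measure) (\<lambda>_. 0::real)"
  proof (rule integral_dominated_convergence[where w = "\<lambda>r. indicator {a<..b} r * (2 * \<kappa>)"])
    show "integrable lborel (\<lambda>r. indicator {a<..b} r * (2 * \<kappa>))"
      by (intro integrable_mult_left integrable_indicator_Ioc)
    show "AE x in lborel. (\<lambda>m. indicator {a<..b} x *\<^sub>R \<bar>cell_step a b (Suc m) g x - g x\<bar>) \<longlonglongrightarrow> 0"
    proof (rule AE_I2)
      fix x
      show "(\<lambda>m. indicator {a<..b} x *\<^sub>R \<bar>cell_step a b (Suc m) g x - g x\<bar>) \<longlonglongrightarrow> 0"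
      proof (cases "a < x \<and> x \<le> b")
        case True
        then have "(\<lambda>m. cell_step a b (Suc m) g x) \<longlonglongrightarrow> g x" using cell_step_continuous[OF ab g] by simp
        then have "(\<lambda>m. \<bar>cell_step a b (Suc m) g x - g x\<bar>) \<longlonglongrightarrow> \<bar>g x - g x\<bar>" by (intro tendsto_intros)
        then show ?thesis using True by simp
      qed (auto simp: indicator_def)
    qed
    show "AE x in lborel. norm (indicator {a<..b} x *\<^sub>R \<bar>cell_step a b (Suc m) g x - g x\<bar>) \<le> indicator {a<..b} x * (2 * \<kappa>)" for m
    proof (rule AE_I2)
      fix x
      have "\<bar>cell_step a b (Suc m) g x - g x\<bar> \<le> 2 * \<kappa>"
        using g(2)[of x] cell_step_bounded[OF ab zero_less_Suc gm g(2), of m x] by linarith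
      then show "norm (indicator {a<..b} x *\<^sub>R \<bar>cell_step a b (Suc m) g x - g x\<bar>) \<le> indicator {a<..b} x * (2 * \<kappa>)"
        by (simp add: indicator_def)
    qed
  qed auto
  then have "\<forall>\<^sub>F m in sequentially. (LINT r:{a<..b}|lborel. \<bar>cell_step a b (Suc m) g r - g r\<bar>) < e / 3"
    using e unfolding set_lebesgue_integral_def by (intro order_tendstoD(2)) auto
  then obtain m0 where m0: "\<And>m. m0 \<le> m \<Longrightarrow> (LINT r:{a<..b}|lborel. \<bar>cell_step a b (Suc m) g r - g r\<bar>) < e / 3"
    by (auto simp: eventually_sequentially)
  show "\<exists>no. \<forall>m\<ge>no. norm ((LINT r:{a<..b}|lborel. \<bar>cell_step a b (Suc m) f r - f r\<bar>) - 0) < e"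
  proof (intro exI allI impI)
    fix m assume m: "m0 \<le> m"
    let ?S = "cell_step a b (Suc m)"
    have si: "set_integrable lborel {a<..b} (\<lambda>r. \<bar>u r - v r\<bar>)"
      if "u \<in> borel_measurable borel" "v \<in> borel_measurable borel" "\<And>r. \<bar>u r\<bar> \<le> \<kappa>" "\<And>r. \<bar>v r\<bar> \<le> \<kappa>" for u v
    proof (rule set_integrable_bounded_Ioc[of _ "2 * \<kappa>"])
      show "\<bar>\<bar>u r - v r\<bar>\<bar> \<le> 2 * \<kappa>" for r using that(3)[of r] that(4)[of r] by simp
    qed (use that in measurable)
    note bS = cell_step_bounded[OF ab zero_less_Suc f(1,2)] cell_step_bounded[OF ab zero_less_Suc gm g(2)]
    note i1 = si[of "?S f" "?S g", OF _ _ bS] and i2 = si[of "?S g" g, OF _ _ bS(2) g(2)] and i3 = si[of f g, OF _ _ f(2) g(2)]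
    have "(LINT r:{a<..b}|lborel. \<bar>?S f r - f r\<bar>)
       \<le> (LINT r:{a<..b}|lborel. \<bar>?S f r - ?S g r\<bar> + \<bar>?S g r - g r\<bar> + \<bar>f r - g r\<bar>)"
      using i1 i2 i3 by (intro set_integral_mono set_integral_add(1) si bS f g(2)) auto
    also have "\<dots> = (LINT r:{a<..b}|lborel. \<bar>?S f r - ?S g r\<bar>) + (LINT r:{a<..b}|lborel. \<bar>?S g r - g r\<bar>) + (LINT r:{a<..b}|lborel. \<bar>f r - g r\<bar>)"
      using i1 i2 i3 by (simp add: set_integral_add)
    also have "(LINT r:{a<..b}|lborel. \<bar>?S f r - ?S g r\<bar>) \<le> (LINT r:{a<..b}|lborel. \<bar>f r - g r\<bar>)"
    proof -
      have "\<bar>f r - g r\<bar> \<le> 2 * \<kappa>" for r using f(2)[of r] g(2)[of r] by linarith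
      then show ?thesis
        using cell_step_contraction[OF ab zero_less_Suc, of "\<lambda>r. f r - g r" "2 * \<kappa>" m]
        by (simp add: cell_step_diff[OF ab zero_less_Suc f(1,2) gm g(2)])
    qed
    finally have "(LINT r:{a<..b}|lborel. \<bar>?S f r - f r\<bar>) < e" using fg m0[OF m] by simp
    moreover have "0 \<le> (LINT r:{a<..b}|lborel. \<bar>?S f r - f r\<bar>)"
      by (simp add: set_lebesgue_integral_def integral_nonneg_AE)
    ultimately show "norm ((LINT r:{a<..b}|lborel. \<bar>?S f r - f r\<bar>) - 0) < e" by simp
  qed
qed

context brownian_space
begin

lemma prog_measurable_joint:
  assumes "prog_measurable_on F a b X" "a \<le> b"
  shows "(\<lambda>(r, \<omega>). X r \<omega>) \<in> borel_measurable (LebM a b)"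
proof -
  have "(\<lambda>(r, \<omega>). X r \<omega>) \<in> borel_measurable (restrict_space borel {a..b} \<Otimes>\<^sub>M F b)"
    using assms by (auto simp: prog_measurable_on_def)
  then have *: "(\<lambda>(r, \<omega>). X r \<omega>) \<in> borel_measurable (Leb a b \<Otimes>\<^sub>M F b)"
    by (simp cong: measurable_cong_sets sets_pair_measure_cong add: sets_Leb)
  have "(\<lambda>z. (fst z, snd z)) \<in> measurable (LebM a b) (Leb a b \<Otimes>\<^sub>M F b)"
    by (intro measurable_Pair measurable_fst measurable_compose[OF measurable_snd] measurable_F_M[of _ b]) auto
  from measurable_compose[OF this *] show ?thesis by (simp add: case_prod_unfold)
qed

text \<open>
  The step functions of the cell averages converge to \<open>\<beta>\<close> in \<open>L\<^sup>1\<close> of the time interval for each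
  \<open>\<omega>\<close>, hence in \<open>L\<^sup>1\<close> of the product space, and almost everywhere along a subsequence. The average over the
  cell before a grid point is measurable with respect to the past of that point because \<open>\<beta>\<close> is progressive.
\<close>

lemma bounded_progressive_approx:
  fixes \<beta> :: "real \<Rightarrow> 'w \<Rightarrow> real"
  assumes a: "0 \<le> a" and ab: "a < b" and prog: "prog_measurable_on F a b \<beta>"
    and bounded: "\<And>r \<omega>. r \<in> {a..b} \<Longrightarrow> \<omega> \<in> space M \<Longrightarrow> \<bar>\<beta> r \<omega>\<bar> \<le> \<kappa>"
  obtains k :: "nat \<Rightarrow> nat" and \<tau> \<xi> where
    "\<And>m. simple_integrand M F a b (k m) (\<tau> m) (\<xi> m)"
    "\<And>m i \<omega>. \<omega> \<in> space M \<Longrightarrow> \<bar>\<xi> m i \<omega>\<bar> \<le> \<kappa>"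
    "AE (r, \<omega>) in LebM a b. (\<lambda>m. simple_value (k m) (\<tau> m) (\<xi> m) r \<omega>) \<longlonglongrightarrow> \<beta> r \<omega>"
proof -
  define f where "f \<omega> r = indicator {a..b} r * \<beta> r \<omega>" for \<omega> r
  have \<beta>_prog: "(\<lambda>(r, \<omega>). \<beta> r \<omega>) \<in> borel_measurable (restrict_space borel {a..u} \<Otimes>\<^sub>M F u)" if "u \<in> {a..b}" for u
    using prog that by (auto simp: prog_measurable_on_def)
  have \<beta>_F: "(\<lambda>(r, \<omega>). \<beta> r \<omega>) \<in> borel_measurable (Leb a u \<Otimes>\<^sub>M F u)" if "u \<in> {a..b}" for u
    using \<beta>_prog[OF that] by (simp cong: measurable_cong_sets sets_pair_measure_cong add: sets_Leb)
  have \<beta>_M: "(\<lambda>(r, \<omega>). \<beta> r \<omega>) \<in> borel_measurable (LebM a b)"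
    using ab by (intro prog_measurable_joint[OF prog]) simp
  have f_meas: "f \<omega> \<in> borel_measurable borel" if \<omega>: "\<omega> \<in> space M" for \<omega>
  proof -
    have "(\<lambda>r. \<beta> r \<omega>) \<in> borel_measurable (restrict_space borel {a..b})"
      using measurable_Pair1[OF \<beta>_prog[of b], of \<omega>] \<omega> ab by simp
    then show ?thesis unfolding f_def[abs_def]
      by (subst (asm) borel_measurable_restrict_space_iff) (auto simp: mult.commute)
  qed
  have f_le: "\<bar>f \<omega> r\<bar> \<le> \<kappa>" if "\<omega> \<in> space M" for \<omega> r
  proof -
    have "0 \<le> \<kappa>" using bounded[of a \<omega>] that ab by fastforce
    then show ?thesis using bounded[OF _ that] by (auto simp: f_def indicator_def)
  qed
  define \<xi> where "\<xi> n i \<omega> = cell_average a b (Suc n) (f \<omega>) i" for n i \<omega>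
  have cell: "simple_value (Suc n) (grid a b (Suc n)) (\<xi> n) r \<omega> = cell_step a b (Suc n) (f \<omega>) r" for n r \<omega>
    by (simp add: simple_value_def cell_step_def \<xi>_def)
  have \<xi>_le: "\<bar>\<xi> n i \<omega>\<bar> \<le> \<kappa>" if "\<omega> \<in> space M" for n i \<omega>
    unfolding \<xi>_def using cell_average_bounded[OF ab zero_less_Suc f_meas[OF that] f_le[OF that]] .
  have \<xi>_meas: "\<xi> n i \<in> borel_measurable (F (grid a b (Suc n) i))" if i: "i < Suc n" for n i
  proof -
    let ?u = "grid a b (Suc n) i" and ?p = "grid a b (Suc n) (i - 1)"
    interpret L: finite_measure "Leb a ?u" by (rule finite_measure_Leb)
    have u: "?u \<in> {a..b}" "a \<le> ?p"
      using grid_ge[OF ab zero_less_Suc] grid_le[OF ab zero_less_Suc, of i n] i by auto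
    have ind: "indicat_real {?p<..?u} \<in> borel_measurable (Leb a ?u)"
      by (rule borel_measurable_Leb) simp
    have "(\<lambda>z. indicat_real {?p<..?u} (fst z) * \<beta> (fst z) (snd z)) \<in> borel_measurable (Leb a ?u \<Otimes>\<^sub>M F ?u)"
      using \<beta>_F[OF u(1)] by (intro borel_measurable_times measurable_compose[OF measurable_fst ind]) (simp add: case_prod_unfold)
    from measurable_pair_swap[OF this]
    have "(\<lambda>(\<omega>, r). indicat_real {?p<..?u} r * \<beta> r \<omega>) \<in> borel_measurable (F ?u \<Otimes>\<^sub>M Leb a ?u)" by simp
    then have "(\<lambda>\<omega>. (\<integral>r. indicat_real {?p<..?u} r * \<beta> r \<omega> \<partial>Leb a ?u)) \<in> borel_measurable (F ?u)"
      by (rule L.borel_measurable_lebesgue_integral)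
    also have "(\<lambda>\<omega>. (\<integral>r. indicat_real {?p<..?u} r * \<beta> r \<omega> \<partial>Leb a ?u)) = (\<lambda>\<omega>. LINT r:{?p<..?u}|lborel. f \<omega> r)"
      unfolding set_lebesgue_integral_def using u
      by (subst integral_restrict_space) (auto simp: f_def indicator_def set_lebesgue_integral_def intro!: ext Bochner_Integration.integral_cong)
    finally show ?thesis unfolding \<xi>_def[abs_def] cell_average_def by measurable
  qed
  have simple: "simple_integrand M F a b (Suc n) (grid a b (Suc n)) (\<xi> n)" for n
    unfolding simple_integrand_def
  proof (intro conjI allI impI)
    show "\<exists>c. \<forall>\<omega>\<in>space M. norm (\<xi> n i \<omega>) \<le> c" for i
      using \<xi>_le by (intro exI[of _ \<kappa>]) simp
  qed (use \<xi>_meas grid_simps(1,2)[OF ab zero_less_Suc] grid_mono[OF ab zero_less_Suc] in auto)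
  let ?u = "\<lambda>n z. cell_step a b (Suc n) (f (snd z)) (fst z) - \<beta> (fst z) (snd z)"
  interpret P: pair_sigma_finite "Leb a b" M by (rule pair_Leb)
  interpret PF: finite_measure "LebM a b" by (rule finite_measure_pair_Leb)
  have step_meas: "(\<lambda>z. cell_step a b (Suc n) (f (snd z)) (fst z)) \<in> borel_measurable (LebM a b)" for n
    using simple_value_measurable[OF simple[of n], of a b] by (simp add: cell case_prod_unfold)
  have u_meas: "?u n \<in> borel_measurable (LebM a b)" for n
    using step_meas[of n] \<beta>_M by (simp add: case_prod_unfold)
  have u_le: "\<bar>?u n z\<bar> \<le> 2 * \<kappa>" if "z \<in> space (LebM a b)" for n z
  proof -
    have z: "fst z \<in> {a..b}" "snd z \<in> space M" using that by (auto simp: space_pair_measure space_restrict_space)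
    then show ?thesis
      using cell_step_bounded[OF ab zero_less_Suc f_meas[OF z(2)] f_le[OF z(2)], of n "fst z"] bounded[OF z] by linarith
  qed
  have u_int: "integrable (LebM a b) (?u n)" for n
    using u_le u_meas by (intro PF.integrable_const_bound[of _ "2 * \<kappa>"]) auto
  have u_norm_int: "integrable (LebM a b) (\<lambda>(r, \<omega>). norm (?u n (r, \<omega>)))" for n
    using integrable_norm[OF u_int[of n]] by (simp add: case_prod_unfold)
  have inner: "(\<integral>r. norm (?u n (r, \<omega>)) \<partial>Leb a b) = (LINT r:{a<..b}|lborel. \<bar>cell_step a b (Suc n) (f \<omega>) r - f \<omega> r\<bar>)" for n \<omega>
  proof -
    have "(\<integral>r. norm (?u n (r, \<omega>)) \<partial>Leb a b) = (LINT r|lborel. indicator {a..b} r *\<^sub>R \<bar>cell_step a b (Suc n) (f \<omega>) r - f \<omega> r\<bar>)"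
      by (subst integral_restrict_space)
        (auto simp: f_def indicator_def set_lebesgue_integral_def intro!: Bochner_Integration.integral_cong)
    also have "\<dots> = (LINT r:{a<..b}|lborel. \<bar>cell_step a b (Suc n) (f \<omega>) r - f \<omega> r\<bar>)"
      unfolding set_lebesgue_integral_def
      by (rule integral_discrete_difference[of "{a}"]) (auto simp: indicator_def)
    finally show ?thesis .
  qed
  have "(\<lambda>n. \<integral>\<omega>. (\<integral>r. norm (?u n (r, \<omega>)) \<partial>Leb a b) \<partial>M) \<longlonglongrightarrow> integral\<^sup>L M (\<lambda>_. 0::real)"
  proof (rule integral_dominated_convergence[where w = "\<lambda>_. 2 * \<kappa> * (b - a)"])
    show "(\<lambda>\<omega>. \<integral>r. norm (?u n (r, \<omega>)) \<partial>Leb a b) \<in> borel_measurable M" for n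
      using P.integrable_snd[OF u_norm_int[of n]] by simp
    show "AE \<omega> in M. (\<lambda>n. \<integral>r. norm (?u n (r, \<omega>)) \<partial>Leb a b) \<longlonglongrightarrow> 0"
    proof (rule AE_I2)
      fix \<omega> assume \<omega>: "\<omega> \<in> space M"
      show "(\<lambda>n. \<integral>r. norm (?u n (r, \<omega>)) \<partial>Leb a b) \<longlonglongrightarrow> 0"
        unfolding inner using cell_step_L1_tendsto[OF ab f_meas[OF \<omega>] f_le[OF \<omega>]] .
    qed
    show "AE \<omega> in M. norm (\<integral>r. norm (?u n (r, \<omega>)) \<partial>Leb a b) \<le> 2 * \<kappa> * (b - a)" for n
    proof (rule AE_I2)
      fix \<omega> assume \<omega>: "\<omega> \<in> space M"
      let ?v = "\<lambda>r. \<bar>cell_step a b (Suc n) (f \<omega>) r - f \<omega> r\<bar>"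
      have v: "\<bar>?v r\<bar> \<le> 2 * \<kappa>" for r
        using cell_step_bounded[OF ab zero_less_Suc f_meas[OF \<omega>] f_le[OF \<omega>], of n r] f_le[OF \<omega>, of r] by linarith
      have "?v \<in> borel_measurable borel"
        using f_meas[OF \<omega>] cell_step_measurable[OF ab zero_less_Suc, of n "f \<omega>"] by measurable
      then have "\<bar>LINT r:{a<..b}|lborel. ?v r\<bar> \<le> 2 * \<kappa> * (b - a)"
        using v ab by (intro set_integral_norm_bound_Ioc) auto
      then show "norm (\<integral>r. norm (?u n (r, \<omega>)) \<partial>Leb a b) \<le> 2 * \<kappa> * (b - a)" unfolding inner by simp
    qed
  qed auto
  then have "(\<lambda>n. \<integral>z. norm (?u n z) \<partial>(LebM a b)) \<longlonglongrightarrow> 0"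
    using P.integral_snd[OF u_norm_int] by (simp add: case_prod_unfold)
  then obtain \<rho> where \<rho>: "AE z in LebM a b. (\<lambda>n. ?u (\<rho> n) z) \<longlonglongrightarrow> 0"
    using tendsto_L1_AE_subseq[of "LebM a b" ?u] u_int by blast
  show ?thesis
  proof (rule that[of "\<lambda>m. Suc (\<rho> m)" "\<lambda>m. grid a b (Suc (\<rho> m))" "\<lambda>m. \<xi> (\<rho> m)"])
    show "AE (r, \<omega>) in LebM a b. (\<lambda>m. simple_value (Suc (\<rho> m)) (grid a b (Suc (\<rho> m))) (\<xi> (\<rho> m)) r \<omega>) \<longlonglongrightarrow> \<beta> r \<omega>"
      using \<rho> by eventually_elim (auto simp: cell LIM_zero_iff)
  qed (use simple \<xi>_le in auto)
qed

end

section \<open>Deterministic Volterra equations and Gronwall's lemma\<close>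

lemma integral_exponential_kernel:
  fixes t T r \<mu> :: real
  assumes "t \<le> r" "r \<le> T"
  shows "(\<integral>s. indicator {..r} s * (\<mu> * exp (- \<mu> * (s - t))) \<partial>Leb t T) = 1 - exp (- \<mu> * (r - t))"
proof -
  have "(\<integral>s. indicator {..r} s * (\<mu> * exp (- \<mu> * (s - t))) \<partial>Leb t T)
    = (\<integral>s. indicator {t..r} s *\<^sub>R (\<mu> * exp (- \<mu> * (s - t))) \<partial>lborel)"
    using assms by (subst integral_restrict_space)
      (auto simp: indicator_def set_lebesgue_integral_def intro!: Bochner_Integration.integral_cong)
  also have "\<dots> = - exp (- \<mu> * (r - t)) - (- exp (- \<mu> * (t - t)))"
  proof (rule integral_FTC_Icc)
    show "((\<lambda>s. - exp (- \<mu> * (s - t))) has_vector_derivative \<mu> * exp (- \<mu> * (s - t))) (at s within {t..r})" for s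
      unfolding has_real_derivative_iff_has_vector_derivative[symmetric]
      by (auto intro!: derivative_eq_intros)
  qed (use assms in \<open>auto intro!: continuous_intros\<close>)
  finally show ?thesis by simp
qed

text \<open>
  Integrating the equation against the resolvent kernel \<open>\<mu> exp (- \<mu> (s - t))\<close> and exchanging the order of
  integration, the double integral contributes \<open>\<mu> \<integral> y(r) (1 - exp (- \<mu> (r - t))) dr\<close>, and the exponential
  terms cancel.
\<close>

lemma resolvent_integral:
  fixes y G :: "real \<Rightarrow> real"
  assumes y: "integrable (Leb t T) y"
    and eq: "AE s in Leb t T. y s + \<mu> * (\<integral>r. indicator {s..} r * y r \<partial>Leb t T) = G s"
    and G: "integrable (Leb t T) G"
  shows "(\<integral>s. \<mu> * exp (- \<mu> * (s - t)) * G s \<partial>Leb t T) = \<mu> * (\<integral>s. y s \<partial>Leb t T)"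
proof -
  interpret L: finite_measure "Leb t T" by (rule finite_measure_Leb)
  interpret LL: pair_sigma_finite "Leb t T" "Leb t T" ..
  let ?k = "\<lambda>s. \<mu> * exp (- \<mu> * (s - t))"
  let ?K = "\<bar>\<mu>\<bar> * exp (\<bar>\<mu>\<bar> * (T - t))"
  have k_meas[measurable]: "?k \<in> borel_measurable (Leb t T)" by (rule borel_measurable_Leb) measurable
  have y_meas[measurable]: "y \<in> borel_measurable (Leb t T)" using y by simp
  have id[measurable]: "(\<lambda>x. x) \<in> borel_measurable (Leb t T)" by (rule borel_measurable_Leb) simp
  have k_le: "\<bar>?k s\<bar> \<le> ?K" if "s \<in> space (Leb t T)" for s
  proof -
    have "s \<in> {t..T}" using that by (simp add: space_restrict_space)
    moreover have "- \<mu> * (s - t) \<le> \<bar>\<mu>\<bar> * (s - t)"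
      using \<open>s \<in> {t..T}\<close> by (intro mult_right_mono) auto
    moreover have "\<bar>\<mu>\<bar> * (s - t) \<le> \<bar>\<mu>\<bar> * (T - t)"
      using \<open>s \<in> {t..T}\<close> by (intro mult_left_mono) auto
    ultimately have "- \<mu> * (s - t) \<le> \<bar>\<mu>\<bar> * (T - t)" by linarith
    then show ?thesis by (simp add: abs_mult mult_left_mono)
  qed
  have ky: "integrable (Leb t T) (\<lambda>s. ?k s * y s)"
  proof (rule Bochner_Integration.integrable_bound)
    show "integrable (Leb t T) (\<lambda>s. ?K * y s)" using y by simp
    show "AE s in Leb t T. norm (?k s * y s) \<le> norm (?K * y s)"
      by (rule AE_I2) (simp only: real_norm_def abs_mult[of _ "y _"], intro mult_right_mono order_trans[OF k_le abs_ge_self], auto)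
  qed measurable
  have pair_meas: "(\<lambda>(s, r). ?k s * (indicator {s..} r * y r)) \<in> borel_measurable (Leb t T \<Otimes>\<^sub>M Leb t T)"
  proof -
    have *: "(\<lambda>(s, r). if s \<le> r then ?k s * y r else 0) \<in> borel_measurable (Leb t T \<Otimes>\<^sub>M Leb t T)"
      by measurable
    show ?thesis by (rule measurable_cong[THEN iffD1, OF _ *]) (auto simp: indicator_def)
  qed
  have dom: "integrable (Leb t T \<Otimes>\<^sub>M Leb t T) (\<lambda>(s, r). ?K * \<bar>y r\<bar>)"
    using y by (intro LL.Fubini_integrable) auto
  have pair: "integrable (Leb t T \<Otimes>\<^sub>M Leb t T) (\<lambda>(s, r). ?k s * (indicator {s..} r * y r))"
  proof (rule Bochner_Integration.integrable_bound[OF dom pair_meas])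
    show "AE z in Leb t T \<Otimes>\<^sub>M Leb t T. norm (case z of (s, r) \<Rightarrow> ?k s * (indicator {s..} r * y r)) \<le> norm (case z of (s, r) \<Rightarrow> ?K * \<bar>y r\<bar>)"
    proof (rule AE_I2)
      fix z assume "z \<in> space (Leb t T \<Otimes>\<^sub>M Leb t T)"
      then obtain s r where z: "z = (s, r)" "s \<in> space (Leb t T)" by (auto simp: space_pair_measure)
      have "\<bar>?k s\<bar> * \<bar>indicator {s..} r * y r\<bar> \<le> ?K * \<bar>y r\<bar>"
        using k_le[OF z(2)] by (intro mult_mono) (auto simp: indicator_def)
      then show "norm (case z of (s, r) \<Rightarrow> ?k s * (indicator {s..} r * y r)) \<le> norm (case z of (s, r) \<Rightarrow> ?K * \<bar>y r\<bar>)"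
        by (simp add: z abs_mult)
    qed
  qed
  have inner: "(\<integral>s. ?k s * (indicator {s..} r * y r) \<partial>Leb t T) = y r * (1 - exp (- \<mu> * (r - t)))" if "r \<in> space (Leb t T)" for r
  proof -
    have r: "t \<le> r" "r \<le> T" using that by (auto simp: space_restrict_space)
    have "(\<integral>s. ?k s * (indicator {s..} r * y r) \<partial>Leb t T) = (\<integral>s. y r * (indicator {..r} s * ?k s) \<partial>Leb t T)"
      by (intro Bochner_Integration.integral_cong refl) (auto simp: indicator_def)
    also have "\<dots> = y r * (\<integral>s. indicator {..r} s * ?k s \<partial>Leb t T)" by (rule integral_mult_right_zero)
    finally show ?thesis by (simp only: integral_exponential_kernel[OF r])
  qed
  have int1: "integrable (Leb t T) (\<lambda>s. ?k s * (\<integral>r. indicator {s..} r * y r \<partial>Leb t T))"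
    using LL.integrable_fst[OF pair] by simp
  have "(\<integral>s. ?k s * (\<integral>r. indicator {s..} r * y r \<partial>Leb t T) \<partial>Leb t T) = (\<integral>r. (\<integral>s. ?k s * (indicator {s..} r * y r) \<partial>Leb t T) \<partial>Leb t T)"
    using LL.Fubini_integral[OF pair] by simp
  also have "\<dots> = (\<integral>r. y r * (1 - exp (- \<mu> * (r - t))) \<partial>Leb t T)"
    by (intro Bochner_Integration.integral_cong refl inner)
  finally have double: "(\<integral>s. ?k s * (\<integral>r. indicator {s..} r * y r \<partial>Leb t T) \<partial>Leb t T) = (\<integral>r. y r * (1 - exp (- \<mu> * (r - t))) \<partial>Leb t T)" .
  have "(\<integral>s. ?k s * G s \<partial>Leb t T) = (\<integral>s. ?k s * y s + \<mu> * (?k s * (\<integral>r. indicator {s..} r * y r \<partial>Leb t T)) \<partial>Leb t T)"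
  proof (rule integral_cong_AE)
    show "AE s in Leb t T. ?k s * G s = ?k s * y s + \<mu> * (?k s * (\<integral>r. indicator {s..} r * y r \<partial>Leb t T))"
      using eq by eventually_elim (simp only: distrib_left[symmetric] mult.left_commute[of \<mu>])
  next
    show "(\<lambda>s. ?k s * G s) \<in> borel_measurable (Leb t T)" using G by (intro borel_measurable_times k_meas) auto
    show "(\<lambda>s. ?k s * y s + \<mu> * (?k s * (\<integral>r. indicator {s..} r * y r \<partial>Leb t T))) \<in> borel_measurable (Leb t T)"
      using ky int1 by (intro borel_measurable_add borel_measurable_times[OF borel_measurable_const]) auto
  qed
  also have "\<dots> = (\<integral>s. ?k s * y s \<partial>Leb t T) + \<mu> * (\<integral>r. y r * (1 - exp (- \<mu> * (r - t))) \<partial>Leb t T)"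
    using ky int1 double by (subst Bochner_Integration.integral_add) (auto simp only: integrable_mult_right integral_mult_right_zero)
  also have "\<mu> * (\<integral>r. y r * (1 - exp (- \<mu> * (r - t))) \<partial>Leb t T) = (\<integral>r. \<mu> * y r - ?k r * y r \<partial>Leb t T)"
    unfolding integral_mult_right_zero[symmetric] by (intro Bochner_Integration.integral_cong refl) (simp add: algebra_simps)
  also have "\<dots> = \<mu> * (\<integral>s. y s \<partial>Leb t T) - (\<integral>s. ?k s * y s \<partial>Leb t T)"
    using ky y by (subst Bochner_Integration.integral_diff) auto
  finally show ?thesis by simp
qed

text \<open>
  Monotonicity yields measurability, without any joint measurability of the data that define \<open>p\<close>.
\<close>

lemma antimono_bounded_integrable:
  fixes p :: "real \<Rightarrow> real"
  assumes anti: "\<And>s s'. t \<le> s \<Longrightarrow> s \<le> s' \<Longrightarrow> s' \<le> T \<Longrightarrow> p s' \<le> p s" and nonneg: "\<And>s. s \<in> {t..T} \<Longrightarrow> 0 \<le> p s"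
  shows "integrable (Leb t T) p"
proof -
  interpret L: finite_measure "Leb t T" by (rule finite_measure_Leb)
  have "mono_on {t..T} (\<lambda>s. - p s)" using anti by (auto intro!: mono_onI)
  then have "(\<lambda>s. - p s) \<in> borel_measurable (restrict_space borel {t..T})" by (rule borel_measurable_mono_on_fnc)
  then have "(\<lambda>s. - (- p s)) \<in> borel_measurable (restrict_space borel {t..T})" by (rule borel_measurable_uminus)
  then have "p \<in> borel_measurable (Leb t T)" by (simp cong: measurable_cong_sets add: sets_Leb)
  then show ?thesis
  proof (rule L.integrable_const_bound[of _ "p t", rotated], intro AE_I2)
    fix s assume "s \<in> space (Leb t T)"
    then have "t \<le> s" "s \<le> T" by (auto simp: space_restrict_space)
    then show "norm (p s) \<le> p t" using anti[of t s] nonneg[of s] by simp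
  qed
qed

text \<open>
  By \<open>resolvent_integral\<close>, \<open>y t\<close> is the right-hand side at \<open>t\<close> minus its integral against the resolvent
  kernel, whose total mass is \<open>1 - exp (- \<mu> (T - t))\<close>. Since \<open>p\<close> is largest at \<open>t\<close>, it contributes at least
  \<open>exp (- \<mu> (T - t)) p(t) \<ge> 0\<close>, and the integral of \<open>n\<close> has the favourable sign.
\<close>

lemma resolvent_lower_bound:
  fixes y p n e :: "real \<Rightarrow> real"
  assumes tT: "t \<le> T" and \<mu>: "0 \<le> \<mu>"
    and y: "integrable (Leb t T) y" and e: "integrable (Leb t T) e"
    and p_anti: "\<And>s s'. t \<le> s \<Longrightarrow> s \<le> s' \<Longrightarrow> s' \<le> T \<Longrightarrow> p s' \<le> p s" and p_nonneg: "\<And>s. s \<in> {t..T} \<Longrightarrow> 0 \<le> p s"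
    and n_anti: "\<And>s s'. t \<le> s \<Longrightarrow> s \<le> s' \<Longrightarrow> s' \<le> T \<Longrightarrow> n s' \<le> n s" and n_nonneg: "\<And>s. s \<in> {t..T} \<Longrightarrow> 0 \<le> n s"
    and eq: "AE s in Leb t T. y s + \<mu> * (\<integral>r. indicator {s..} r * y r \<partial>Leb t T) = p s - n s + e s"
    and eq_t: "y t + \<mu> * (\<integral>r. y r \<partial>Leb t T) = p t - n t + e t"
  shows "- n t - \<bar>e t\<bar> - \<mu> * (\<integral>s. \<bar>e s\<bar> \<partial>Leb t T) \<le> y t"
proof -
  interpret L: finite_measure "Leb t T" by (rule finite_measure_Leb)
  let ?k = "\<lambda>s. \<mu> * exp (- \<mu> * (s - t))"
  have k_meas[measurable]: "?k \<in> borel_measurable (Leb t T)" by (rule borel_measurable_Leb) measurable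
  note p = antimono_bounded_integrable[of t T p, OF p_anti p_nonneg]
  note n = antimono_bounded_integrable[of t T n, OF n_anti n_nonneg]
  have k_range: "0 \<le> ?k s" "?k s \<le> \<mu>" if "s \<in> space (Leb t T)" for s
  proof -
    have "s \<in> {t..T}" using that by (simp add: space_restrict_space)
    then show "0 \<le> ?k s" "?k s \<le> \<mu>" using \<mu> by (auto intro!: mult_left_le)
  qed
  have k_int: "integrable (Leb t T) ?k"
    using k_range by (intro L.integrable_const_bound[of _ \<mu>] k_meas AE_I2) auto
  have kf: "integrable (Leb t T) (\<lambda>s. ?k s * f s)" if f: "integrable (Leb t T) f" for f :: "real \<Rightarrow> real"
  proof (rule Bochner_Integration.integrable_bound)
    show "integrable (Leb t T) (\<lambda>s. \<mu> * f s)" using f by simp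
    show "(\<lambda>s. ?k s * f s) \<in> borel_measurable (Leb t T)" using f by (intro borel_measurable_times k_meas) auto
    show "AE s in Leb t T. norm (?k s * f s) \<le> norm (\<mu> * f s)"
    proof (rule AE_I2)
      fix s assume s: "s \<in> space (Leb t T)"
      have "\<bar>?k s\<bar> \<le> \<bar>\<mu>\<bar>" using k_range[OF s] by linarith
      then show "norm (?k s * f s) \<le> norm (\<mu> * f s)" unfolding real_norm_def abs_mult[of _ "f s"] by (rule mult_right_mono) simp
    qed
  qed
  have "\<mu> * (\<integral>s. y s \<partial>Leb t T) = (\<integral>s. ?k s * (p s - n s + e s) \<partial>Leb t T)"
    using resolvent_integral[OF y eq] p n e by simp
  also have "\<dots> = (\<integral>s. ?k s * p s \<partial>Leb t T) - (\<integral>s. ?k s * n s \<partial>Leb t T) + (\<integral>s. ?k s * e s \<partial>Leb t T)"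
    using kf[OF p] kf[OF n] kf[OF e] by (simp only: distrib_left right_diff_distrib Bochner_Integration.integral_add Bochner_Integration.integral_diff Bochner_Integration.integrable_diff)
  also have "(\<integral>s. ?k s * p s \<partial>Leb t T) \<le> p t"
  proof -
    have "(\<integral>s. ?k s * p s \<partial>Leb t T) \<le> (\<integral>s. ?k s * p t \<partial>Leb t T)"
    proof (rule integral_mono[OF kf[OF p]])
      show "integrable (Leb t T) (\<lambda>s. ?k s * p t)" using k_int by (rule integrable_mult_left)
      fix s assume s: "s \<in> space (Leb t T)"
      then have "p s \<le> p t" using p_anti[of t s] by (simp add: space_restrict_space)
      then show "?k s * p s \<le> ?k s * p t" using k_range(1)[OF s] by (rule mult_left_mono)
    qed
    also have "\<dots> = (1 - exp (- \<mu> * (T - t))) * p t"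
    proof -
      have "(\<integral>s. ?k s \<partial>Leb t T) = (\<integral>s. indicator {..T} s * ?k s \<partial>Leb t T)"
        by (intro Bochner_Integration.integral_cong refl) (auto simp: space_restrict_space indicator_def)
      then show ?thesis using integral_exponential_kernel[OF tT order_refl, of \<mu>] by simp
    qed
    also have "\<dots> \<le> 1 * p t" using p_nonneg[of t] tT by (intro mult_right_mono) auto
    finally show ?thesis by simp
  qed
  also have "(\<integral>s. ?k s * e s \<partial>Leb t T) \<le> \<mu> * (\<integral>s. \<bar>e s\<bar> \<partial>Leb t T)"
  proof -
    have "(\<integral>s. ?k s * e s \<partial>Leb t T) \<le> (\<integral>s. \<mu> * \<bar>e s\<bar> \<partial>Leb t T)"
    proof (rule integral_mono[OF kf[OF e]])
      show "integrable (Leb t T) (\<lambda>s. \<mu> * \<bar>e s\<bar>)" using e by simp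
      fix s assume s: "s \<in> space (Leb t T)"
      have "?k s * e s \<le> ?k s * \<bar>e s\<bar>" using k_range(1)[OF s] by (intro mult_left_mono) auto
      also have "\<dots> \<le> \<mu> * \<bar>e s\<bar>" using k_range(2)[OF s] by (intro mult_right_mono) auto
      finally show "?k s * e s \<le> \<mu> * \<bar>e s\<bar>" .
    qed
    then show ?thesis by simp
  qed
  finally have "\<mu> * (\<integral>s. y s \<partial>Leb t T) \<le> p t - (\<integral>s. ?k s * n s \<partial>Leb t T) + \<mu> * (\<integral>s. \<bar>e s\<bar> \<partial>Leb t T)" by simp
  moreover have "0 \<le> (\<integral>s. ?k s * n s \<partial>Leb t T)"
  proof (rule Bochner_Integration.integral_nonneg)
    fix s assume s: "s \<in> space (Leb t T)"
    then have "0 \<le> n s" using n_nonneg[of s] by (simp add: space_restrict_space)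
    then show "0 \<le> ?k s * n s" using k_range(1)[OF s] by (rule mult_nonneg_nonneg[rotated])
  qed
  ultimately show ?thesis using eq_t by linarith
qed

text \<open>
  In the norm with weight \<open>exp (l t)\<close>, the operator \<open>q \<mapsto> C \<integral>\<^sub>t\<^sup>T q\<close> has norm at most \<open>C / l\<close>. For
  \<open>l = 2 C + 1\<close> the hypothesis gives \<open>I \<le> I / 2\<close> for the finite weighted integral \<open>I\<close> of \<open>q\<close>.
\<close>

lemma backward_Gronwall:
  fixes q :: "real \<Rightarrow> ennreal"
  assumes q[measurable]: "q \<in> borel_measurable (Leb 0 T)" and fin: "(\<integral>\<^sup>+t. q t \<partial>Leb 0 T) < \<infinity>"
    and C: "0 \<le> C" and le: "AE t in Leb 0 T. q t \<le> ennreal C * (\<integral>\<^sup>+s. indicator {t..} s * q s \<partial>Leb 0 T)"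
  shows "AE t in Leb 0 T. q t = 0"
proof -
  interpret L: finite_measure "Leb 0 T" by (rule finite_measure_Leb)
  interpret LL: pair_sigma_finite "Leb 0 T" "Leb 0 T" ..
  define l where "l = 2 * C + 1"
  have l: "0 < l" "2 * C \<le> l" using C by (auto simp: l_def)
  let ?e = "\<lambda>t. ennreal (exp (l * t))"
  have id[measurable]: "(\<lambda>x. x) \<in> borel_measurable (Leb 0 T)" by (rule borel_measurable_Leb) simp
  define I where "I = (\<integral>\<^sup>+t. ?e t * q t \<partial>Leb 0 T)"
  have "I \<le> (\<integral>\<^sup>+t. ennreal (exp (l * T)) * q t \<partial>Leb 0 T)"
    unfolding I_def using l by (intro nn_integral_mono mult_right_mono ennreal_leI) (auto simp: space_restrict_space)
  also have "\<dots> = ennreal (exp (l * T)) * (\<integral>\<^sup>+t. q t \<partial>Leb 0 T)" by (rule nn_integral_cmult) measurable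
  also have "\<dots> < \<infinity>" using fin by (simp add: ennreal_mult_less_top)
  finally have I_fin: "I < \<infinity>" .
  have pair_meas: "(\<lambda>(t, s). ?e t * (ennreal C * (indicator {t..} s * q s))) \<in> borel_measurable (Leb 0 T \<Otimes>\<^sub>M Leb 0 T)"
  proof -
    have *: "(\<lambda>(t, s). if t \<le> s then ?e t * (ennreal C * q s) else 0) \<in> borel_measurable (Leb 0 T \<Otimes>\<^sub>M Leb 0 T)"
      by measurable
    show ?thesis by (rule measurable_cong[THEN iffD1, OF _ *]) (auto simp: indicator_def)
  qed
  have ind_meas: "(\<lambda>s. indicator {t..} s * q s) \<in> borel_measurable (Leb 0 T)" for t
  proof -
    have [measurable]: "(indicator {t..} :: real \<Rightarrow> ennreal) \<in> borel_measurable (Leb 0 T)"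
      by (rule borel_measurable_Leb) simp
    show ?thesis by measurable
  qed
  have inner: "(\<integral>\<^sup>+t. ?e t * (ennreal C * (indicator {t..} s * q s)) \<partial>Leb 0 T) \<le> ennreal (1 / 2) * (?e s * q s)" if "s \<in> space (Leb 0 T)" for s
  proof -
    have s: "0 \<le> s" "s \<le> T" using that by (auto simp: space_restrict_space)
    have "(\<integral>\<^sup>+t. ?e t * (ennreal C * (indicator {t..} s * q s)) \<partial>Leb 0 T)
      = (\<integral>\<^sup>+t. (ennreal C * q s) * (ennreal (exp (l * t)) * indicator {0..s} t) \<partial>Leb 0 T)"
      by (intro nn_integral_cong) (auto simp: indicator_def space_restrict_space ac_simps)
    also have "\<dots> = (ennreal C * q s) * (\<integral>\<^sup>+t. ennreal (exp (l * t)) * indicator {0..s} t \<partial>Leb 0 T)"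
      by (rule nn_integral_cmult) (intro borel_measurable_Leb, measurable)
    also have "(\<integral>\<^sup>+t. ennreal (exp (l * t)) * indicator {0..s} t \<partial>Leb 0 T) = (\<integral>\<^sup>+t. ennreal (exp (l * t)) * indicator {0..s} t \<partial>lborel)"
      using s by (subst nn_integral_restrict_space) (auto simp: indicator_def intro!: nn_integral_cong)
    also have "\<dots> = ennreal (exp (l * s) / l - exp (l * 0) / l)"
      using s l by (intro nn_integral_FTC_Icc) (auto intro!: derivative_eq_intros)
    also have "(ennreal C * q s) * \<dots> \<le> (ennreal C * q s) * ennreal (exp (l * s) / l)"
      using l by (intro mult_left_mono ennreal_leI) auto
    also have "\<dots> = ennreal (C / l) * (?e s * q s)"
    proof -
      have "ennreal C * ennreal (exp (l * s) / l) = ennreal (C / l) * ?e s"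
        using C l by (simp flip: ennreal_mult)
      then show ?thesis by (simp add: ac_simps) (metis (no_types, lifting) mult.assoc mult.commute)
    qed
    also have "\<dots> \<le> ennreal (1 / 2) * (?e s * q s)"
      using l by (intro mult_right_mono ennreal_leI) (auto simp: field_simps)
    finally show ?thesis .
  qed
  have "I \<le> (\<integral>\<^sup>+t. ?e t * (ennreal C * (\<integral>\<^sup>+s. indicator {t..} s * q s \<partial>Leb 0 T)) \<partial>Leb 0 T)"
    unfolding I_def by (rule nn_integral_mono_AE) (use le in \<open>auto elim!: eventually_mono intro: mult_left_mono\<close>)
  also have "\<dots> = (\<integral>\<^sup>+t. (\<integral>\<^sup>+s. ?e t * (ennreal C * (indicator {t..} s * q s)) \<partial>Leb 0 T) \<partial>Leb 0 T)"
    using ind_meas by (simp add: nn_integral_cmult)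
  also have "\<dots> = (\<integral>\<^sup>+s. (\<integral>\<^sup>+t. ?e t * (ennreal C * (indicator {t..} s * q s)) \<partial>Leb 0 T) \<partial>Leb 0 T)"
    using LL.Fubini'[OF pair_meas] by simp
  also have "\<dots> \<le> (\<integral>\<^sup>+s. ennreal (1 / 2) * (?e s * q s) \<partial>Leb 0 T)"
    by (intro nn_integral_mono inner)
  also have "\<dots> = ennreal (1 / 2) * I" unfolding I_def by (rule nn_integral_cmult) measurable
  finally have "I \<le> ennreal (1 / 2) * I" .
  moreover obtain i where i: "I = ennreal i" "0 \<le> i" using I_fin by (cases I) auto
  ultimately have "ennreal i \<le> ennreal (1 / 2 * i)" by (simp only: ennreal_mult)
  then have "i \<le> 1 / 2 * i" using i(2) by (subst (asm) ennreal_le_iff) auto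
  then have "i = 0" using i(2) by simp
  then have "(\<integral>\<^sup>+t. ?e t * q t \<partial>Leb 0 T) = 0" using i unfolding I_def by simp
  then have "AE t in Leb 0 T. ?e t * q t = 0" by (subst (asm) nn_integral_0_iff_AE) measurable
  then show ?thesis by eventually_elim (simp add: ennreal_eq_0_iff)
qed

section \<open>The linear backward stochastic Volterra equation\<close>

lemma borel_measurable_component: "(\<lambda>x. f x) \<in> borel_measurable M \<Longrightarrow> (\<lambda>x. f x $ i) \<in> borel_measurable M"
  for f :: "'a \<Rightarrow> 'b::real_normed_vector ^ 'n"
  by (rule borel_measurable_continuous_on[of "\<lambda>x. x $ i"]) (auto intro: continuous_intros)

lemma borel_measurable_vecI:
  fixes f :: "'a \<Rightarrow> real ^ 'n"
  assumes "\<And>i. (\<lambda>x. f x $ i) \<in> borel_measurable M"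
  shows "f \<in> borel_measurable M"
  by (subst borel_measurable_euclidean_space) (auto simp: Basis_vec_def inner_axis assms)

lemma integral_vec_component:
  fixes f :: "'a \<Rightarrow> real ^ 'n"
  assumes "integrable M f"
  shows "(\<integral>x. f x \<partial>M) $ i = (\<integral>x. f x $ i \<partial>M)"
  using integral_bounded_linear[OF bounded_linear_vec_nth assms, of i] by simp

lemma integrable_vecI:
  fixes f :: "'a \<Rightarrow> real ^ 'n"
  assumes "\<And>i. integrable M (\<lambda>x. f x $ i)"
  shows "integrable M f"
proof (rule Bochner_Integration.integrable_bound)
  show "integrable M (\<lambda>x. \<Sum>i\<in>UNIV. \<bar>f x $ i\<bar>)" using assms by (intro Bochner_Integration.integrable_sum integrable_abs)
  show "f \<in> borel_measurable M" using assms by (intro borel_measurable_vecI) auto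
  show "AE x in M. norm (f x) \<le> norm (\<Sum>i\<in>UNIV. \<bar>f x $ i\<bar>)"
    by (rule AE_I2) (use norm_le_l1_cart in \<open>auto intro: order_trans[OF _ abs_ge_self]\<close>)
qed

lemma component_square_le: "(x $ i)\<^sup>2 \<le> (norm x)\<^sup>2" for x :: "real ^ 'n"
  using component_le_norm_cart[of x i] by (metis abs_ge_zero power2_abs power_mono)

lemma abs_matrix_component_le: "\<bar>C $ i $ j\<bar> \<le> norm C" for C :: "real ^ 'n ^ 'n"
proof -
  have "\<bar>C $ i $ j\<bar> \<le> norm (C $ i)" by (rule component_le_norm_cart)
  also have "\<dots> \<le> norm C" by (rule Finite_Cartesian_Product.norm_nth_le)
  finally show ?thesis .
qed

lemma (in brownian_space) has_ito_integral_component: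
  fixes H :: "real \<Rightarrow> 'w \<Rightarrow> real ^ 'c" and i :: 'c
  assumes "has_ito_integral M F W s T H J"
  shows "has_ito_integral M F W s T (\<lambda>r \<omega>. H r \<omega> $ i) (\<lambda>\<omega>. J \<omega> $ i)"
proof -
  obtain k \<tau> \<xi> where simple: "\<And>m::nat. simple_integrand M F s T (k m) (\<tau> m) (\<xi> m)"
    and V: "(\<lambda>m. \<integral>\<^sup>+\<omega>. (\<integral>\<^sup>+r\<in>{s..T}. ennreal ((norm (simple_value (k m) (\<tau> m) (\<xi> m) r \<omega> - H r \<omega>))\<^sup>2) \<partial>lborel) \<partial>M) \<longlonglongrightarrow> 0"
    and I: "(\<lambda>m. \<integral>\<^sup>+\<omega>. ennreal ((norm (simple_ito W (k m) (\<tau> m) (\<xi> m) \<omega> - J \<omega>))\<^sup>2) \<partial>M) \<longlonglongrightarrow> 0"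
    and J: "J \<in> borel_measurable M"
    using assms unfolding has_ito_integral_def by blast
  let ?\<xi> = "\<lambda>m l \<omega>. \<xi> m l \<omega> $ i"
  have value_eq: "simple_value (k m) (\<tau> m) (?\<xi> m) r \<omega> = simple_value (k m) (\<tau> m) (\<xi> m) r \<omega> $ i" for m r \<omega>
    by (simp add: simple_value_def sum_component)
  have ito: "simple_ito W (k m) (\<tau> m) (?\<xi> m) \<omega> = simple_ito W (k m) (\<tau> m) (\<xi> m) \<omega> $ i" for m \<omega>
    by (simp add: simple_ito_def sum_component)
  have le: "(x $ i - y $ i)\<^sup>2 \<le> (norm (x - y))\<^sup>2" for x y :: "real ^ 'c"
    using component_le_norm_cart[of "x - y" i] by (metis abs_ge_zero power2_abs power_mono vector_minus_component)
  show ?thesis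
    unfolding has_ito_integral_def
  proof (intro conjI exI allI)
    show "(\<lambda>\<omega>. J \<omega> $ i) \<in> borel_measurable M" using J by (rule borel_measurable_component)
    show "simple_integrand M F s T (k m) (\<tau> m) (?\<xi> m)" for m
      unfolding simple_integrand_def
    proof (intro conjI allI impI)
      fix l assume l: "l < k m"
      then have "\<xi> m l \<in> borel_measurable (F (\<tau> m l))" "\<exists>c. \<forall>\<omega>\<in>space M. norm (\<xi> m l \<omega>) \<le> c"
        using simple[of m] unfolding simple_integrand_def by blast+
      then show "?\<xi> m l \<in> borel_measurable (F (\<tau> m l))" "\<exists>c. \<forall>\<omega>\<in>space M. norm (?\<xi> m l \<omega>) \<le> c"
        using component_le_norm_cart[of _ i] by (auto intro: borel_measurable_component order_trans)
    qed (use simple[of m] in \<open>auto simp: simple_integrand_def\<close>)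
    show "(\<lambda>m. \<integral>\<^sup>+\<omega>. (\<integral>\<^sup>+r\<in>{s..T}. ennreal ((norm (simple_value (k m) (\<tau> m) (?\<xi> m) r \<omega> - H r \<omega> $ i))\<^sup>2) \<partial>lborel) \<partial>M) \<longlonglongrightarrow> 0"
      unfolding value_eq
      by (rule tendsto_sandwich[OF _ _ tendsto_const V]) (auto intro!: always_eventually nn_integral_mono mult_right_mono ennreal_leI le)
    show "(\<lambda>m. \<integral>\<^sup>+\<omega>. ennreal ((norm (simple_ito W (k m) (\<tau> m) (?\<xi> m) \<omega> - J \<omega> $ i))\<^sup>2) \<partial>M) \<longlonglongrightarrow> 0"
      unfolding ito
      by (rule tendsto_sandwich[OF _ _ tendsto_const I]) (auto intro!: always_eventually nn_integral_mono ennreal_leI le)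
  qed
qed

locale linear_bsvie = brownian_space M W for M :: "'w measure" and W +
  fixes T K :: real
    and A :: "real \<Rightarrow> real \<Rightarrow> 'w \<Rightarrow> real^'n^'n" and B :: "real \<Rightarrow> 'w \<Rightarrow> real^'n^'n"
    and \<psi> Y :: "real \<Rightarrow> 'w \<Rightarrow> real^'n" and Z :: "real \<Rightarrow> real \<Rightarrow> 'w \<Rightarrow> real^'n"
  assumes T_pos: "0 < T"
    and A_bounded: "\<And>t s \<omega>. 0 \<le> t \<Longrightarrow> t \<le> s \<Longrightarrow> s \<le> T \<Longrightarrow> \<omega> \<in> space M \<Longrightarrow> norm (A t s \<omega>) \<le> K"
    and B_bounded: "\<And>s \<omega>. s \<in> {0..T} \<Longrightarrow> \<omega> \<in> space M \<Longrightarrow> norm (B s \<omega>) \<le> K"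
    and B_prog: "prog_measurable_on F 0 T B"
    and A_prog: "\<And>t. t \<in> {0..T} \<Longrightarrow> prog_measurable_on F t T (A t)"
    and A_offdiag: "\<And>t s. 0 \<le> t \<Longrightarrow> t \<le> s \<Longrightarrow> s \<le> T \<Longrightarrow> AE \<omega> in M. A t s \<omega> \<in> offdiag_nonneg_matrices"
    and A_antimono: "\<And>t \<tau> s. 0 \<le> t \<Longrightarrow> t \<le> \<tau> \<Longrightarrow> \<tau> \<le> s \<Longrightarrow> s \<le> T \<Longrightarrow>
      AE \<omega> in M. A t s \<omega> - A \<tau> s \<omega> \<in> nonneg_matrices"
    and B_diagonal: "\<And>s. s \<in> {0..T} \<Longrightarrow> AE \<omega> in M. B s \<omega> \<in> diagonal_matrices"
    and \<psi>_L2: "\<And>t. t \<in> {0..T} \<Longrightarrow> \<psi> t \<in> L2_rv M (F T)"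
    and \<psi>_antimono: "\<And>t s. 0 \<le> t \<Longrightarrow> t \<le> s \<Longrightarrow> s \<le> T \<Longrightarrow> AE \<omega> in M. \<psi> t \<omega> \<ge> \<psi> s \<omega> \<and> \<psi> s \<omega> \<ge> 0"
    and solution: "adapted_solution M F W T A B \<psi> Y Z"
begin

text \<open>
  Adding \<open>K\<close> to the diagonal makes all entries nonnegative, since \<open>K\<close> bounds the diagonal entries.
\<close>

definition A_plus :: "real \<Rightarrow> real \<Rightarrow> 'w \<Rightarrow> 'n \<Rightarrow> 'n \<Rightarrow> real" where
  "A_plus s r \<omega> i j = A s r \<omega> $ i $ j + (if i = j then K else 0)"

lemma K_nonneg: "0 \<le> K"
proof -
  obtain \<omega> where "\<omega> \<in> space M" using not_empty by blast
  then show ?thesis using order_trans[OF norm_ge_zero B_bounded[of 0 \<omega>]] T_pos by simp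
qed

lemma A_plus_bounded:
  assumes "0 \<le> s" "s \<le> r" "r \<le> T" "\<omega> \<in> space M"
  shows "\<bar>A_plus s r \<omega> i j\<bar> \<le> 2 * K"
  using abs_matrix_component_le[of "A s r \<omega>" i j] A_bounded[OF assms] K_nonneg by (auto simp: A_plus_def)

lemma A_plus_nonneg:
  assumes "0 \<le> s" "s \<le> r" "r \<le> T"
  shows "AE \<omega> in M. \<forall>j. 0 \<le> A_plus s r \<omega> i j"
  using A_offdiag[OF assms] AE_space
proof eventually_elim
  case (elim \<omega>)
  show ?case
  proof
    fix j
    show "0 \<le> A_plus s r \<omega> i j"
      using elim(1) abs_matrix_component_le[of "A s r \<omega>" i j] A_bounded[OF assms elim(2)]
      by (auto simp: A_plus_def offdiag_nonneg_matrices_def)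
  qed
qed

lemma A_plus_antimono:
  assumes "0 \<le> s" "s \<le> s'" "s' \<le> r" "r \<le> T"
  shows "AE \<omega> in M. \<forall>j. A_plus s' r \<omega> i j \<le> A_plus s r \<omega> i j"
  using A_antimono[OF assms] by eventually_elim (auto simp: A_plus_def nonneg_matrices_def)

lemma A_plus_measurable:
  assumes "s \<in> {0..T}"
  shows "(\<lambda>(r, \<omega>). A_plus s r \<omega> i j) \<in> borel_measurable (LebM s T)"
proof -
  have "(\<lambda>z. A s (fst z) (snd z)) \<in> borel_measurable (LebM s T)"
    using prog_measurable_joint[OF A_prog[OF assms]] assms by (simp add: case_prod_unfold)
  then have "(\<lambda>z. A s (fst z) (snd z) $ i $ j) \<in> borel_measurable (LebM s T)"
    by (intro borel_measurable_component)
  then show ?thesis unfolding A_plus_def case_prod_unfold by (rule borel_measurable_add) simp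
qed

lemma inclusion_measurable:
  assumes "a \<le> s" "t \<le> b"
  shows "(\<lambda>z. (fst z, snd z)) \<in> measurable (LebM s t) (LebM a b)"
proof (intro measurable_Pair measurable_compose[OF measurable_fst] measurable_snd)
  show "(\<lambda>x. x) \<in> measurable (Leb s t) (Leb a b)"
    using assms by (intro measurable_restrict_space2 measurable_restrict_space1) (auto simp: space_restrict_space)
qed

lemma B_measurable:
  assumes "0 \<le> s"
  shows "(\<lambda>(r, \<omega>). B r \<omega> $ i $ j) \<in> borel_measurable (LebM s T)"
proof -
  have "(\<lambda>z. B (fst z) (snd z)) \<in> borel_measurable (LebM s T)"
    using measurable_compose[OF inclusion_measurable[OF assms order_refl, of T] prog_measurable_joint[OF B_prog]] T_pos
    by (simp add: case_prod_unfold)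
  then show ?thesis unfolding case_prod_unfold by (intro borel_measurable_component)
qed

lemma Y_measurable:
  assumes "0 \<le> s"
  shows "(\<lambda>(r, \<omega>). Y r \<omega> $ j) \<in> borel_measurable (LebM s T)"
proof -
  have "(\<lambda>(t, \<omega>). Y t \<omega>) \<in> borel_measurable (restrict_space borel {0..T} \<Otimes>\<^sub>M M)"
    using solution by (auto simp: adapted_solution_def L2_adapted_def)
  then have "(\<lambda>(t, \<omega>). Y t \<omega>) \<in> borel_measurable (LebM 0 T)"
    by (simp cong: measurable_cong_sets sets_pair_measure_cong add: sets_Leb)
  from measurable_compose[OF inclusion_measurable[OF assms order_refl] this]
  show ?thesis by (simp add: case_prod_unfold borel_measurable_component)
qed

lemma Y_adapted: "t \<in> {0..T} \<Longrightarrow> (\<lambda>\<omega>. Y t \<omega> $ j) \<in> borel_measurable (F t)"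
  using solution by (auto simp: adapted_solution_def L2_adapted_def intro: borel_measurable_component)

lemma square_integrable_Y:
  assumes "0 \<le> s"
  shows "square_integrable (LebM s T) (\<lambda>(r, \<omega>). Y r \<omega> $ j)"
  unfolding square_integrable_Leb_iff(1)[OF Y_measurable[OF assms]]
proof -
  have "(\<integral>\<^sup>+\<omega>. (\<integral>\<^sup>+r\<in>{s..T}. ennreal ((Y r \<omega> $ j)\<^sup>2) \<partial>lborel) \<partial>M)
    \<le> (\<integral>\<^sup>+\<omega>. (\<integral>\<^sup>+t\<in>{0..T}. ennreal ((norm (Y t \<omega>))\<^sup>2) \<partial>lborel) \<partial>M)"
    by (intro nn_integral_mono mult_mono ennreal_leI component_square_le) (use assms in \<open>auto simp: indicator_def\<close>)
  also have "\<dots> < \<infinity>" using solution by (auto simp: adapted_solution_def L2_adapted_def)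
  finally show "(\<integral>\<^sup>+\<omega>. (\<integral>\<^sup>+r\<in>{s..T}. ennreal ((Y r \<omega> $ j)\<^sup>2) \<partial>lborel) \<partial>M) < \<infinity>" .
qed

lemma square_integrable_\<psi>:
  assumes "s \<in> {0..T}"
  shows "square_integrable M (\<lambda>\<omega>. \<psi> s \<omega> $ j)"
proof -
  have meas: "\<psi> s \<in> borel_measurable M" and fin: "(\<integral>\<^sup>+\<omega>. ennreal ((norm (\<psi> s \<omega>))\<^sup>2) \<partial>M) < \<infinity>"
    using \<psi>_L2[OF assms] measurable_F_M by (auto simp: L2_rv_def)
  have c: "(\<lambda>\<omega>. \<psi> s \<omega> $ j) \<in> borel_measurable M" using meas by (rule borel_measurable_component)
  have "(\<integral>\<^sup>+\<omega>. ennreal ((\<psi> s \<omega> $ j)\<^sup>2) \<partial>M) \<le> (\<integral>\<^sup>+\<omega>. ennreal ((norm (\<psi> s \<omega>))\<^sup>2) \<partial>M)"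
    by (intro nn_integral_mono ennreal_leI component_square_le)
  with fin show ?thesis unfolding square_integrable_nn_iff[OF c] by (rule le_less_trans[rotated])
qed

lemma square_integrable_A_plus_sum:
  assumes s: "s \<in> {0..T}" and f: "f \<in> borel_measurable borel" "\<And>y. \<bar>f y\<bar> \<le> \<bar>y\<bar>"
  shows "square_integrable (LebM s T) (\<lambda>(r, \<omega>). \<Sum>j\<in>UNIV. A_plus s r \<omega> i j * f (Y r \<omega> $ j))"
  unfolding case_prod_unfold
proof (rule square_integrable_sum)
  fix j
  have Y: "square_integrable (LebM s T) (\<lambda>z. Y (fst z) (snd z) $ j)"
    using square_integrable_Y[of s j] s by (simp add: case_prod_unfold)
  then have fY: "square_integrable (LebM s T) (\<lambda>z. f (Y (fst z) (snd z) $ j))"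
  proof (rule square_integrable_dominated)
    show "(\<lambda>z. f (Y (fst z) (snd z) $ j)) \<in> borel_measurable (LebM s T)"
      using Y by (intro measurable_compose[OF _ f(1)]) (simp add: square_integrable_def)
  qed (use f(2) in simp)
  show "square_integrable (LebM s T) (\<lambda>z. A_plus s (fst z) (snd z) i j * f (Y (fst z) (snd z) $ j))"
    using A_plus_measurable[OF s, of i j] A_plus_bounded[of s] s
    by (intro square_integrable_bounded_mult[OF fY, of _ "2 * K"]) (auto simp: space_pair_measure space_restrict_space case_prod_unfold)
qed

definition Z_norm :: "real \<Rightarrow> ennreal" where
  "Z_norm s = (\<integral>\<^sup>+\<omega>. (\<integral>\<^sup>+r\<in>{s..T}. ennreal ((norm (Z s r \<omega>))\<^sup>2) \<partial>lborel) \<partial>M)"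

text \<open>
  The times at which the equation can be used; almost every time is one of them.
\<close>

definition solves_at :: "real \<Rightarrow> bool" where
  "solves_at s \<longleftrightarrow> s \<in> {0..T} \<and> Z_norm s < \<infinity> \<and>
     (\<exists>J. has_ito_integral M F W s T (Z s) J \<and>
        (AE \<omega> in M. Y s \<omega> = \<psi> s \<omega> + (LINT r:{s..T}|lborel. A s r \<omega> *v Y r \<omega> + B r \<omega> *v Z s r \<omega>) - J \<omega>))"

lemma Z_norm_measurable: "Z_norm \<in> borel_measurable (Leb 0 T)"
  and Z_norm_finite: "(\<integral>\<^sup>+s. Z_norm s \<partial>Leb 0 T) < \<infinity>"
proof -
  have "Z_norm \<in> borel_measurable (restrict_space borel {0..T})" "(\<integral>\<^sup>+s\<in>{0..T}. Z_norm s \<partial>lborel) < \<infinity>"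
    using solution unfolding adapted_solution_def L2_adapted_triangle_def Z_norm_def[abs_def] by blast+
  then show "Z_norm \<in> borel_measurable (Leb 0 T)" "(\<integral>\<^sup>+s. Z_norm s \<partial>Leb 0 T) < \<infinity>"
    by (simp_all cong: measurable_cong_sets add: sets_Leb nn_integral_restrict_space)
qed

lemma AE_solves_at: "AE s in Leb 0 T. solves_at s"
proof -
  have "AE s in lborel. s \<in> {0..T} \<longrightarrow> (\<exists>J. has_ito_integral M F W s T (Z s) J \<and>
     (AE \<omega> in M. Y s \<omega> = \<psi> s \<omega> + (LINT r:{s..T}|lborel. A s r \<omega> *v Y r \<omega> + B r \<omega> *v Z s r \<omega>) - J \<omega>))"
    using solution unfolding adapted_solution_def by blast
  then have "AE s in Leb 0 T. \<exists>J. has_ito_integral M F W s T (Z s) J \<and>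
     (AE \<omega> in M. Y s \<omega> = \<psi> s \<omega> + (LINT r:{s..T}|lborel. A s r \<omega> *v Y r \<omega> + B r \<omega> *v Z s r \<omega>) - J \<omega>)"
    by (subst AE_restrict_space_iff) auto
  moreover have "AE s in Leb 0 T. Z_norm s \<noteq> \<infinity>"
    using Z_norm_finite by (intro nn_integral_PInf_AE Z_norm_measurable) auto
  ultimately show ?thesis using AE_space[of "Leb 0 T"]
    by eventually_elim (auto simp: solves_at_def space_restrict_space less_top)
qed

lemma square_integrable_Z:
  assumes "solves_at s"
  shows "square_integrable (LebM s T) (\<lambda>(r, \<omega>). Z s r \<omega> $ j)"
    and "(\<integral>z. (case z of (r, \<omega>) \<Rightarrow> Z s r \<omega> $ j)\<^sup>2 \<partial>(LebM s T)) \<le> enn2real (Z_norm s)"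
proof -
  have s: "s \<in> {0..T}" and fin: "Z_norm s < \<infinity>" using assms by (auto simp: solves_at_def)
  have "prog_measurable_on F s T (Z s)"
    using solution s unfolding adapted_solution_def L2_adapted_triangle_def by blast
  then have meas: "(\<lambda>(r, \<omega>). Z s r \<omega> $ j) \<in> borel_measurable (LebM s T)"
    using prog_measurable_joint[of s T "Z s"] s by (simp add: case_prod_unfold borel_measurable_component)
  have le: "(\<integral>\<^sup>+\<omega>. (\<integral>\<^sup>+r\<in>{s..T}. ennreal ((Z s r \<omega> $ j)\<^sup>2) \<partial>lborel) \<partial>M) \<le> Z_norm s"
    unfolding Z_norm_def
    by (intro nn_integral_mono mult_right_mono ennreal_leI component_square_le) auto
  then show sq: "square_integrable (LebM s T) (\<lambda>(r, \<omega>). Z s r \<omega> $ j)"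
    unfolding square_integrable_Leb_iff(1)[OF meas] using fin by (rule le_less_trans)
  show "(\<integral>z. (case z of (r, \<omega>) \<Rightarrow> Z s r \<omega> $ j)\<^sup>2 \<partial>(LebM s T)) \<le> enn2real (Z_norm s)"
    unfolding square_integrable_Leb_iff(2)[OF meas sq] using le fin by (intro enn2real_mono) auto
qed

text \<open>
  The \<open>i\<close>-th component of the drift for diagonal \<open>B\<close>, written with the nonnegative matrix \<open>A_plus\<close>.
\<close>

definition integrand :: "real \<Rightarrow> 'n \<Rightarrow> real \<Rightarrow> 'w \<Rightarrow> real" where
  "integrand s i r \<omega> = (\<Sum>j\<in>UNIV. A_plus s r \<omega> i j * Y r \<omega> $ j) - K * Y r \<omega> $ i + B r \<omega> $ i $ i * Z s r \<omega> $ i"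

lemma square_integrable_B_mult:
  assumes "0 \<le> s" and H: "square_integrable (LebM s T) (\<lambda>(r, \<omega>). H r \<omega>)"
  shows "square_integrable (LebM s T) (\<lambda>(r, \<omega>). B r \<omega> $ i $ j * H r \<omega>)"
proof -
  have "\<bar>case z of (r, \<omega>) \<Rightarrow> B r \<omega> $ i $ j\<bar> \<le> K" if "z \<in> space (LebM s T)" for z
    using that assms order_trans[OF abs_matrix_component_le B_bounded]
    by (auto simp: space_pair_measure space_restrict_space)
  from square_integrable_bounded_mult[OF H B_measurable[OF assms(1)] this]
  show ?thesis by (simp add: case_prod_unfold)
qed

text \<open>
  The drift is integrable for almost every \<open>\<omega>\<close>, as it is square-integrable on the product space. This
  allows taking components inside the integral, where the off-diagonal entries of \<open>B\<close> vanish almost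
  everywhere.
\<close>

lemma component_equation:
  assumes "solves_at s"
  shows "\<exists>J. has_ito_integral M F W s T (\<lambda>r \<omega>. Z s r \<omega> $ i) J \<and>
    (AE \<omega> in M. Y s \<omega> $ i = \<psi> s \<omega> $ i + (\<integral>r. integrand s i r \<omega> \<partial>Leb s T) - J \<omega>)"
proof -
  have s: "s \<in> {0..T}" using assms by (simp add: solves_at_def)
  interpret P: pair_sigma_finite "Leb s T" M by (rule pair_Leb)
  interpret Q: pair_sigma_finite M "Leb s T" ..
  interpret PF: finite_measure "LebM s T" by (rule finite_measure_pair_Leb)
  obtain J where J: "has_ito_integral M F W s T (Z s) J"
    and eq: "AE \<omega> in M. Y s \<omega> = \<psi> s \<omega> + (LINT r:{s..T}|lborel. A s r \<omega> *v Y r \<omega> + B r \<omega> *v Z s r \<omega>) - J \<omega>"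
    using assms unfolding solves_at_def by blast
  let ?v = "\<lambda>r \<omega>. A s r \<omega> *v Y r \<omega> + B r \<omega> *v Z s r \<omega>"
  have comp: "?v r \<omega> $ l = (\<Sum>j\<in>UNIV. A_plus s r \<omega> l j * Y r \<omega> $ j) - K * Y r \<omega> $ l + (\<Sum>j\<in>UNIV. B r \<omega> $ l $ j * Z s r \<omega> $ j)" for r \<omega> l
  proof -
    have "(\<Sum>j\<in>UNIV. A_plus s r \<omega> l j * Y r \<omega> $ j) = (\<Sum>j\<in>UNIV. A s r \<omega> $ l $ j * Y r \<omega> $ j) + (\<Sum>j\<in>UNIV. if l = j then K * Y r \<omega> $ j else 0)"
      unfolding sum.distrib[symmetric] by (intro sum.cong) (auto simp: A_plus_def algebra_simps)
    then show ?thesis by (simp add: matrix_vector_mult_def)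
  qed
  have sq: "square_integrable (LebM s T) (\<lambda>z. ?v (fst z) (snd z) $ l)" for l
  proof -
    have 1: "square_integrable (LebM s T) (\<lambda>z. \<Sum>j\<in>UNIV. A_plus s (fst z) (snd z) l j * Y (fst z) (snd z) $ j)"
      using square_integrable_A_plus_sum[OF s, of "\<lambda>y. y" l] by (simp add: case_prod_unfold)
    have 2: "square_integrable (LebM s T) (\<lambda>z. Y (fst z) (snd z) $ l)"
      using square_integrable_Y[of s l] s by (simp add: case_prod_unfold)
    have 3: "square_integrable (LebM s T) (\<lambda>z. B (fst z) (snd z) $ l $ j * Z s (fst z) (snd z) $ j)" for j
      using square_integrable_B_mult[OF _ square_integrable_Z(1)[OF assms]] s by (simp add: case_prod_unfold)
    show ?thesis unfolding comp
      by (rule square_integrable_add[OF square_integrable_diff[OF 1 square_integrable_cmult[OF 2]] square_integrable_sum[OF 3]])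
  qed
  have "integrable (LebM s T) (\<lambda>z. ?v (fst z) (snd z))"
  proof (rule integrable_vecI)
    fix l
    show "integrable (LebM s T) (\<lambda>z. ?v (fst z) (snd z) $ l)"
      using square_integrable_mult[OF sq[of l] square_integrable_const[OF PF.finite_measure_axioms, of 1]] by simp
  qed
  from P.integrable_product_swap[OF this]
  have int: "AE \<omega> in M. integrable (Leb s T) (\<lambda>r. ?v r \<omega>)"
    using Q.AE_integrable_fst'[of "\<lambda>(x, y). ?v y x"] by (simp add: case_prod_unfold)
  have diag: "AE \<omega> in M. AE r in Leb s T. (\<Sum>j\<in>UNIV - {i}. \<bar>B r \<omega> $ i $ j\<bar>) = 0"
  proof (subst P.AE_commute[symmetric])
    have "(\<lambda>z. \<Sum>j\<in>UNIV - {i}. \<bar>B (fst z) (snd z) $ i $ j\<bar>) \<in> borel_measurable (LebM s T)"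
      using B_measurable[of s i] s by (intro borel_measurable_sum borel_measurable_abs) (auto simp: case_prod_unfold)
    then show "{z \<in> space (LebM s T). (\<Sum>j\<in>UNIV - {i}. \<bar>B (fst z) (snd z) $ i $ j\<bar>) = 0} \<in> sets (LebM s T)"
      by measurable
    show "AE r in Leb s T. AE \<omega> in M. (\<Sum>j\<in>UNIV - {i}. \<bar>B r \<omega> $ i $ j\<bar>) = 0"
    proof (rule AE_I2)
      fix r assume "r \<in> space (Leb s T)"
      then have "r \<in> {0..T}" using s by (auto simp: space_restrict_space)
      from B_diagonal[OF this] show "AE \<omega> in M. (\<Sum>j\<in>UNIV - {i}. \<bar>B r \<omega> $ i $ j\<bar>) = 0"
        by eventually_elim (auto simp: diagonal_matrices_def intro!: sum.neutral)
    qed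
  qed
  have "AE \<omega> in M. Y s \<omega> $ i = \<psi> s \<omega> $ i + (\<integral>r. integrand s i r \<omega> \<partial>Leb s T) - J \<omega> $ i"
    using eq int diag AE_space
  proof eventually_elim
    case (elim \<omega>)
    have "(LINT r:{s..T}|lborel. ?v r \<omega>) = (\<integral>r. ?v r \<omega> \<partial>Leb s T)"
      by (subst integral_restrict_space) (auto simp: set_lebesgue_integral_def)
    then have "(LINT r:{s..T}|lborel. ?v r \<omega>) $ i = (\<integral>r. ?v r \<omega> $ i \<partial>Leb s T)"
      using integral_vec_component[OF elim(2)] by simp
    also have "\<dots> = (\<integral>r. integrand s i r \<omega> \<partial>Leb s T)"
    proof (rule integral_cong_AE)
      show "(\<lambda>r. ?v r \<omega> $ i) \<in> borel_measurable (Leb s T)"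
        using elim(2) by (intro borel_measurable_component) auto
      have "(\<lambda>z. integrand s i (fst z) (snd z)) \<in> borel_measurable (LebM s T)"
        unfolding integrand_def
        using square_integrable_A_plus_sum[OF s, of "\<lambda>y. y" i] Y_measurable[of s i] B_measurable[of s i i] square_integrable_Z(1)[OF assms, of i] s
        by (auto simp: case_prod_unfold square_integrable_def intro!: borel_measurable_add borel_measurable_diff borel_measurable_times)
      from measurable_Pair1[OF this elim(4)]
      show "(\<lambda>r. integrand s i r \<omega>) \<in> borel_measurable (Leb s T)" by simp
      show "AE r in Leb s T. ?v r \<omega> $ i = integrand s i r \<omega>"
        using elim(3)
      proof eventually_elim
        case (elim r)
        then have zero: "B r \<omega> $ i $ j = 0" if "j \<noteq> i" for j
          using that by (subst (asm) sum_nonneg_eq_0_iff) auto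
        have "(\<Sum>j\<in>UNIV. B r \<omega> $ i $ j * Z s r \<omega> $ j) = (\<Sum>j\<in>UNIV. if j = i then B r \<omega> $ i $ i * Z s r \<omega> $ i else 0)"
          using zero by (intro sum.cong) auto
        then show ?case unfolding comp integrand_def by simp
      qed
    qed
    finally show ?case by (subst elim(1)) simp
  qed
  then show ?thesis using has_ito_integral_component[OF J] by blast
qed

end

section \<open>The equation tested with a density\<close>

lemma AE_Leb_mono:
  assumes "AE r in Leb a b. P r" "a \<le> s" "t \<le> b"
  shows "AE r in Leb s t. P r"
proof -
  have "AE r in lborel. r \<in> {a..b} \<longrightarrow> P r" using assms(1) by (subst (asm) AE_restrict_space_iff) auto
  then have "AE r in lborel. r \<in> {s..t} \<longrightarrow> P r" by eventually_elim (use assms(2,3) in auto)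
  then show ?thesis by (subst AE_restrict_space_iff) auto
qed

lemma integral_Leb_subinterval:
  fixes f :: "real \<Rightarrow> real"
  assumes "a \<le> s"
  shows "(\<integral>r. f r \<partial>Leb s t) = (\<integral>r. indicator {s..} r * f r \<partial>Leb a t)"
proof -
  have "(\<integral>r. f r \<partial>Leb s t) = (LINT r|lborel. indicator {s..t} r *\<^sub>R f r)"
    by (subst integral_restrict_space) (auto simp: set_lebesgue_integral_def)
  also have "\<dots> = (LINT r|lborel. indicator {a..t} r *\<^sub>R (indicator {s..} r * f r))"
    by (rule Bochner_Integration.integral_cong) (use assms in \<open>auto simp: indicator_def\<close>)
  also have "\<dots> = (\<integral>r. indicator {s..} r * f r \<partial>Leb a t)"
    by (subst integral_restrict_space) (auto simp: set_lebesgue_integral_def)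
  finally show ?thesis .
qed

lemma integrable_Leb_subinterval:
  fixes f :: "real \<Rightarrow> real"
  assumes f: "integrable (Leb a t) f" and "a \<le> s"
  shows "integrable (Leb s t) f"
proof -
  have "set_integrable lborel {a..t} f" using f by (simp add: integrable_restrict_space set_integrable_def)
  then have "set_integrable lborel {s..t} f" by (rule set_integrable_subset) (use assms in auto)
  then show ?thesis by (simp add: integrable_restrict_space set_integrable_def)
qed

lemma integral_Leb_mono_interval:
  fixes f :: "real \<Rightarrow> real"
  assumes f: "integrable (Leb a t) f" and s: "a \<le> s" and nonneg: "\<And>r. r \<in> {a..t} \<Longrightarrow> 0 \<le> f r"
  shows "(\<integral>r. f r \<partial>Leb s t) \<le> (\<integral>r. f r \<partial>Leb a t)"
  unfolding integral_Leb_subinterval[OF s]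
proof (rule integral_mono[OF _ f])
  show "integrable (Leb a t) (\<lambda>r. indicator {s..} r * f r)"
  proof (rule Bochner_Integration.integrable_bound[OF f])
    have "(indicat_real {s..}) \<in> borel_measurable (Leb a t)" by (rule borel_measurable_Leb) simp
    then show "(\<lambda>r. indicat_real {s..} r * f r) \<in> borel_measurable (Leb a t)" using f by (intro borel_measurable_times) auto
  qed (auto simp: indicator_def)
  fix r assume "r \<in> space (Leb a t)"
  then show "indicator {s..} r * f r \<le> f r" using nonneg[of r] by (auto simp: indicator_def space_restrict_space)
qed

text \<open>
  The tail integrals of the positive and of the negative part of \<open>y\<close> are monotone.
\<close>

lemma integrable_tail_integral:
  fixes y :: "real \<Rightarrow> real"
  assumes y: "integrable (Leb t T) y"
  shows "integrable (Leb t T) (\<lambda>s. \<integral>r. indicator {s..} r * y r \<partial>Leb t T)"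
proof -
  have ind: "(indicat_real {s..}) \<in> borel_measurable (Leb t T)" for s :: real by (rule borel_measurable_Leb) simp
  have nonneg_case: "integrable (Leb t T) (\<lambda>s. \<integral>r. indicator {s..} r * u r \<partial>Leb t T)"
      and int: "\<And>s. integrable (Leb t T) (\<lambda>r. indicator {s..} r * u r)"
    if u: "integrable (Leb t T) u" "\<And>r. 0 \<le> u r" for u :: "real \<Rightarrow> real"
  proof -
    show int: "integrable (Leb t T) (\<lambda>r. indicator {s..} r * u r)" for s
    proof (rule Bochner_Integration.integrable_bound[OF u(1)])
      show "(\<lambda>r. indicat_real {s..} r * u r) \<in> borel_measurable (Leb t T)"
        using u ind by (intro borel_measurable_times) auto
    qed (use u in \<open>auto simp: indicator_def\<close>)
    show "integrable (Leb t T) (\<lambda>s. \<integral>r. indicator {s..} r * u r \<partial>Leb t T)"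
    proof (rule antimono_bounded_integrable)
      fix s s' :: real assume "s \<le> s'"
      then show "(\<integral>r. indicator {s'..} r * u r \<partial>Leb t T) \<le> (\<integral>r. indicator {s..} r * u r \<partial>Leb t T)"
        by (intro integral_mono int) (auto simp: indicator_def u)
    next
      fix s :: real
      show "0 \<le> (\<integral>r. indicator {s..} r * u r \<partial>Leb t T)" by (intro Bochner_Integration.integral_nonneg) (simp add: u)
    qed
  qed
  have p: "integrable (Leb t T) (\<lambda>r. max (y r) 0)" and n: "integrable (Leb t T) (\<lambda>r. max (- y r) 0)"
    using y by (auto intro!: integrable_max)
  have "(\<integral>r. indicator {s..} r * y r \<partial>Leb t T) = (\<integral>r. indicator {s..} r * max (y r) 0 \<partial>Leb t T) - (\<integral>r. indicator {s..} r * max (- y r) 0 \<partial>Leb t T)" for s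
  proof -
    have ip: "integrable (Leb t T) (\<lambda>r. indicator {s..} r * max (y r) 0)" by (rule int[OF p]) simp
    have "in": "integrable (Leb t T) (\<lambda>r. indicator {s..} r * max (- y r) 0)" by (rule int[OF n]) simp
    show ?thesis unfolding Bochner_Integration.integral_diff[OF ip "in", symmetric]
      by (intro Bochner_Integration.integral_cong) (auto simp: indicator_def)
  qed
  then show ?thesis using nonneg_case[OF p] nonneg_case[OF n] by (simp add: Bochner_Integration.integrable_diff)
qed

context linear_bsvie
begin

text \<open>
  It is applied with the positive and the negative part as \<open>f\<close>.
\<close>

definition weighted :: "('w \<Rightarrow> real) \<Rightarrow> (real \<Rightarrow> real) \<Rightarrow> 'n \<Rightarrow> real \<Rightarrow> real \<Rightarrow> real" where
  "weighted \<eta> f i s r = (\<integral>\<omega>. \<eta> \<omega> * (\<Sum>j\<in>UNIV. A_plus s r \<omega> i j * f (Y r \<omega> $ j)) \<partial>M)"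

context
  fixes \<eta> :: "'w \<Rightarrow> real" and f :: "real \<Rightarrow> real"
  assumes \<eta>: "square_integrable M \<eta>" and \<eta>_nonneg: "\<And>\<omega>. 0 \<le> \<eta> \<omega>"
    and f: "f \<in> borel_measurable borel" "\<And>y. \<bar>f y\<bar> \<le> \<bar>y\<bar>" "\<And>y. 0 \<le> f y"
begin

lemma weighted_nonneg:
  assumes "0 \<le> s" "s \<le> r" "r \<le> T"
  shows "0 \<le> weighted \<eta> f i s r"
  unfolding weighted_def
proof (rule integral_nonneg_AE)
  show "AE \<omega> in M. 0 \<le> \<eta> \<omega> * (\<Sum>j\<in>UNIV. A_plus s r \<omega> i j * f (Y r \<omega> $ j))"
    using A_plus_nonneg[OF assms, of i] by eventually_elim (intro mult_nonneg_nonneg sum_nonneg \<eta>_nonneg f(3), simp)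
qed

lemma weighted_integrable:
  assumes "s \<in> {0..T}"
  shows "integrable (Leb s T) (weighted \<eta> f i s)"
    and "AE r in Leb s T. integrable M (\<lambda>\<omega>. \<eta> \<omega> * (\<Sum>j\<in>UNIV. A_plus s r \<omega> i j * f (Y r \<omega> $ j)))"
    and "(\<integral>r. weighted \<eta> f i s r \<partial>Leb s T) = (\<integral>(r, \<omega>). \<eta> \<omega> * (\<Sum>j\<in>UNIV. A_plus s r \<omega> i j * f (Y r \<omega> $ j)) \<partial>(LebM s T))"
proof -
  interpret P: pair_sigma_finite "Leb s T" M by (rule pair_Leb)
  note int = integral_mult_Leb(1)[OF \<eta> square_integrable_A_plus_sum[OF assms f(1,2), of i]]
  show "integrable (Leb s T) (weighted \<eta> f i s)"
    using P.integrable_fst'[OF int] by (simp add: weighted_def[abs_def])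
  show "AE r in Leb s T. integrable M (\<lambda>\<omega>. \<eta> \<omega> * (\<Sum>j\<in>UNIV. A_plus s r \<omega> i j * f (Y r \<omega> $ j)))"
    using P.AE_integrable_fst'[OF int] by simp
  show "(\<integral>r. weighted \<eta> f i s r \<partial>Leb s T) = (\<integral>(r, \<omega>). \<eta> \<omega> * (\<Sum>j\<in>UNIV. A_plus s r \<omega> i j * f (Y r \<omega> $ j)) \<partial>(LebM s T))"
    using P.integral_fst'[OF int] by (simp add: weighted_def)
qed

lemma weighted_tail_nonneg:
  assumes "0 \<le> s"
  shows "0 \<le> (\<integral>r. weighted \<eta> f i s r \<partial>Leb s T)"
  using weighted_nonneg[OF assms] by (intro Bochner_Integration.integral_nonneg) (auto simp: space_restrict_space)

text \<open>
  Two effects add up: the matrix decreases in its first time variable, and the interval of integration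
  of a nonnegative function shrinks.
\<close>

lemma weighted_tail_antimono:
  assumes s: "0 \<le> s" "s \<le> s'" "s' \<le> T"
  shows "(\<integral>r. weighted \<eta> f i s' r \<partial>Leb s' T) \<le> (\<integral>r. weighted \<eta> f i s r \<partial>Leb s T)"
proof -
  have in_range: "s \<in> {0..T}" "s' \<in> {0..T}" using s by auto
  note w = weighted_integrable[OF in_range(1), of i] and w' = weighted_integrable[OF in_range(2), of i]
  have "(\<integral>r. weighted \<eta> f i s' r \<partial>Leb s' T) \<le> (\<integral>r. weighted \<eta> f i s r \<partial>Leb s' T)"
  proof (rule integral_mono_AE[OF w'(1) integrable_Leb_subinterval[OF w(1) s(2)]])
    show "AE r in Leb s' T. weighted \<eta> f i s' r \<le> weighted \<eta> f i s r"
      using AE_Leb_mono[OF w(2) s(2) order_refl] w'(2) AE_space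
    proof eventually_elim
      case (elim r)
      then have r: "s' \<le> r" "r \<le> T" by (auto simp: space_restrict_space)
      show ?case unfolding weighted_def
      proof (rule integral_mono_AE[OF elim(2,1)])
        show "AE \<omega> in M. \<eta> \<omega> * (\<Sum>j\<in>UNIV. A_plus s' r \<omega> i j * f (Y r \<omega> $ j)) \<le> \<eta> \<omega> * (\<Sum>j\<in>UNIV. A_plus s r \<omega> i j * f (Y r \<omega> $ j))"
          using A_plus_antimono[OF s(1,2) r, of i]
          by eventually_elim (intro mult_left_mono sum_mono mult_right_mono \<eta>_nonneg f(3), simp)
      qed
    qed
  qed
  also have "\<dots> \<le> (\<integral>r. weighted \<eta> f i s r \<partial>Leb s T)"
    using weighted_nonneg[OF s(1)] by (intro integral_Leb_mono_interval[OF w(1) s(2)]) auto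
  finally show ?thesis .
qed

end

lemma \<psi>_weighted_antimono:
  assumes \<eta>: "square_integrable M \<eta>" "\<And>\<omega>. 0 \<le> \<eta> \<omega>" and s: "0 \<le> s" "s \<le> s'" "s' \<le> T"
  shows "(\<integral>\<omega>. \<eta> \<omega> * \<psi> s' \<omega> $ i \<partial>M) \<le> (\<integral>\<omega>. \<eta> \<omega> * \<psi> s \<omega> $ i \<partial>M)"
    and "0 \<le> (\<integral>\<omega>. \<eta> \<omega> * \<psi> s' \<omega> $ i \<partial>M)"
proof -
  have int: "integrable M (\<lambda>\<omega>. \<eta> \<omega> * \<psi> r \<omega> $ i)" if "r \<in> {0..T}" for r
    using square_integrable_mult[OF \<eta>(1) square_integrable_\<psi>[OF that]] .
  show "(\<integral>\<omega>. \<eta> \<omega> * \<psi> s' \<omega> $ i \<partial>M) \<le> (\<integral>\<omega>. \<eta> \<omega> * \<psi> s \<omega> $ i \<partial>M)"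
  proof (rule integral_mono_AE)
    show "AE \<omega> in M. \<eta> \<omega> * \<psi> s' \<omega> $ i \<le> \<eta> \<omega> * \<psi> s \<omega> $ i"
      using \<psi>_antimono[OF s] by eventually_elim (auto simp: less_eq_vec_def intro!: mult_left_mono \<eta>(2))
  qed (use int s in auto)
  show "0 \<le> (\<integral>\<omega>. \<eta> \<omega> * \<psi> s' \<omega> $ i \<partial>M)"
  proof (rule integral_nonneg_AE)
    show "AE \<omega> in M. 0 \<le> \<eta> \<omega> * \<psi> s' \<omega> $ i"
      using \<psi>_antimono[OF s] by eventually_elim (auto simp: less_eq_vec_def intro!: mult_nonneg_nonneg \<eta>(2))
  qed
qed

lemma measurable_Y: "t \<in> {0..T} \<Longrightarrow> (\<lambda>\<omega>. Y t \<omega> $ j) \<in> borel_measurable M"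
  using measurable_F_M[OF Y_adapted] .

text \<open>
  Multiply \<open>component_equation\<close> by \<open>\<eta>\<close> and take the mean. By \<open>ito_duality\<close> the stochastic integral turns into
  a time integral with the simple kernel in place of the diagonal entry of \<open>B\<close>; the difference of the two is the
  last term.
\<close>

lemma weighted_equation:
  assumes t: "0 \<le> t" "t \<le> s" and s: "solves_at s"
    and D: "exponential_density M W t T k \<tau> \<xi> K"
    and \<zeta>: "\<zeta> \<in> borel_measurable (F t)" "square_integrable M \<zeta>" "\<And>\<omega>. 0 \<le> \<zeta> \<omega>"
  defines "\<eta> \<equiv> \<lambda>\<omega>. \<zeta> \<omega> * exponential_density.density_upto W k \<tau> \<xi> T \<omega>"
  shows "(\<integral>\<omega>. \<eta> \<omega> * Y s \<omega> $ i \<partial>M) + K * (\<integral>r. (\<integral>\<omega>. \<eta> \<omega> * Y r \<omega> $ i \<partial>M) \<partial>Leb s T)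
    = ((\<integral>\<omega>. \<eta> \<omega> * \<psi> s \<omega> $ i \<partial>M) + (\<integral>r. weighted \<eta> (\<lambda>y. max y 0) i s r \<partial>Leb s T))
      - (\<integral>r. weighted \<eta> (\<lambda>y. max (- y) 0) i s r \<partial>Leb s T)
      + (\<integral>(r, \<omega>). \<eta> \<omega> * ((B r \<omega> $ i $ i - simple_value k \<tau> \<xi> r \<omega>) * Z s r \<omega> $ i) \<partial>(LebM s T))"
proof -
  interpret D: exponential_density M W t T k \<tau> \<xi> K by (rule D)
  interpret P: pair_sigma_finite "Leb s T" M by (rule pair_Leb)
  have s_range: "s \<in> {0..T}" using s by (simp add: solves_at_def)
  have \<eta>: "square_integrable M \<eta>" unfolding \<eta>_def using D.a_le_b \<zeta> by (intro D.square_integrable_density) auto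
  have \<eta>_nonneg: "0 \<le> \<eta> \<omega>" for \<omega> unfolding \<eta>_def using \<zeta>(3) D.density_pos[of T \<omega>] by simp
  have \<eta>_meas: "\<eta> \<in> borel_measurable M" using \<eta> by (simp add: square_integrable_def)
  obtain J where J: "has_ito_integral M F W s T (\<lambda>r \<omega>. Z s r \<omega> $ i) J"
    and eq: "AE \<omega> in M. Y s \<omega> $ i = \<psi> s \<omega> $ i + (\<integral>r. integrand s i r \<omega> \<partial>Leb s T) - J \<omega>"
    using component_equation[OF s] by blast
  note sqZ = square_integrable_Z(1)[OF s, of i]
  note ito = D.ito_duality[OF t(2) _ J sqZ \<zeta>(1,2)]
  have sT: "s \<le> T" using s_range by simp
  let ?N = "LebM s T"
  let ?pos = "\<lambda>(r, \<omega>). \<Sum>j\<in>UNIV. A_plus s r \<omega> i j * max (Y r \<omega> $ j) 0"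
  let ?neg = "\<lambda>(r, \<omega>). \<Sum>j\<in>UNIV. A_plus s r \<omega> i j * max (- Y r \<omega> $ j) 0"
  let ?BZ = "\<lambda>(r, \<omega>). B r \<omega> $ i $ i * Z s r \<omega> $ i"
  let ?kZ = "\<lambda>(r, \<omega>). simple_value k \<tau> \<xi> r \<omega> * Z s r \<omega> $ i"
  let ?Y = "\<lambda>(r, \<omega>). Y r \<omega> $ i"
  have sq_pos: "square_integrable ?N ?pos"
    using square_integrable_A_plus_sum[OF s_range, of "\<lambda>y. max y 0" i] by auto
  have sq_neg: "square_integrable ?N ?neg"
    using square_integrable_A_plus_sum[OF s_range, of "\<lambda>y. max (- y) 0" i] by auto
  have sq_BZ: "square_integrable ?N ?BZ"
    using square_integrable_B_mult[OF _ sqZ] s_range by auto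
  have sq_kZ: "square_integrable ?N ?kZ" by (rule D.square_integrable_kern_mult[OF sqZ])
  have sq_Y: "square_integrable ?N ?Y" using square_integrable_Y s_range by auto
  have split: "integrand s i r \<omega> = ?pos (r, \<omega>) - ?neg (r, \<omega>) - K * ?Y (r, \<omega>) + ?BZ (r, \<omega>)" for r \<omega>
    unfolding integrand_def prod.case sum_subtractf[symmetric]
    by (simp add: right_diff_distrib[symmetric]) (intro sum.cong refl arg_cong2[where f="(*)"], auto)
  have sq_int: "square_integrable ?N (\<lambda>(r, \<omega>). integrand s i r \<omega>)"
    using square_integrable_add[OF square_integrable_diff[OF square_integrable_diff[OF sq_pos sq_neg] square_integrable_cmult[OF sq_Y, of K]] sq_BZ]
    unfolding split by (simp add: case_prod_unfold)
  have i: "integrable ?N (\<lambda>z. \<eta> (snd z) * g z)" if "square_integrable ?N g" for g :: "real \<times> 'w \<Rightarrow> real"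
    using integral_mult_Leb(1)[OF \<eta>, of s T "\<lambda>r \<omega>. g (r, \<omega>)"] that by (simp add: case_prod_unfold)
  have "(\<integral>\<omega>. \<eta> \<omega> * Y s \<omega> $ i \<partial>M) = (\<integral>\<omega>. \<eta> \<omega> * \<psi> s \<omega> $ i + \<eta> \<omega> * (\<integral>r. integrand s i r \<omega> \<partial>Leb s T) - \<eta> \<omega> * J \<omega> \<partial>M)"
  proof (rule integral_cong_AE)
    show "(\<lambda>\<omega>. \<eta> \<omega> * Y s \<omega> $ i) \<in> borel_measurable M"
      by (rule borel_measurable_times[OF \<eta>_meas measurable_Y[OF s_range]])
    show "(\<lambda>\<omega>. \<eta> \<omega> * \<psi> s \<omega> $ i + \<eta> \<omega> * (\<integral>r. integrand s i r \<omega> \<partial>Leb s T) - \<eta> \<omega> * J \<omega>) \<in> borel_measurable M"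
      using square_integrable_mult[OF \<eta> square_integrable_\<psi>[OF s_range, of i]] integral_mult_Leb(2)[OF \<eta> sq_int] square_integrable_mult[OF \<eta> ito(1)[OF sT]]
      by (intro borel_measurable_diff borel_measurable_add) auto
    show "AE \<omega> in M. \<eta> \<omega> * Y s \<omega> $ i = \<eta> \<omega> * \<psi> s \<omega> $ i + \<eta> \<omega> * (\<integral>r. integrand s i r \<omega> \<partial>Leb s T) - \<eta> \<omega> * J \<omega>"
      using eq by eventually_elim (simp only: distrib_left right_diff_distrib)
  qed
  also have "\<dots> = (\<integral>\<omega>. \<eta> \<omega> * \<psi> s \<omega> $ i \<partial>M) + (\<integral>\<omega>. \<eta> \<omega> * (\<integral>r. integrand s i r \<omega> \<partial>Leb s T) \<partial>M) - (\<integral>\<omega>. \<eta> \<omega> * J \<omega> \<partial>M)"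
    using square_integrable_mult[OF \<eta> square_integrable_\<psi>[OF s_range, of i]] integral_mult_Leb(2)[OF \<eta> sq_int] square_integrable_mult[OF \<eta> ito(1)[OF sT]]
    by simp
  also have "(\<integral>\<omega>. \<eta> \<omega> * J \<omega> \<partial>M) = (\<integral>z. \<eta> (snd z) * ?kZ z \<partial>?N)"
    using ito(2)[OF sT] by (simp add: \<eta>_def case_prod_unfold)
  also have "(\<integral>\<omega>. \<eta> \<omega> * (\<integral>r. integrand s i r \<omega> \<partial>Leb s T) \<partial>M) = (\<integral>z. \<eta> (snd z) * (?pos z - ?neg z - K * ?Y z + ?BZ z) \<partial>?N)"
    using integral_mult_Leb(3)[OF \<eta> sq_int] by (simp add: split case_prod_unfold)
  also have "(\<integral>z. \<eta> (snd z) * (?pos z - ?neg z - K * ?Y z + ?BZ z) \<partial>?N)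
    = (\<integral>z. \<eta> (snd z) * ?pos z \<partial>?N) - (\<integral>z. \<eta> (snd z) * ?neg z \<partial>?N) - K * (\<integral>z. \<eta> (snd z) * ?Y z \<partial>?N) + (\<integral>z. \<eta> (snd z) * ?BZ z \<partial>?N)"
  proof -
    have "(\<lambda>z. \<eta> (snd z) * (?pos z - ?neg z - K * ?Y z + ?BZ z)) = (\<lambda>z. \<eta> (snd z) * ?pos z - \<eta> (snd z) * ?neg z - K * (\<eta> (snd z) * ?Y z) + \<eta> (snd z) * ?BZ z)"
      by (rule ext) (simp only: algebra_simps)
    then show ?thesis
      using i[OF sq_pos] i[OF sq_neg] i[OF sq_Y] i[OF sq_BZ]
      by (simp only: Bochner_Integration.integral_add Bochner_Integration.integral_diff Bochner_Integration.integrable_diff integrable_mult_right integral_mult_right_zero)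
  qed
  also have "(\<integral>z. \<eta> (snd z) * ?pos z \<partial>?N) = (\<integral>r. weighted \<eta> (\<lambda>y. max y 0) i s r \<partial>Leb s T)"
    using weighted_integrable(3)[OF \<eta> \<eta>_nonneg _ _ _ s_range, of "\<lambda>y. max y 0" i] by (simp add: case_prod_unfold)
  also have "(\<integral>z. \<eta> (snd z) * ?neg z \<partial>?N) = (\<integral>r. weighted \<eta> (\<lambda>y. max (- y) 0) i s r \<partial>Leb s T)"
    using weighted_integrable(3)[OF \<eta> \<eta>_nonneg _ _ _ s_range, of "\<lambda>y. max (- y) 0" i] by (simp add: case_prod_unfold)
  also have "(\<integral>z. \<eta> (snd z) * ?Y z \<partial>?N) = (\<integral>r. (\<integral>\<omega>. \<eta> \<omega> * Y r \<omega> $ i \<partial>M) \<partial>Leb s T)"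
    using P.integral_fst'[OF i[OF sq_Y]] by (simp add: case_prod_unfold)
  finally have main: "(\<integral>\<omega>. \<eta> \<omega> * Y s \<omega> $ i \<partial>M) + K * (\<integral>r. (\<integral>\<omega>. \<eta> \<omega> * Y r \<omega> $ i \<partial>M) \<partial>Leb s T)
    = ((\<integral>\<omega>. \<eta> \<omega> * \<psi> s \<omega> $ i \<partial>M) + (\<integral>r. weighted \<eta> (\<lambda>y. max y 0) i s r \<partial>Leb s T))
      - (\<integral>r. weighted \<eta> (\<lambda>y. max (- y) 0) i s r \<partial>Leb s T)
      + ((\<integral>z. \<eta> (snd z) * ?BZ z \<partial>?N) - (\<integral>z. \<eta> (snd z) * ?kZ z \<partial>?N))" by simp
  have "(\<integral>z. \<eta> (snd z) * ?BZ z \<partial>?N) - (\<integral>z. \<eta> (snd z) * ?kZ z \<partial>?N)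
    = (\<integral>(r, \<omega>). \<eta> \<omega> * ((B r \<omega> $ i $ i - simple_value k \<tau> \<xi> r \<omega>) * Z s r \<omega> $ i) \<partial>?N)"
    using i[OF sq_BZ] i[OF sq_kZ]
    by (subst Bochner_Integration.integral_diff[symmetric]) (auto simp: case_prod_unfold algebra_simps)
  then show ?thesis using main by simp
qed

end

section \<open>Estimate of the negative part\<close>

lemma (in brownian_space) prog_measurable_on_component_restrict:
  fixes X :: "real \<Rightarrow> 'w \<Rightarrow> real ^ 'c ^ 'd"
  assumes X: "prog_measurable_on F a b X" and t: "a \<le> t"
  shows "prog_measurable_on F t b (\<lambda>r \<omega>. X r \<omega> $ i $ j)"
  unfolding prog_measurable_on_def
proof
  fix u assume u: "u \<in> {t..b}"
  then have meas: "(\<lambda>(r, \<omega>). X r \<omega>) \<in> borel_measurable (restrict_space borel {a..u} \<Otimes>\<^sub>M F u)"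
    using X t by (auto simp: prog_measurable_on_def)
  have "(\<lambda>z. (fst z, snd z)) \<in> measurable (restrict_space borel {t..u} \<Otimes>\<^sub>M F u) (restrict_space borel {a..u} \<Otimes>\<^sub>M F u)"
  proof (intro measurable_Pair measurable_compose[OF measurable_fst] measurable_snd)
    show "(\<lambda>x. x) \<in> measurable (restrict_space borel {t..u}) (restrict_space borel {a..u})"
      using t by (intro measurable_restrict_space2 measurable_restrict_space1) (auto simp: space_restrict_space)
  qed
  from measurable_compose[OF this meas]
  have "(\<lambda>z. X (fst z) (snd z)) \<in> borel_measurable (restrict_space borel {t..u} \<Otimes>\<^sub>M F u)"
    by (simp add: case_prod_unfold)
  then show "(\<lambda>(r, \<omega>). X r \<omega> $ i $ j) \<in> borel_measurable (restrict_space borel {t..u} \<Otimes>\<^sub>M F u)"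
    unfolding case_prod_unfold by (intro borel_measurable_component)
qed

context linear_bsvie
begin

definition neg_sq :: "real \<Rightarrow> 'w \<Rightarrow> real" where
  "neg_sq r \<omega> = (\<Sum>j\<in>UNIV. (max (- Y r \<omega> $ j) 0)\<^sup>2)"

lemma A_plus_neg_sum_le:
  assumes "0 \<le> s" "s \<le> r" "r \<le> T" "\<omega> \<in> space M"
  shows "(\<Sum>j\<in>UNIV. A_plus s r \<omega> i j * max (- Y r \<omega> $ j) 0)\<^sup>2 \<le> 4 * K\<^sup>2 * real CARD('n) * neg_sq r \<omega>"
proof -
  have "\<bar>\<Sum>j\<in>UNIV. A_plus s r \<omega> i j * max (- Y r \<omega> $ j) 0\<bar> \<le> (\<Sum>j\<in>UNIV. 2 * K * max (- Y r \<omega> $ j) 0)"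
  proof (rule order_trans[OF sum_abs sum_mono])
    fix j
    have "\<bar>A_plus s r \<omega> i j * max (- Y r \<omega> $ j) 0\<bar> = \<bar>A_plus s r \<omega> i j\<bar> * max (- Y r \<omega> $ j) 0" by (simp add: abs_mult)
    also have "\<dots> \<le> 2 * K * max (- Y r \<omega> $ j) 0" using A_plus_bounded[OF assms] by (intro mult_right_mono) auto
    finally show "\<bar>A_plus s r \<omega> i j * max (- Y r \<omega> $ j) 0\<bar> \<le> 2 * K * max (- Y r \<omega> $ j) 0" .
  qed
  then have "(\<Sum>j\<in>UNIV. A_plus s r \<omega> i j * max (- Y r \<omega> $ j) 0)\<^sup>2 \<le> (\<Sum>j\<in>UNIV. 2 * K * max (- Y r \<omega> $ j) 0)\<^sup>2"
    by (intro abs_le_square_iff[THEN iffD1] order_trans[OF _ abs_ge_self])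
  also have "\<dots> \<le> (\<Sum>j\<in>UNIV. (2 * K * max (- Y r \<omega> $ j) 0)\<^sup>2) * real CARD('n)"
    by (rule sum_squared_le_sum_of_squares)
  also have "\<dots> = 4 * K\<^sup>2 * real CARD('n) * neg_sq r \<omega>"
    unfolding neg_sq_def power_mult_distrib sum_distrib_left[symmetric] by simp
  finally show ?thesis .
qed

lemma neg_sq_integrable: "0 \<le> t \<Longrightarrow> integrable (LebM t T) (\<lambda>(r, \<omega>). neg_sq r \<omega>)"
proof -
  assume t: "0 \<le> t"
  have "square_integrable (LebM t T) (\<lambda>z. max (- Y (fst z) (snd z) $ j) 0)" for j
  proof (rule square_integrable_dominated)
    show sq: "square_integrable (LebM t T) (\<lambda>z. Y (fst z) (snd z) $ j)"
      using square_integrable_Y[OF t] by (simp add: case_prod_unfold)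
    then show "(\<lambda>z. max (- Y (fst z) (snd z) $ j) 0) \<in> borel_measurable (LebM t T)"
      by (intro borel_measurable_max borel_measurable_uminus) (auto simp: square_integrable_def)
  qed auto
  then show ?thesis unfolding neg_sq_def case_prod_unfold by (intro Bochner_Integration.integrable_sum) (simp add: square_integrable_def)
qed

text \<open>
  The mean square of what remains when a simple kernel replaces the diagonal entry of \<open>B\<close>.
\<close>

definition kernel_error :: "nat \<Rightarrow> (nat \<Rightarrow> real) \<Rightarrow> (nat \<Rightarrow> 'w \<Rightarrow> real) \<Rightarrow> 'n \<Rightarrow> real \<Rightarrow> real" where
  "kernel_error k \<tau> \<xi> i s = (\<integral>z. (case z of (r, \<omega>) \<Rightarrow>
     (B r \<omega> $ i $ i - simple_value k \<tau> \<xi> r \<omega>) * Z s r \<omega> $ i)\<^sup>2 \<partial>(LebM s T))"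

text \<open>
  The function \<open>y(s) = E[\<eta> Y\<^sub>i(s)]\<close>, where \<open>\<eta>\<close> is the negative part of \<open>Y\<^sub>i(t)\<close> times the density started at
  \<open>t\<close>, satisfies a scalar Volterra equation with error \<open>e\<close> by \<open>weighted_equation\<close>, so
  \<open>resolvent_lower_bound\<close> applies. At \<open>s = t\<close> the density drops out by its martingale property, and
  \<open>y(t) = - z2\<close>. The constant \<open>c\<close> bounds the norm of \<open>\<eta>\<close> on the product space.
\<close>

lemma perturbed_estimate:
  assumes t: "0 \<le> t" "t < T" and solves: "solves_at t" and sqY: "square_integrable M (\<lambda>\<omega>. Y t \<omega> $ i)"
    and D: "exponential_density M W t T k \<tau> \<xi> K"
  defines "z2 \<equiv> (\<integral>\<omega>. (max (- Y t \<omega> $ i) 0)\<^sup>2 \<partial>M)"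
  defines "c \<equiv> sqrt (T * (exp (K\<^sup>2 * T) * z2))"
  shows "\<exists>e. integrable (Leb t T) e \<and>
    (\<forall>s. t \<le> s \<longrightarrow> solves_at s \<longrightarrow> \<bar>e s\<bar> \<le> c * sqrt (kernel_error k \<tau> \<xi> i s)) \<and>
    z2 \<le> c * sqrt (4 * K\<^sup>2 * real CARD('n) * (\<integral>(r, \<omega>). neg_sq r \<omega> \<partial>(LebM t T)))
      + \<bar>e t\<bar> + K * (\<integral>s. \<bar>e s\<bar> \<partial>Leb t T)"
proof -
  interpret D: exponential_density M W t T k \<tau> \<xi> K by (rule D)
  interpret P: pair_sigma_finite "Leb t T" M by (rule pair_Leb)
  define \<zeta> where "\<zeta> \<omega> = max (- Y t \<omega> $ i) 0" for \<omega>
  define \<eta> where "\<eta> = (\<lambda>\<omega>. \<zeta> \<omega> * D.density_upto T \<omega>)"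
  have t_range: "t \<in> {0..T}" using t by simp
  have \<zeta>_F: "\<zeta> \<in> borel_measurable (F t)"
    unfolding \<zeta>_def[abs_def] using Y_adapted[OF t_range] by (intro borel_measurable_max borel_measurable_uminus) auto
  have \<zeta>_nonneg: "0 \<le> \<zeta> \<omega>" for \<omega> by (simp add: \<zeta>_def)
  have \<zeta>_sq: "square_integrable M \<zeta>"
    by (rule square_integrable_dominated[OF sqY measurable_F_M[OF \<zeta>_F]]) (auto simp: \<zeta>_def)
  have \<eta>: "square_integrable M \<eta>" unfolding \<eta>_def using t by (intro D.square_integrable_density(1) \<zeta>_F \<zeta>_sq) auto
  have \<eta>_nonneg: "0 \<le> \<eta> \<omega>" for \<omega> unfolding \<eta>_def using \<zeta>_nonneg D.density_pos[of T \<omega>] by simp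
  have z2: "z2 = (\<integral>\<omega>. (\<zeta> \<omega>)\<^sup>2 \<partial>M)" by (simp add: z2_def \<zeta>_def)
  then have z2_nonneg: "0 \<le> z2" by simp
  have c_bound: "sqrt ((T - s) * (\<integral>\<omega>. (\<eta> \<omega>)\<^sup>2 \<partial>M)) \<le> c" if s: "t \<le> s" "s \<le> T" for s
  proof -
    have "(\<integral>\<omega>. (\<eta> \<omega>)\<^sup>2 \<partial>M) \<le> exp (K\<^sup>2 * (T - t)) * z2"
      unfolding \<eta>_def z2 using t by (intro D.square_integrable_density(2) \<zeta>_F \<zeta>_sq) auto
    also have "\<dots> \<le> exp (K\<^sup>2 * T) * z2"
      using t z2_nonneg by (intro mult_right_mono) (auto intro!: mult_left_mono)
    finally have "(T - s) * (\<integral>\<omega>. (\<eta> \<omega>)\<^sup>2 \<partial>M) \<le> T * (exp (K\<^sup>2 * T) * z2)"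
      using s t by (intro mult_mono) auto
    then show ?thesis unfolding c_def by (rule real_sqrt_le_mono)
  qed
  define y where "y s = (\<integral>\<omega>. \<eta> \<omega> * Y s \<omega> $ i \<partial>M)" for s
  define p where "p s = (\<integral>\<omega>. \<eta> \<omega> * \<psi> s \<omega> $ i \<partial>M) + (\<integral>r. weighted \<eta> (\<lambda>y. max y 0) i s r \<partial>Leb s T)" for s
  define n where "n s = (\<integral>r. weighted \<eta> (\<lambda>y. max (- y) 0) i s r \<partial>Leb s T)" for s
  \<comment> \<open>a definition for all \<open>s\<close>, so that \<open>e\<close> is measurable; it is the error term at the times where the equation holds\<close>
  define e where "e s = y s + K * (\<integral>r. indicator {s..} r * y r \<partial>Leb t T) - p s + n s" for s
  have pm[measurable]: "(\<lambda>y::real. max y 0) \<in> borel_measurable borel" "(\<lambda>y::real. max (- y) 0) \<in> borel_measurable borel"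
    by measurable
  have y_int: "integrable (Leb t T) y"
    using P.integrable_fst'[OF integral_mult_Leb(1)[OF \<eta> square_integrable_Y[OF t(1)], of i]] by (simp add: y_def[abs_def])
  have p_anti: "p s' \<le> p s" if "t \<le> s" "s \<le> s'" "s' \<le> T" for s s'
    unfolding p_def using that t
    by (intro add_mono \<psi>_weighted_antimono(1)[OF \<eta> \<eta>_nonneg] weighted_tail_antimono[OF \<eta> \<eta>_nonneg pm(1)]) auto
  have p_nonneg: "0 \<le> p s" if "s \<in> {t..T}" for s
    unfolding p_def using that t
    by (intro add_nonneg_nonneg \<psi>_weighted_antimono(2)[OF \<eta> \<eta>_nonneg, of s] weighted_tail_nonneg[OF \<eta> \<eta>_nonneg pm(1)]) auto
  have n_anti: "n s' \<le> n s" if "t \<le> s" "s \<le> s'" "s' \<le> T" for s s'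
    unfolding n_def using that t by (intro weighted_tail_antimono[OF \<eta> \<eta>_nonneg pm(2)]) auto
  have n_nonneg: "0 \<le> n s" if "s \<in> {t..T}" for s
    unfolding n_def using that t by (intro weighted_tail_nonneg[OF \<eta> \<eta>_nonneg pm(2)]) auto
  have e_int: "integrable (Leb t T) e"
    unfolding e_def[abs_def]
    using y_int integrable_tail_integral[OF y_int] antimono_bounded_integrable[OF p_anti p_nonneg] antimono_bounded_integrable[OF n_anti n_nonneg]
    by (intro Bochner_Integration.integrable_add Bochner_Integration.integrable_diff integrable_mult_right) auto
  have e_bound: "\<bar>e s\<bar> \<le> c * sqrt (kernel_error k \<tau> \<xi> i s)"
    if s: "t \<le> s" "solves_at s" for s
  proof -
    have sT: "s \<le> T" and s0: "0 \<le> s" using s t by (auto simp: solves_at_def)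
    let ?f = "\<lambda>r \<omega>. (B r \<omega> $ i $ i - simple_value k \<tau> \<xi> r \<omega>) * Z s r \<omega> $ i"
    note sqZ = square_integrable_Z(1)[OF s(2), of i]
    have sqf: "square_integrable (LebM s T) (\<lambda>(r, \<omega>). ?f r \<omega>)"
      using square_integrable_diff[OF square_integrable_B_mult[OF s0 sqZ, of i i] D.square_integrable_kern_mult[OF sqZ]]
      by (simp add: case_prod_unfold left_diff_distrib)
    have "e s = (\<integral>(r, \<omega>). \<eta> \<omega> * ?f r \<omega> \<partial>(LebM s T))"
      using weighted_equation[OF t(1) s D \<zeta>_F \<zeta>_sq \<zeta>_nonneg, of i]
      unfolding e_def y_def p_def n_def integral_Leb_subinterval[OF s(1), symmetric] \<eta>_def by linarith
    then have "\<bar>e s\<bar> \<le> sqrt ((T - s) * (\<integral>\<omega>. (\<eta> \<omega>)\<^sup>2 \<partial>M)) * sqrt (\<integral>z. (case z of (r, \<omega>) \<Rightarrow> ?f r \<omega>)\<^sup>2 \<partial>(LebM s T))"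
      using integral_mult_Leb(4)[OF \<eta> sqf sT] by simp
    also have "\<dots> \<le> c * sqrt (\<integral>z. (case z of (r, \<omega>) \<Rightarrow> ?f r \<omega>)\<^sup>2 \<partial>(LebM s T))"
      using c_bound[OF s(1) sT] by (intro mult_right_mono) auto
    finally show ?thesis unfolding kernel_error_def .
  qed
  have tail_t: "(\<integral>r. indicator {t..} r * y r \<partial>Leb t T) = (\<integral>r. y r \<partial>Leb t T)"
    by (intro Bochner_Integration.integral_cong) (auto simp: space_restrict_space)
  have lower: "- n t - \<bar>e t\<bar> - K * (\<integral>s. \<bar>e s\<bar> \<partial>Leb t T) \<le> y t"
  proof (rule resolvent_lower_bound[OF _ K_nonneg y_int e_int p_anti p_nonneg n_anti n_nonneg])
    show "AE s in Leb t T. y s + K * (\<integral>r. indicator {s..} r * y r \<partial>Leb t T) = p s - n s + e s"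
      by (simp add: e_def)
    show "y t + K * (\<integral>r. y r \<partial>Leb t T) = p t - n t + e t"
      by (simp add: e_def tail_t)
  qed (use t in auto)
  have y_t: "y t = - z2"
  proof -
    have X: "(\<lambda>\<omega>. \<zeta> \<omega> * Y t \<omega> $ i) \<in> borel_measurable (F t)"
      by (rule borel_measurable_times[OF \<zeta>_F Y_adapted[OF t_range]])
    have "integrable M (\<lambda>\<omega>. \<zeta> \<omega> * Y t \<omega> $ i * D.density_upto t \<omega>)"
      using square_integrable_mult[OF \<zeta>_sq sqY] by (simp add: D.density_start)
    from D.integral_density(2)[OF _ _ _ X this, of T] t
    have "(\<integral>\<omega>. \<zeta> \<omega> * Y t \<omega> $ i * D.density_upto T \<omega> \<partial>M) = (\<integral>\<omega>. \<zeta> \<omega> * Y t \<omega> $ i \<partial>M)"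
      by (simp add: D.density_start)
    also have "\<dots> = (\<integral>\<omega>. - (\<zeta> \<omega>)\<^sup>2 \<partial>M)"
      by (intro Bochner_Integration.integral_cong refl) (auto simp: \<zeta>_def max_def power2_eq_square)
    finally show ?thesis by (simp add: y_def \<eta>_def z2 mult_ac)
  qed
  have n_t: "n t \<le> c * sqrt (4 * K\<^sup>2 * real CARD('n) * (\<integral>(r, \<omega>). neg_sq r \<omega> \<partial>(LebM t T)))"
  proof -
    let ?g = "\<lambda>r \<omega>. \<Sum>j\<in>UNIV. A_plus t r \<omega> i j * max (- Y r \<omega> $ j) 0"
    have sqg: "square_integrable (LebM t T) (\<lambda>(r, \<omega>). ?g r \<omega>)"
      using square_integrable_A_plus_sum[OF t_range pm(2), of i] by auto
    have "n t = (\<integral>(r, \<omega>). \<eta> \<omega> * ?g r \<omega> \<partial>(LebM t T))"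
      unfolding n_def by (rule weighted_integrable(3)[OF \<eta> \<eta>_nonneg pm(2) _ _ t_range]) auto
    also have "\<dots> \<le> sqrt ((T - t) * (\<integral>\<omega>. (\<eta> \<omega>)\<^sup>2 \<partial>M)) * sqrt (\<integral>z. (case z of (r, \<omega>) \<Rightarrow> ?g r \<omega>)\<^sup>2 \<partial>(LebM t T))"
      using integral_mult_Leb(4)[OF \<eta> sqg less_imp_le[OF t(2)]] by (rule order_trans[OF abs_ge_self])
    also have "\<dots> \<le> c * sqrt (4 * K\<^sup>2 * real CARD('n) * (\<integral>(r, \<omega>). neg_sq r \<omega> \<partial>(LebM t T)))"
    proof (rule mult_mono[OF c_bound])
      have "(\<integral>z. (case z of (r, \<omega>) \<Rightarrow> ?g r \<omega>)\<^sup>2 \<partial>(LebM t T))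
        \<le> (\<integral>z. 4 * K\<^sup>2 * real CARD('n) * (case z of (r, \<omega>) \<Rightarrow> neg_sq r \<omega>) \<partial>(LebM t T))"
      proof (rule integral_mono)
        show "integrable (LebM t T) (\<lambda>z. (case z of (r, \<omega>) \<Rightarrow> ?g r \<omega>)\<^sup>2)" using sqg by (simp add: square_integrable_def)
        show "integrable (LebM t T) (\<lambda>z. 4 * K\<^sup>2 * real CARD('n) * (case z of (r, \<omega>) \<Rightarrow> neg_sq r \<omega>))"
          by (intro integrable_mult_right neg_sq_integrable t(1))
        fix z assume "z \<in> space (LebM t T)"
        then show "(case z of (r, \<omega>) \<Rightarrow> ?g r \<omega>)\<^sup>2 \<le> 4 * K\<^sup>2 * real CARD('n) * (case z of (r, \<omega>) \<Rightarrow> neg_sq r \<omega>)"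
          using A_plus_neg_sum_le[OF t(1)] by (auto simp: space_pair_measure space_restrict_space)
      qed
      then show "sqrt (\<integral>z. (case z of (r, \<omega>) \<Rightarrow> ?g r \<omega>)\<^sup>2 \<partial>(LebM t T)) \<le> sqrt (4 * K\<^sup>2 * real CARD('n) * (\<integral>(r, \<omega>). neg_sq r \<omega> \<partial>(LebM t T)))"
        by (intro real_sqrt_le_mono) simp
      show "0 \<le> c" unfolding c_def using T_pos z2_nonneg by simp
    qed (use t in auto)
    finally show ?thesis .
  qed
  have final: "z2 \<le> c * sqrt (4 * K\<^sup>2 * real CARD('n) * (\<integral>(r, \<omega>). neg_sq r \<omega> \<partial>(LebM t T)))
      + \<bar>e t\<bar> + K * (\<integral>s. \<bar>e s\<bar> \<partial>Leb t T)"
    using lower y_t n_t by linarith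
  show ?thesis using e_int e_bound final by blast
qed

text \<open>
  Dominated convergence: both the diagonal entry of \<open>B\<close> and the simple kernels are bounded by \<open>K\<close>.
\<close>

lemma perturbation_tendsto_0:
  assumes t: "0 \<le> t" "t \<le> s" and s: "solves_at s"
    and D: "\<And>m. exponential_density M W t T (k m) (\<tau> m) (\<xi> m) K"
    and lim: "AE (r, \<omega>) in LebM t T. (\<lambda>m. simple_value (k m) (\<tau> m) (\<xi> m) r \<omega>) \<longlonglongrightarrow> B r \<omega> $ i $ i"
  shows "(\<lambda>m. kernel_error (k m) (\<tau> m) (\<xi> m) i s) \<longlonglongrightarrow> 0"
    and "kernel_error (k m) (\<tau> m) (\<xi> m) i s \<le> 4 * K\<^sup>2 * enn2real (Z_norm s)"
proof -
  interpret Pt: pair_sigma_finite "Leb t T" M by (rule pair_Leb)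
  interpret P: pair_sigma_finite "Leb s T" M by (rule pair_Leb)
  let ?N = "LebM s T"
  let ?v = "\<lambda>m z. simple_value (k m) (\<tau> m) (\<xi> m) (fst z) (snd z)"
  let ?b = "\<lambda>z. B (fst z) (snd z) $ i $ i"
  let ?z = "\<lambda>z. Z s (fst z) (snd z) $ i"
  have s_range: "s \<in> {0..T}" using s by (simp add: solves_at_def)
  have v_meas[measurable]: "?v m \<in> borel_measurable ?N" for m
    using exponential_density.kern_measurable[OF D] by (simp add: case_prod_unfold)
  have b_meas[measurable]: "?b \<in> borel_measurable ?N"
    using B_measurable[of s i i] s_range by (simp add: case_prod_unfold)
  have z_sq: "square_integrable ?N ?z" using square_integrable_Z(1)[OF s, of i] by (simp add: case_prod_unfold)
  then have z_meas[measurable]: "?z \<in> borel_measurable ?N" by (simp add: square_integrable_def)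
  have dom: "integrable ?N (\<lambda>z. 4 * K\<^sup>2 * (?z z)\<^sup>2)" using z_sq by (simp add: square_integrable_def)
  have conv: "AE z in ?N. (\<lambda>m. ?v m z) \<longlonglongrightarrow> ?b z"
  proof (rule P.AE_pair_measure)
    have "Measurable.pred ?N (\<lambda>z. (\<lambda>m. ?v m z) \<longlonglongrightarrow> ?b z)" by (rule measurable_limit2) measurable
    then show "{z \<in> space ?N. (\<lambda>m. ?v m z) \<longlonglongrightarrow> ?b z} \<in> sets ?N" by (rule predE)
    have "AE r in Leb t T. AE \<omega> in M. (\<lambda>m. ?v m (r, \<omega>)) \<longlonglongrightarrow> ?b (r, \<omega>)"
      using Pt.AE_pair[OF lim] by simp
    then show "AE r in Leb s T. AE \<omega> in M. (\<lambda>m. ?v m (r, \<omega>)) \<longlonglongrightarrow> ?b (r, \<omega>)"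
      by (rule AE_Leb_mono[OF _ t(2) order_refl])
  qed
  have bound: "((?b z - ?v m z) * ?z z)\<^sup>2 \<le> 4 * K\<^sup>2 * (?z z)\<^sup>2" if "z \<in> space ?N" for z m
  proof -
    have z: "fst z \<in> {0..T}" "snd z \<in> space M" using that s_range by (auto simp: space_pair_measure space_restrict_space)
    have "\<bar>?b z\<bar> \<le> K" using order_trans[OF abs_matrix_component_le B_bounded[OF z]] .
    moreover have "\<bar>?v m z\<bar> \<le> K" using exponential_density.kern_bounded[OF D z(2), of m "fst z"] K_nonneg by simp
    ultimately have "\<bar>?b z - ?v m z\<bar> \<le> \<bar>2 * K\<bar>" by linarith
    then have "(?b z - ?v m z)\<^sup>2 \<le> (2 * K)\<^sup>2" by (rule abs_le_square_iff[THEN iffD1])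
    then have "(?b z - ?v m z)\<^sup>2 * (?z z)\<^sup>2 \<le> (2 * K)\<^sup>2 * (?z z)\<^sup>2" by (rule mult_right_mono) simp
    then show ?thesis by (simp add: power_mult_distrib)
  qed
  have "(\<lambda>m. \<integral>z. ((?b z - ?v m z) * ?z z)\<^sup>2 \<partial>?N) \<longlonglongrightarrow> integral\<^sup>L ?N (\<lambda>_. 0::real)"
  proof (rule integral_dominated_convergence[OF _ _ dom])
    show "AE z in ?N. (\<lambda>m. ((?b z - ?v m z) * ?z z)\<^sup>2) \<longlonglongrightarrow> 0"
      using conv
    proof eventually_elim
      case (elim z)
      then have "(\<lambda>m. ((?b z - ?v m z) * ?z z)\<^sup>2) \<longlonglongrightarrow> ((?b z - ?b z) * ?z z)\<^sup>2" by (intro tendsto_intros)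
      then show ?case by simp
    qed
    show "AE z in ?N. norm (((?b z - ?v m z) * ?z z)\<^sup>2) \<le> 4 * K\<^sup>2 * (?z z)\<^sup>2" for m
      using bound by (intro AE_I2) simp
  qed measurable
  then show "(\<lambda>m. kernel_error (k m) (\<tau> m) (\<xi> m) i s) \<longlonglongrightarrow> 0"
    by (simp add: kernel_error_def case_prod_unfold)
  have "(\<integral>z. ((?b z - ?v m z) * ?z z)\<^sup>2 \<partial>?N) \<le> (\<integral>z. 4 * K\<^sup>2 * (?z z)\<^sup>2 \<partial>?N)"
  proof (rule integral_mono[OF _ dom bound])
    show "integrable ?N (\<lambda>z. ((?b z - ?v m z) * ?z z)\<^sup>2)"
    proof (rule Bochner_Integration.integrable_bound[OF dom])
      show "AE z in ?N. norm (((?b z - ?v m z) * ?z z)\<^sup>2) \<le> norm (4 * K\<^sup>2 * (?z z)\<^sup>2)"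
        by (rule AE_I2) (use bound in simp)
    qed measurable
  qed
  also have "\<dots> \<le> 4 * K\<^sup>2 * enn2real (Z_norm s)"
    using square_integrable_Z(2)[OF s, of i] by (simp add: case_prod_unfold mult_left_mono)
  finally show "kernel_error (k m) (\<tau> m) (\<xi> m) i s \<le> 4 * K\<^sup>2 * enn2real (Z_norm s)"
    by (simp add: kernel_error_def case_prod_unfold)
qed

text \<open>
  Passing to the limit along simple kernels in \<open>perturbed_estimate\<close> removes the error terms, as \<open>c\<close> is the
  same for all of them. Since \<open>c\<close> is proportional to the square root of the left-hand side, that square
  root cancels.
\<close>

lemma negative_part_estimate:
  assumes t: "0 \<le> t" "t < T" and solves: "solves_at t" and sqY: "square_integrable M (\<lambda>\<omega>. Y t \<omega> $ i)"
  shows "(\<integral>\<omega>. (max (- Y t \<omega> $ i) 0)\<^sup>2 \<partial>M)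
    \<le> T * exp (K\<^sup>2 * T) * (4 * K\<^sup>2 * real CARD('n)) * (\<integral>(r, \<omega>). neg_sq r \<omega> \<partial>(LebM t T))"
proof -
  let ?z2 = "\<integral>\<omega>. (max (- Y t \<omega> $ i) 0)\<^sup>2 \<partial>M"
  let ?R = "4 * K\<^sup>2 * real CARD('n) * (\<integral>(r, \<omega>). neg_sq r \<omega> \<partial>(LebM t T))"
  define c where "c = sqrt (T * (exp (K\<^sup>2 * T) * ?z2))"
  have c_nonneg: "0 \<le> c" unfolding c_def using T_pos by simp
  obtain k \<tau> \<xi> where simple: "\<And>m::nat. simple_integrand M F t T (k m) (\<tau> m) (\<xi> m)"
    and \<xi>: "\<And>m l \<omega>. \<omega> \<in> space M \<Longrightarrow> \<bar>\<xi> m l \<omega>\<bar> \<le> K"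
    and lim: "AE (r, \<omega>) in LebM t T. (\<lambda>m. simple_value (k m) (\<tau> m) (\<xi> m) r \<omega>) \<longlonglongrightarrow> B r \<omega> $ i $ i"
  proof (rule bounded_progressive_approx[OF t prog_measurable_on_component_restrict[OF B_prog t(1)]])
    show "\<bar>B r \<omega> $ i $ i\<bar> \<le> K" if "r \<in> {t..T}" "\<omega> \<in> space M" for r \<omega>
      using order_trans[OF abs_matrix_component_le B_bounded] that t by auto
  qed (use that in blast)
  have D: "exponential_density M W t T (k m) (\<tau> m) (\<xi> m) K" for m
    by (unfold_locales) (use t simple \<xi> in auto)
  let ?err = "\<lambda>m. kernel_error (k m) (\<tau> m) (\<xi> m) i"
  have "\<forall>m. \<exists>e. integrable (Leb t T) e \<and> (\<forall>s. t \<le> s \<longrightarrow> solves_at s \<longrightarrow> \<bar>e s\<bar> \<le> c * sqrt (?err m s)) \<and>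
    ?z2 \<le> c * sqrt ?R + \<bar>e t\<bar> + K * (\<integral>s. \<bar>e s\<bar> \<partial>Leb t T)"
    using perturbed_estimate[OF t solves sqY D] unfolding c_def by blast
  then obtain e where e_int: "\<And>m. integrable (Leb t T) (e m)"
    and e_le: "\<And>m s. t \<le> s \<Longrightarrow> solves_at s \<Longrightarrow> \<bar>e m s\<bar> \<le> c * sqrt (?err m s)"
    and est: "\<And>m. ?z2 \<le> c * sqrt ?R + \<bar>e m t\<bar> + K * (\<integral>s. \<bar>e m s\<bar> \<partial>Leb t T)"
    by metis
  have e_lim: "(\<lambda>m. \<bar>e m s\<bar>) \<longlonglongrightarrow> 0" if s: "t \<le> s" "solves_at s" for s
  proof (rule tendsto_sandwich[OF _ _ tendsto_const])
    have "(\<lambda>m. c * sqrt (?err m s)) \<longlonglongrightarrow> c * sqrt 0"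
      by (intro tendsto_mult tendsto_const tendsto_real_sqrt perturbation_tendsto_0(1)[OF t(1) s D lim])
    then show "(\<lambda>m. c * sqrt (?err m s)) \<longlonglongrightarrow> 0" by simp
  qed (use e_le[OF s] in auto)
  let ?w = "\<lambda>s. c * (2 * K * (1 + enn2real (Z_norm s)))"
  have e_dom: "\<bar>e m s\<bar> \<le> ?w s" if s: "t \<le> s" "solves_at s" for m s
  proof -
    let ?x = "enn2real (Z_norm s)"
    have x: "0 \<le> ?x" by simp
    \<comment> \<open>the root of \<open>Z_norm\<close> may be replaced by an integrable bound, \<open>Z_norm\<close> itself being integrable\<close>
    have "sqrt ?x \<le> 1 + ?x"
      using x by (intro real_le_lsqrt) (auto simp: power2_eq_square algebra_simps)
    then have "sqrt (4 * K\<^sup>2 * ?x) \<le> 2 * K * (1 + ?x)"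
      using K_nonneg by (simp add: real_sqrt_mult mult_left_mono)
    moreover have "sqrt (?err m s) \<le> sqrt (4 * K\<^sup>2 * ?x)"
      by (intro real_sqrt_le_mono perturbation_tendsto_0(2)[OF t(1) s D lim])
    ultimately have "c * sqrt (?err m s) \<le> ?w s" using c_nonneg by (intro mult_left_mono) linarith+
    with e_le[OF s, of m] show ?thesis by linarith
  qed
  have solves_AE: "AE s in Leb t T. solves_at s" by (rule AE_Leb_mono[OF AE_solves_at t(1) order_refl])
  have Z_int: "integrable (Leb t T) (\<lambda>s. enn2real (Z_norm s))"
  proof -
    have "integrable (Leb 0 T) (\<lambda>s. enn2real (Z_norm s))"
    proof (rule integrableI_nonneg)
      show "(\<lambda>s. enn2real (Z_norm s)) \<in> borel_measurable (Leb 0 T)"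
        using Z_norm_measurable by measurable
      have "(\<integral>\<^sup>+s. ennreal (enn2real (Z_norm s)) \<partial>Leb 0 T) \<le> (\<integral>\<^sup>+s. Z_norm s \<partial>Leb 0 T)"
        by (intro nn_integral_mono) (simp add: ennreal_enn2real_if)
      then show "(\<integral>\<^sup>+s. ennreal (enn2real (Z_norm s)) \<partial>Leb 0 T) < \<infinity>" using Z_norm_finite by (rule le_less_trans)
    qed simp
    then show ?thesis by (rule integrable_Leb_subinterval[OF _ t(1)])
  qed
  have "(\<lambda>m. \<integral>s. \<bar>e m s\<bar> \<partial>Leb t T) \<longlonglongrightarrow> integral\<^sup>L (Leb t T) (\<lambda>_. 0::real)"
  proof (rule integral_dominated_convergence[where w = ?w])
    interpret L: finite_measure "Leb t T" by (rule finite_measure_Leb)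
    show "integrable (Leb t T) ?w" using Z_int by (intro integrable_mult_right Bochner_Integration.integrable_add L.integrable_const)
    show "AE s in Leb t T. (\<lambda>m. \<bar>e m s\<bar>) \<longlonglongrightarrow> 0"
      using solves_AE AE_space by eventually_elim (rule e_lim, auto simp: space_restrict_space)
    show "AE s in Leb t T. norm \<bar>e m s\<bar> \<le> ?w s" for m
      using solves_AE AE_space
    proof eventually_elim
      case (elim s)
      then show ?case using e_dom[of s m] by (simp add: space_restrict_space)
    qed
  qed (use e_int in auto)
  then have "(\<lambda>m. c * sqrt ?R + \<bar>e m t\<bar> + K * (\<integral>s. \<bar>e m s\<bar> \<partial>Leb t T)) \<longlonglongrightarrow> c * sqrt ?R + 0 + K * 0"
    using e_lim[OF order_refl solves] by (intro tendsto_intros) simp_all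
  then have main: "?z2 \<le> c * sqrt ?R"
    using est by (intro LIMSEQ_le_const[of _ "c * sqrt ?R" ?z2]) auto
  have z2_nonneg: "0 \<le> ?z2" by simp
  have R_nonneg: "0 \<le> ?R"
  proof -
    have "0 \<le> (\<integral>(r, \<omega>). neg_sq r \<omega> \<partial>(LebM t T))"
      by (intro Bochner_Integration.integral_nonneg) (auto simp: neg_sq_def intro!: sum_nonneg)
    then show ?thesis by simp
  qed
  have "?z2 * ?z2 \<le> (c * sqrt ?R) * (c * sqrt ?R)" using main z2_nonneg order_trans[OF z2_nonneg main] by (intro mult_mono)
  also have "\<dots> = (c * c) * (sqrt ?R * sqrt ?R)" by (simp only: mult_ac)
  also have "c * c = T * (exp (K\<^sup>2 * T) * ?z2)"
    unfolding c_def using T_pos z2_nonneg by (intro real_sqrt_mult_self[THEN trans] abs_of_nonneg mult_nonneg_nonneg) auto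
  also have "sqrt ?R * sqrt ?R = ?R" using R_nonneg by (simp only: real_sqrt_mult_self abs_of_nonneg)
  finally have sq: "?z2 * ?z2 \<le> (T * (exp (K\<^sup>2 * T) * ?R)) * ?z2" by (simp only: mult_ac)
  have RHS_nonneg: "0 \<le> T * (exp (K\<^sup>2 * T) * ?R)" 
    by (rule mult_nonneg_nonneg[OF less_imp_le[OF T_pos] mult_nonneg_nonneg[OF exp_ge_zero R_nonneg]])
  have "?z2 \<le> T * (exp (K\<^sup>2 * T) * ?R)"
  proof (cases "?z2 = 0")
    case True
    then show ?thesis using RHS_nonneg by linarith
  next
    case False
    then have "0 < ?z2" using z2_nonneg by linarith
    with sq show ?thesis by (rule mult_right_le_imp_le)
  qed
  then show ?thesis by (simp only: mult.assoc)
qed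

text \<open>
  Summing \<open>negative_part_estimate\<close> over the components, the mean square \<open>q\<close> of the negative part satisfies
  the hypothesis of \<open>backward_Gronwall\<close>. The time \<open>T\<close> is left out, because the approximating kernels live on
  a nondegenerate interval.
\<close>

lemma solution_nonneg: "AE t in Leb 0 T. AE \<omega> in M. Y t \<omega> \<ge> 0"
proof -
  interpret P: pair_sigma_finite "Leb 0 T" M by (rule pair_Leb)
  let ?C = "T * exp (K\<^sup>2 * T) * (4 * K\<^sup>2 * real CARD('n))"
  define q where "q t = (\<integral>\<^sup>+\<omega>. ennreal (neg_sq t \<omega>) \<partial>M)" for t
  have neg_sq_nonneg: "0 \<le> neg_sq r \<omega>" for r \<omega> by (simp add: neg_sq_def sum_nonneg)
  have neg_sq_meas: "(\<lambda>(r, \<omega>). neg_sq r \<omega>) \<in> borel_measurable (LebM t T)" if "0 \<le> t" for t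
    using neg_sq_integrable[OF that] by simp
  have q_meas: "q \<in> borel_measurable (Leb 0 T)"
    unfolding q_def[abs_def] using neg_sq_meas[OF order_refl]
    by (intro borel_measurable_nn_integral) (simp add: case_prod_unfold)
  have q_tail: "(\<integral>\<^sup>+r. q r \<partial>Leb t T) = ennreal (\<integral>(r, \<omega>). neg_sq r \<omega> \<partial>(LebM t T))" if t: "0 \<le> t" for t
  proof -
    have "(\<integral>\<^sup>+r. q r \<partial>Leb t T) = (\<integral>\<^sup>+z. ennreal (case z of (r, \<omega>) \<Rightarrow> neg_sq r \<omega>) \<partial>(LebM t T))"
      unfolding q_def using nn_integral_fst[of "\<lambda>z. ennreal (case z of (r, \<omega>) \<Rightarrow> neg_sq r \<omega>)" "Leb t T"] neg_sq_meas[OF t] by simp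
    also have "\<dots> = ennreal (\<integral>z. (case z of (r, \<omega>) \<Rightarrow> neg_sq r \<omega>) \<partial>(LebM t T))"
      using neg_sq_integrable[OF t] by (intro nn_integral_eq_integral) (auto simp: neg_sq_nonneg)
    finally show ?thesis by simp
  qed
  have q_sub: "(\<integral>\<^sup>+s. indicator {t..} s * q s \<partial>Leb 0 T) = (\<integral>\<^sup>+s. q s \<partial>Leb t T)" if "0 \<le> t" for t
    using that by (simp add: nn_integral_restrict_space) (intro nn_integral_cong, auto simp: indicator_def)
  have sqY: "AE t in Leb 0 T. \<forall>i\<in>UNIV. square_integrable M (\<lambda>\<omega>. Y t \<omega> $ i)"
  proof (rule AE_finite_allI[OF finite_class.finite_UNIV])
    fix i
    have "integrable (LebM 0 T) (\<lambda>z. (case z of (r, \<omega>) \<Rightarrow> Y r \<omega> $ i)\<^sup>2)"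
      using square_integrable_Y[of 0 i] by (simp add: square_integrable_def)
    from P.AE_integrable_fst'[OF this] AE_space
    show "AE t in Leb 0 T. square_integrable M (\<lambda>\<omega>. Y t \<omega> $ i)"
      by eventually_elim (auto simp: square_integrable_def space_restrict_space intro: measurable_Y)
  qed
  have "AE t in lborel. t \<noteq> T" by (rule AE_lborel_singleton)
  then have "AE t in Leb 0 T. t \<noteq> T" by (subst AE_restrict_space_iff) auto
  then have "AE t in Leb 0 T. q t \<le> ennreal (real CARD('n) * ?C) * (\<integral>\<^sup>+s. indicator {t..} s * q s \<partial>Leb 0 T)"
    using sqY AE_solves_at AE_space
  proof eventually_elim
    case (elim t)
    then have t: "0 \<le> t" "t < T" by (auto simp: space_restrict_space)
    let ?R = "\<integral>(r, \<omega>). neg_sq r \<omega> \<partial>(LebM t T)"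
    have int: "integrable M (\<lambda>\<omega>. (max (- Y t \<omega> $ j) 0)\<^sup>2)" for j
    proof -
      have "square_integrable M (\<lambda>\<omega>. max (- Y t \<omega> $ j) 0)"
      proof (rule square_integrable_dominated)
        show "square_integrable M (\<lambda>\<omega>. Y t \<omega> $ j)" using elim by blast
        show "(\<lambda>\<omega>. max (- Y t \<omega> $ j) 0) \<in> borel_measurable M"
          using measurable_Y[of t j] t by (intro borel_measurable_max borel_measurable_uminus) auto
      qed auto
      then show ?thesis by (simp add: square_integrable_def)
    qed
    have "q t = ennreal (\<integral>\<omega>. neg_sq t \<omega> \<partial>M)"
      unfolding q_def neg_sq_def using int by (intro nn_integral_eq_integral) (auto intro!: sum_nonneg)
    also have "(\<integral>\<omega>. neg_sq t \<omega> \<partial>M) = (\<Sum>j\<in>UNIV. \<integral>\<omega>. (max (- Y t \<omega> $ j) 0)\<^sup>2 \<partial>M)"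
      unfolding neg_sq_def using int by (intro Bochner_Integration.integral_sum) auto
    also have "ennreal \<dots> \<le> ennreal (\<Sum>j\<in>(UNIV :: 'n set). ?C * ?R)"
      using elim t by (intro ennreal_leI sum_mono negative_part_estimate) auto
    also have "(\<Sum>j\<in>(UNIV :: 'n set). ?C * ?R) = real CARD('n) * ?C * ?R" by simp
    also have "ennreal \<dots> = ennreal (real CARD('n) * ?C) * ennreal ?R"
      using T_pos by (intro ennreal_mult') (auto intro!: mult_nonneg_nonneg)
    finally show ?case using q_sub[OF t(1)] q_tail[OF t(1)] by simp
  qed
  then have "AE t in Leb 0 T. q t = 0"
    using q_meas T_pos q_tail[of 0] K_nonneg by (intro backward_Gronwall[of q T]) auto
  then show ?thesis
    using AE_space
  proof eventually_elim
    case (elim t)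
    then have t: "t \<in> {0..T}" by (simp add: space_restrict_space)
    have "(\<lambda>\<omega>. ennreal (neg_sq t \<omega>)) \<in> borel_measurable M"
      unfolding neg_sq_def using measurable_Y[OF t]
      by (intro measurable_compose[OF _ measurable_ennreal] borel_measurable_sum borel_measurable_power borel_measurable_max borel_measurable_uminus) auto
    then have "AE \<omega> in M. ennreal (neg_sq t \<omega>) = 0"
      using elim(1) unfolding q_def by (simp add: nn_integral_0_iff_AE)
    then show ?case
    proof eventually_elim
      case (elim \<omega>)
      then have "neg_sq t \<omega> = 0" using neg_sq_nonneg[of t \<omega>] by (simp add: ennreal_eq_0_iff)
      then have "max (- Y t \<omega> $ j) 0 = 0" for j
        unfolding neg_sq_def by (subst (asm) sum_nonneg_eq_0_iff) auto
      then have "0 \<le> Y t \<omega> $ j" for j by (metis max.cobounded1 neg_le_0_iff_le)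
      then show ?case by (simp add: less_eq_vec_def)
    qed
  qed
qed

end

section \<open>Comparison with zero\<close>

theorem theorem3p6:
  fixes M :: "'w measure" and F :: "real \<Rightarrow> 'w measure" and W :: "real \<Rightarrow> 'w \<Rightarrow> real"
    and T :: real
    and A :: "real \<Rightarrow> real \<Rightarrow> 'w \<Rightarrow> real^'n^'n" and B :: "real \<Rightarrow> 'w \<Rightarrow> real^'n^'n"
    and \<psi> Y :: "real \<Rightarrow> 'w \<Rightarrow> real^'n" and Z :: "real \<Rightarrow> real \<Rightarrow> 'w \<Rightarrow> real^'n"
  assumes "prob_space M" and "complete_measure M"
    and "standard_brownian_motion M W" and "F = augmented_filtration M W"
    and "0 < T"
    and "\<exists>K. \<forall>t s. 0 \<le> t \<and> t \<le> s \<and> s \<le> T \<longrightarrow> (\<forall>\<omega>\<in>space M. norm (A t s \<omega>) \<le> K)"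
    and "\<exists>K. \<forall>s\<in>{0..T}. \<forall>\<omega>\<in>space M. norm (B s \<omega>) \<le> K"
    and "prog_measurable_on F 0 T B"
    and "\<forall>t\<in>{0..T}. prog_measurable_on F t T (A t)"
    and "\<forall>s\<in>{0..T}. \<forall>\<omega>\<in>space M. continuous_on {0..s} (\<lambda>t. A t s \<omega>)"
    and "\<forall>t s. 0 \<le> t \<and> t \<le> s \<and> s \<le> T \<longrightarrow> (AE \<omega> in M. A t s \<omega> \<in> offdiag_nonneg_matrices)"
    and "\<forall>t \<tau> s. 0 \<le> t \<and> t \<le> \<tau> \<and> \<tau> \<le> s \<and> s \<le> T \<longrightarrow>
           (AE \<omega> in M. A t s \<omega> - A \<tau> s \<omega> \<in> nonneg_matrices)"
    and "\<forall>s\<in>{0..T}. AE \<omega> in M. B s \<omega> \<in> diagonal_matrices"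
    and "\<psi> \<in> continuous_L2_maps M (F T) T"
    and "\<forall>t s. 0 \<le> t \<and> t \<le> s \<and> s \<le> T \<longrightarrow> (AE \<omega> in M. \<psi> t \<omega> \<ge> \<psi> s \<omega> \<and> \<psi> s \<omega> \<ge> 0)"
    and "adapted_solution M F W T A B \<psi> Y Z"
  shows "AE t in lborel. t \<in> {0..T} \<longrightarrow> (AE \<omega> in M. Y t \<omega> \<ge> 0)"
proof -
  obtain KA KB where KA: "\<forall>t s. 0 \<le> t \<and> t \<le> s \<and> s \<le> T \<longrightarrow> (\<forall>\<omega>\<in>space M. norm (A t s \<omega>) \<le> KA)"
    and KB: "\<forall>s\<in>{0..T}. \<forall>\<omega>\<in>space M. norm (B s \<omega>) \<le> KB"
    using assms(6,7) by blast
  note F = assms(4)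
  have "linear_bsvie M W T (max KA KB) A B \<psi> Y Z"
    unfolding linear_bsvie_def brownian_space_def brownian_space_axioms_def linear_bsvie_axioms_def
  proof (intro conjI allI impI)
    show "\<psi> t \<in> L2_rv M (augmented_filtration M W T)" if "t \<in> {0..T}" for t
      using assms(14) that unfolding continuous_L2_maps_def F by blast
  qed (use assms(1,3,5,8,9,11,12,13,15,16) KA KB in \<open>auto simp: F intro: max.coboundedI1 max.coboundedI2\<close>)
  then have "AE t in Leb 0 T. AE \<omega> in M. Y t \<omega> \<ge> 0" by (rule linear_bsvie.solution_nonneg)
  then show ?thesis by (subst (asm) AE_restrict_space_iff) auto
qed

end
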